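(* Let $d\ge 1$, $k\ge 0$ and let $I_{d,k}\subset\mathbb{K}[x_{ij}\mid i\in\{0,\dots,d\},\ j\in\{0,\dots,k\}]$ be the ideal generated by the $2\times2$ minors of the matrix $X_1$. Then $I_{d,k}$ is differentially perfect. In particular, for all integers $r,s\ge1$ the set $$\Big\{\prod_{i=1}^{l}f_{j_i}^{r_i}\ \Big|\ f_{j_i}^{r_i}\in\mathcal{M}_{r_i+1}(X_{r_i}),\ r_i\ge r,\ \sum_{i=1}^{l}(\deg f_{j_i}^{r_i}-r)=s\Big\}$$ forms a Gröbner basis for the symbolic power $(I_{d,k}^{\{r\}})^{(s)}$ with respect to any diagonal term order.
   Context: $\mathbb{K}$ is an algebraically closed field and $R=\mathbb{K}[\mathbf{x}]$ is the polynomial ring in the $(d+1)(k+1)$ indeterminates $x_{ij}$. For $q\ge0$, $r\ge1$ with $q+r\le d$, $X_{q,r}$ is the $(r+1)\times(k+1)$ matrix whose entry in row $a$, column $b$ ($0\le a\le r$, $0\le b\le k$) is $x_{q+a,b}$, and for $1\le r\le d$, $X_r=\begin{pmatrix}X_{0,r}&X_{1,r}&\cdots&X_{d-r,r}\end{pmatrix}$ is their concatenation. (The ideal $I_{d,k}$ is that of the scroll $\nu_d(\mathbb{P}^1)\times\mathbb{P}^k$.) $\mathcal{M}_t(X)$ is the set of all $t'\times t'$ minors of $X$ for all $t'\ge t$ (possibly empty). In $f_{j_i}^{r_i}$ the superscript is an index, not a power, and $l\ge1$ is arbitrary; the $r_i$ range over values for which $X_{r_i}$ is defined. A diagonal term order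 here is any term order that selects the product of the main diagonal entries as leading monomial of every minor of the matrices $X_r$ (for instance the lexicographic order with $x_{i_1j_1}\prec x_{i_2j_2}$ if $i_1>i_2$, or $i_1=i_2$ and $j_1>j_2$). Symbolic power: $I^{(r)}=(R_I^{-1}I^r)\cap R$, where $R_I$ is the complement of the union of the minimal primes of $I$. Join and secant ideals: $I\ast J=\big(I(\mathbf{y})+J(\mathbf{z})+\langle x_a-y_a-z_a\mid a\rangle\big)\cap\mathbb{K}[\mathbf{x}]$ ($a$ running over the indices of the variables), where $I(\mathbf{y})$ is $I$ with $y_a$ substituted for $x_a$; the $r$-th secant ideal is the $r$-fold join $I^{\{r\}}=I\ast\cdots\ast I$ (so $I^{\{1\}}=I$). An ideal $I$ is $r$-differentially perfect if for all $s\ge1$, $(I^{\{r\}})^{(s)}=I^{\{r+s-1\}}+\sum_{i=1}^{s-1}(I^{\{r\}})^{(i)}(I^{\{r\}})^{(s-i)}$; it is differentially perfect if it is $r$-differentially perfect for all $r\ge1$. *)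

theory Defs
  imports
    "HOL-Library.Poly_Mapping"
    "HOL-Computational_Algebra.Polynomial"
    "HOL-Algebra.Ideal_Product"
    "Jordan_Normal_Form.Determinant"
    "Jordan_Normal_Form.DL_Submatrix"
begin

section \<open>Multivariate polynomials\<close>

type_synonym 'v monomial = "'v \<Rightarrow>\<^sub>0 nat"
type_synonym ('v, 'a) mpoly = "'v monomial \<Rightarrow>\<^sub>0 'a"

definition Var :: "'v \<Rightarrow> ('v, 'a::comm_ring_1) mpoly" where
  "Var v = Poly_Mapping.single (Poly_Mapping.single v 1) 1"

definition vars :: "('v, 'a::zero) mpoly \<Rightarrow> 'v set" where
  "vars p = (\<Union>m\<in>Poly_Mapping.keys p. Poly_Mapping.keys m)"

definition total_degree :: "('v, 'a::zero) mpoly \<Rightarrow> nat" where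
  "total_degree p =
     Max (insert 0 ((\<lambda>m. \<Sum>v\<in>Poly_Mapping.keys m. Poly_Mapping.lookup m v) ` Poly_Mapping.keys p))"

definition mpoly_ring :: "'v set \<Rightarrow> ('v, 'a::comm_ring_1) mpoly ring" where
  "mpoly_ring V = \<lparr> carrier = {p. vars p \<subseteq> V}, monoid.mult = (*), monoid.one = 1,
     ring.zero = 0, ring.add = (+) \<rparr>"

text \<open>The substitution homomorphism that fixes constants and maps each variable \<open>v\<close> to \<open>\<sigma> v\<close>.\<close>

definition subst_vars ::
  "('v \<Rightarrow> ('w, 'a) mpoly) \<Rightarrow> ('v, 'a::comm_ring_1) mpoly \<Rightarrow> ('w, 'a) mpoly" where
  "subst_vars \<sigma> p = (\<Sum>m\<in>Poly_Mapping.keys p. Poly_Mapping.single 0 (Poly_Mapping.lookup p m) *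
     (\<Prod>v\<in>Poly_Mapping.keys m. \<sigma> v ^ Poly_Mapping.lookup m v))"


section \<open>Symbolic powers\<close>

definition minimal_primes :: "('a, 'b) ring_scheme \<Rightarrow> 'a set \<Rightarrow> 'a set set" where
  "minimal_primes R I = {P. primeideal P R \<and> I \<subseteq> P \<and>
     (\<forall>Q. primeideal Q R \<and> I \<subseteq> Q \<and> Q \<subseteq> P \<longrightarrow> Q = P)}"

text \<open>
  With \<open>W\<close> the complement of the union of the minimal primes of \<open>I\<close>, an element \<open>f\<close> lies in the
  symbolic power iff \<open>f/1 = g/u\<close> in the localization \<open>W\<^sup>-\<^sup>1R\<close> for some \<open>g \<in> I\<^sup>s\<close> and \<open>u \<in> W\<close>,
  and this equality of fractions means \<open>v(uf - g) = 0\<close> for some \<open>v \<in> W\<close>.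
\<close>

definition symbolic_power :: "('a, 'b) ring_scheme \<Rightarrow> 'a set \<Rightarrow> nat \<Rightarrow> 'a set" where
  "symbolic_power R I s =
     (let W = carrier R - \<Union>(minimal_primes R I) in
      {f \<in> carrier R. \<exists>g \<in> I [^]\<^bsub>ideals_set R\<^esub> s. \<exists>u\<in>W. \<exists>v\<in>W.
          v \<otimes>\<^bsub>R\<^esub> (u \<otimes>\<^bsub>R\<^esub> f \<ominus>\<^bsub>R\<^esub> g) = \<zero>\<^bsub>R\<^esub>})"


section \<open>Joins, secant ideals, differential perfection\<close>

text \<open>
  The variables of \<open>K[x,y,z]\<close> are the three summands of \<open>V <+> V <+> V\<close>, in this order.
\<close>

abbreviation var_x :: "'v \<Rightarrow> ('v + 'v + 'v, 'a::comm_ring_1) mpoly" where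
  "var_x a \<equiv> Var (Inl a)"
abbreviation var_y :: "'v \<Rightarrow> ('v + 'v + 'v, 'a::comm_ring_1) mpoly" where
  "var_y a \<equiv> Var (Inr (Inl a))"
abbreviation var_z :: "'v \<Rightarrow> ('v + 'v + 'v, 'a::comm_ring_1) mpoly" where
  "var_z a \<equiv> Var (Inr (Inr a))"

definition join_ideal ::
  "'v set \<Rightarrow> ('v, 'a::comm_ring_1) mpoly set \<Rightarrow> ('v, 'a) mpoly set \<Rightarrow> ('v, 'a) mpoly set" where
  "join_ideal V I J = {f \<in> carrier (mpoly_ring V).
     subst_vars var_x f \<in> Idl\<^bsub>mpoly_ring (V <+> V <+> V)\<^esub>
       (subst_vars var_y ` I \<union> subst_vars var_z ` J \<union> {var_x a - var_y a - var_z a | a. a \<in> V})}"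

text \<open>The \<open>r\<close>-fold join, for \<open>r \<ge> 1\<close>; the value at \<open>r = 0\<close> is irrelevant.\<close>

definition secant_ideal ::
  "'v set \<Rightarrow> ('v, 'a::comm_ring_1) mpoly set \<Rightarrow> nat \<Rightarrow> ('v, 'a) mpoly set" where
  "secant_ideal V I r = ((\<lambda>J. join_ideal V J I) ^^ (r - 1)) I"

text \<open>Sums, products and powers of ideals are taken in the semiring \<^const>\<open>ideals_set\<close> of ideals.\<close>

definition diff_perfect_at :: "'v set \<Rightarrow> ('v, 'a::comm_ring_1) mpoly set \<Rightarrow> nat \<Rightarrow> bool" where
  "diff_perfect_at V I r \<longleftrightarrow>
     (let R = mpoly_ring V; J = secant_ideal V I r in
      \<forall>s\<ge>1. symbolic_power R J s =
        secant_ideal V I (r + s - 1) \<oplus>\<^bsub>ideals_set R\<^esub>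
        (\<Oplus>\<^bsub>ideals_set R\<^esub> i \<in> {1..s - 1}.
           symbolic_power R J i \<otimes>\<^bsub>ideals_set R\<^esub> symbolic_power R J (s - i)))"

definition differentially_perfect :: "'v set \<Rightarrow> ('v, 'a::comm_ring_1) mpoly set \<Rightarrow> bool" where
  "differentially_perfect V I \<longleftrightarrow> (\<forall>r\<ge>1. diff_perfect_at V I r)"


section \<open>Term orders and Groebner bases\<close>

text \<open>A pair \<open>(m, n)\<close> in the relation \<open>tord\<close> means that \<open>m\<close> is at most \<open>n\<close>.\<close>

definition term_order_on :: "'v set \<Rightarrow> 'v monomial rel \<Rightarrow> bool" where
  "term_order_on V tord \<longleftrightarrow>
     (let M = {m. Poly_Mapping.keys m \<subseteq> V} in
      linear_order_on M tord \<and> (\<forall>m\<in>M. (0, m) \<in> tord) \<and>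
      (\<forall>m\<in>M. \<forall>n\<in>M. \<forall>u\<in>M. (m, n) \<in> tord \<longrightarrow> (m + u, n + u) \<in> tord))"

definition is_leading_monomial ::
  "'v monomial rel \<Rightarrow> ('v, 'a::zero) mpoly \<Rightarrow> 'v monomial \<Rightarrow> bool" where
  "is_leading_monomial tord p m \<longleftrightarrow>
     m \<in> Poly_Mapping.keys p \<and> (\<forall>n\<in>Poly_Mapping.keys p. (n, m) \<in> tord)"

definition leading_monomials ::
  "'v monomial rel \<Rightarrow> ('v, 'a::comm_ring_1) mpoly set \<Rightarrow> ('v, 'a) mpoly set" where
  "leading_monomials tord S =
     {Poly_Mapping.single m 1 | m p. p \<in> S \<and> is_leading_monomial tord p m}"

definition groebner_basis ::
  "'v set \<Rightarrow> 'v monomial rel \<Rightarrow> ('v, 'a::comm_ring_1) mpoly set \<Rightarrow> ('v, 'a) mpoly set \<Rightarrow> bool" where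
  "groebner_basis V tord G I \<longleftrightarrow> finite G \<and> G \<subseteq> I \<and>
     Idl\<^bsub>mpoly_ring V\<^esub> (leading_monomials tord G) = Idl\<^bsub>mpoly_ring V\<^esub> (leading_monomials tord I)"


section \<open>Minors and scroll matrices\<close>

definition minors :: "nat \<Rightarrow> 'a::comm_ring_1 mat \<Rightarrow> 'a set" where
  "minors t A = {det (submatrix A S T) | S T.
     S \<subseteq> {..<dim_row A} \<and> T \<subseteq> {..<dim_col A} \<and> card S = t \<and> card T = t}"

definition minors_ge :: "nat \<Rightarrow> 'a::comm_ring_1 mat \<Rightarrow> 'a set" where
  "minors_ge t A = (\<Union>t'\<in>{t..}. minors t' A)"

definition scroll_vars :: "nat \<Rightarrow> nat \<Rightarrow> (nat \<times> nat) set" where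
  "scroll_vars d k = {..d} \<times> {..k}"

text \<open>
  The concatenation of the \<open>(r+1) \<times> (k+1)\<close> blocks with entries \<open>x\<^sub>q\<^sub>+\<^sub>a\<^sub>,\<^sub>b\<close> for \<open>q = 0, \<dots>, d - r\<close>,
  where \<open>1 \<le> r \<le> d\<close>: column \<open>b\<close> of block \<open>q\<close> is column \<open>c = q(k+1) + b\<close> of the whole matrix.
\<close>

definition scroll_mat :: "nat \<Rightarrow> nat \<Rightarrow> nat \<Rightarrow> (nat \<times> nat, 'a::comm_ring_1) mpoly mat" where
  "scroll_mat d k r = mat (r + 1) ((d - r + 1) * (k + 1))
     (\<lambda>(a, c). Var (c div (k + 1) + a, c mod (k + 1)))"

definition scroll_ideal :: "nat \<Rightarrow> nat \<Rightarrow> (nat \<times> nat, 'a::comm_ring_1) mpoly set" where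
  "scroll_ideal d k = Idl\<^bsub>mpoly_ring (scroll_vars d k)\<^esub> (minors 2 (scroll_mat d k 1))"

definition diagonal_term_order ::
  "'v set \<Rightarrow> ('v, 'a::comm_ring_1) mpoly mat set \<Rightarrow> 'v monomial rel \<Rightarrow> bool" where
  "diagonal_term_order V As tord \<longleftrightarrow> term_order_on V tord \<and>
     (\<forall>A\<in>As. \<forall>S T. S \<subseteq> {..<dim_row A} \<and> T \<subseteq> {..<dim_col A} \<and> card S = card T \<longrightarrow>
        (\<exists>m. prod_list (diag_mat (submatrix A S T)) = Poly_Mapping.single m 1 \<and>
             is_leading_monomial tord (det (submatrix A S T)) m))"

end

theory Submission
  imports Defs "HOL-Library.Product_Lexorder" "HOL-Library.Multiset"
begin

text \<open>
  The \<open>r\<close>-th secant ideal is the kernel \<open>J\<close> of the parametrization of the secant variety by sums of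
  \<open>r\<close> points of the scroll; it is prime. Adding an independent variable \<open>w\<^sub>i\<^sub>j\<close> to each coordinate of
  the parametrization turns the order of vanishing along the variety into the order in the \<open>w\<^sub>i\<^sub>j\<close>,
  so every polynomial in the symbolic power \<open>J\<^sup>(\<^sup>s\<^sup>)\<close> has order at least \<open>s\<close>.

  Number the variables row by row and call a sequence of positions with gaps larger than \<open>k + 1\<close> a
  chain: chains of length \<open>\<rho> + 1\<close> are the main diagonals of the maximal minors of \<open>X\<^sub>\<rho>\<close>. Modulo the
  equations of the scroll a monomial can be moved into a window of \<open>k + 2\<close> consecutive positions,
  and each move makes it smaller in a diagonal order. Hence if \<open>r\<close> windows cover part of a leading
  monomial, the monomial in the parameters that represents this part, times the \<open>w\<close>-monomial of the
  rest, can arise only from that leading monomial and in one way only, so it occurs with a nonzero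
  coefficient: for a polynomial of order at least \<open>s\<close> the rest has degree at least \<open>s\<close>. By
  Greene--Kleitman duality for unit interval orders, the leading monomial is then divisible by a
  product of disjoint chains of lengths \<open>l\<^sub>i\<close> with \<open>\<Sum>(l\<^sub>i - r) = s\<close>.

  Conversely, block elimination shows that a minor of size \<open>r + q\<close> lies in \<open>J\<^sup>(\<^sup>q\<^sup>)\<close>. So the products
  of minors belonging to such families of chains lie in \<open>J\<^sup>(\<^sup>s\<^sup>)\<close> and generate its initial ideal. They
  generate \<open>J\<^sup>(\<^sup>s\<^sup>)\<close> itself by division; factors of the products give differential perfection.
\<close>

section \<open>Polynomials as poly mappings\<close>

text \<open>The number \<open>k + 2\<close> enters twice, and the proof rests on this coincidence.
  Consecutive diagonal entries of a minor are at least \<open>k + 2\<close> positions apart, so an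
  antichain of the gap relation is a set inside \<open>k + 2\<close> consecutive positions. In such
  a window a toric class has only one monomial: only the two end positions have the same column
  index, and the sum of the row indices decides how often each of them occurs. So the windows
  provided by the duality are exactly places where toric normal forms live.

  That polynomials of order at least \<open>s\<close> lie in the symbolic power is not attacked
  directly. Their leading monomials are divisible by those of products of chain minors, so division
  puts them into every ideal that contains these products. For the symbolic power this gives the
  missing inclusion, and for the right-hand side of differential perfection the main one.

  Division uses one fixed order in which only finitely many monomials lie below a given one. For an
  arbitrary diagonal order leading monomials are compared, but nothing is reduced.\<close>

abbreviation "lookup \<equiv> Poly_Mapping.lookup"
abbreviation "keys \<equiv> Poly_Mapping.keys"
abbreviation "single \<equiv> Poly_Mapping.single"

lemma sum_singles: "p = (\<Sum>m\<in>keys p. single m (lookup p m))"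
proof (rule poly_mapping_eqI)
  fix k
  have "(\<Sum>m\<in>keys p. lookup (single m (lookup p m)) k) = (\<Sum>m\<in>keys p. if m = k then lookup p m else 0)"
    by (intro sum.cong) (auto simp: lookup_single when_def)
  also have "\<dots> = lookup p k"
    by (simp add: in_keys_iff)
  finally show "lookup p k = lookup (\<Sum>m\<in>keys p. single m (lookup p m)) k"
    by (simp add: lookup_sum)
qed

lemma keys_nat_add: "keys (a + b :: 'v monomial) = keys a \<union> keys b"
  by (auto simp: in_keys_iff lookup_add)

definition monom_eval :: "('v \<Rightarrow> 'b::comm_semiring_1) \<Rightarrow> 'v monomial \<Rightarrow> 'b" where
  "monom_eval \<sigma> m = (\<Prod>v\<in>keys m. \<sigma> v ^ lookup m v)"

lemma monom_eval_superset:
  assumes "finite S" "keys m \<subseteq> S"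
  shows "monom_eval \<sigma> m = (\<Prod>v\<in>S. \<sigma> v ^ lookup m v)"
  unfolding monom_eval_def
  by (rule prod.mono_neutral_left) (use assms in \<open>auto simp: in_keys_iff\<close>)

lemma monom_eval_0 [simp]: "monom_eval \<sigma> 0 = 1"
  by (simp add: monom_eval_def)

lemma monom_eval_add: "monom_eval \<sigma> (m + n) = monom_eval \<sigma> m * monom_eval \<sigma> n"
proof -
  let ?S = "keys m \<union> keys n"
  have "monom_eval \<sigma> (m + n) = (\<Prod>v\<in>?S. \<sigma> v ^ lookup (m + n) v)"
    by (rule monom_eval_superset) (auto simp: keys_nat_add)
  also have "\<dots> = (\<Prod>v\<in>?S. \<sigma> v ^ lookup m v) * (\<Prod>v\<in>?S. \<sigma> v ^ lookup n v)"
    by (simp add: lookup_add power_add prod.distrib)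
  finally show ?thesis
    by (simp add: monom_eval_superset[of ?S])
qed

lemma monom_eval_single [simp]: "monom_eval \<sigma> (single v e) = \<sigma> v ^ e"
  by (simp add: monom_eval_def)

lemma subst_vars_superset:
  assumes "finite S" "keys p \<subseteq> S"
  shows "subst_vars \<sigma> p = (\<Sum>m\<in>S. single 0 (lookup p m) * monom_eval \<sigma> m)"
  unfolding subst_vars_def monom_eval_def[symmetric]
  by (rule sum.mono_neutral_left) (use assms in \<open>auto simp: in_keys_iff\<close>)

lemma subst_vars_0 [simp]: "subst_vars \<sigma> 0 = 0"
  by (simp add: subst_vars_def)

lemma subst_vars_add: "subst_vars \<sigma> (p + q) = subst_vars \<sigma> p + subst_vars \<sigma> q"
proof -
  let ?S = "keys p \<union> keys q"
  have "subst_vars \<sigma> (p + q) = (\<Sum>m\<in>?S. single 0 (lookup (p + q) m) * monom_eval \<sigma> m)"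
    by (rule subst_vars_superset) (auto simp: Poly_Mapping.keys_add)
  also have "\<dots> = (\<Sum>m\<in>?S. single 0 (lookup p m) * monom_eval \<sigma> m)
      + (\<Sum>m\<in>?S. single 0 (lookup q m) * monom_eval \<sigma> m)"
    by (simp add: lookup_add single_add distrib_right sum.distrib)
  finally show ?thesis
    by (simp add: subst_vars_superset[of ?S])
qed

lemma subst_vars_sum: "subst_vars \<sigma> (\<Sum>x\<in>A. f x) = (\<Sum>x\<in>A. subst_vars \<sigma> (f x))"
  by (induction A rule: infinite_finite_induct) (simp_all add: subst_vars_add)

lemma subst_vars_single: "subst_vars \<sigma> (single m c) = single 0 c * monom_eval \<sigma> m"
  by (subst subst_vars_superset[of "{m}"]) (auto split: if_splits)

lemma subst_vars_mult: "subst_vars \<sigma> (p * q) = subst_vars \<sigma> p * subst_vars \<sigma> q"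
proof -
  have s: "subst_vars \<sigma> (single m c * single n e)
      = subst_vars \<sigma> (single m c) * subst_vars \<sigma> (single n e)" for m n c e
    by (simp add: mult_single subst_vars_single monom_eval_add) (simp add: mult_single[of 0 c 0 e, simplified, symmetric] ac_simps)
  have "p * q = (\<Sum>m\<in>keys p. \<Sum>n\<in>keys q. single m (lookup p m) * single n (lookup q n))"
    by (subst sum_singles[of p], subst sum_singles[of q]) (simp add: sum_product)
  also have "subst_vars \<sigma> \<dots> = subst_vars \<sigma> (\<Sum>m\<in>keys p. single m (lookup p m))
      * subst_vars \<sigma> (\<Sum>n\<in>keys q. single n (lookup q n))"
    by (simp only: subst_vars_sum s sum_product)
  finally show ?thesis
    by (simp only: sum_singles[symmetric])
qed

lemma subst_vars_const [simp]: "subst_vars \<sigma> (single 0 c) = single 0 c"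
  by (simp add: subst_vars_single)

lemma subst_vars_1 [simp]: "subst_vars \<sigma> 1 = 1"
  using subst_vars_const[of \<sigma> 1] by simp

lemma subst_vars_uminus: "subst_vars \<sigma> (- p) = - subst_vars \<sigma> p"
  using subst_vars_add[of \<sigma> p "- p"] by (simp add: eq_neg_iff_add_eq_0 add.commute)

lemma subst_vars_diff: "subst_vars \<sigma> (p - q) = subst_vars \<sigma> p - subst_vars \<sigma> q"
  using subst_vars_add[of \<sigma> p "- q"] by (simp add: subst_vars_uminus)

lemma subst_vars_Var [simp]: "subst_vars \<sigma> (Var v) = \<sigma> v"
  by (simp add: Var_def subst_vars_single)

lemma subst_vars_power: "subst_vars \<sigma> (p ^ n) = subst_vars \<sigma> p ^ n"
  by (induction n) (simp_all add: subst_vars_mult)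

lemma subst_vars_prod: "subst_vars \<sigma> (\<Prod>x\<in>A. f x) = (\<Prod>x\<in>A. subst_vars \<sigma> (f x))"
  by (induction A rule: infinite_finite_induct) (simp_all add: subst_vars_mult)

lemma subst_vars_comp: "subst_vars \<sigma> (subst_vars \<tau> p) = subst_vars (\<lambda>v. subst_vars \<sigma> (\<tau> v)) p"
  by (simp add: subst_vars_def[of \<tau>] subst_vars_def[of "\<lambda>v. subst_vars \<sigma> (\<tau> v)"] subst_vars_sum
      subst_vars_mult subst_vars_prod subst_vars_power)

lemma subst_vars_cong:
  assumes "\<And>v. v \<in> vars p \<Longrightarrow> \<sigma> v = \<tau> v"
  shows "subst_vars \<sigma> p = subst_vars \<tau> p"
proof -
  have "\<sigma> v = \<tau> v" if "m \<in> keys p" "v \<in> keys m" for m v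
    using that assms by (auto simp: vars_def)
  then show ?thesis
    unfolding subst_vars_def by (intro sum.cong prod.cong arg_cong2[of _ _ _ _ "(*)"] refl) simp
qed

lemma single_power: "single m (c::'a::comm_ring_1) ^ n = single (\<Sum>_\<in>{..<n}. m) (c ^ n)"
  by (induction n) (simp_all add: mult_single add.commute)

lemma monom_eval_Var: "monom_eval Var m = (single m 1 :: ('v, 'a::comm_ring_1) mpoly)"
proof -
  have P: "(\<Prod>v\<in>S. single (g v) 1) = (single (\<Sum>v\<in>S. g v) 1 :: ('v, 'a) mpoly)"
    if "finite S" for S and g :: "'v \<Rightarrow> 'v monomial"
    using that by induction (simp_all add: mult_single)
  have e: "(\<Sum>_\<in>{..<n}. single v 1) = single v n" for v :: 'v and n :: nat
    by (induction n) (simp_all add: single_add[symmetric])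
  show ?thesis
    unfolding monom_eval_def Var_def single_power
    by (simp add: P e[simplified] sum_singles[symmetric])
qed

lemma subst_vars_self: "subst_vars Var p = p"
proof -
  have "subst_vars Var p = (\<Sum>m\<in>keys p. single 0 (lookup p m) * single m 1)"
    unfolding subst_vars_def monom_eval_def[symmetric] monom_eval_Var ..
  also have "\<dots> = p"
    by (simp add: mult_single sum_singles[symmetric])
  finally show ?thesis .
qed

subsection \<open>Variables\<close>

lemma vars_0 [simp]: "vars 0 = {}"
  by (simp add: vars_def)

lemma vars_const [simp]: "vars (single 0 c) = {}"
  by (auto simp: vars_def split: if_splits)

lemma vars_1 [simp]: "vars (1 :: ('v, 'a::comm_ring_1) mpoly) = {}"
  using vars_const[of "1 :: 'a"] by (simp del: vars_const)

lemma vars_single: "vars (single m c) \<subseteq> keys m"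
  by (auto simp: vars_def split: if_splits)

lemma vars_Var [simp]: "vars (Var v :: ('v, 'a::comm_ring_1) mpoly) = {v}"
  by (auto simp: vars_def Var_def)

lemma vars_add: "vars (p + q) \<subseteq> vars p \<union> vars q"
  using Poly_Mapping.keys_add[of p q] by (auto simp: vars_def)

lemma vars_uminus [simp]: "vars (- p) = vars (p :: ('v, 'a::comm_ring_1) mpoly)"
  by (simp add: vars_def in_keys_iff set_eq_iff)

lemma vars_diff: "vars (p - q) \<subseteq> vars p \<union> vars (q :: ('v, 'a::comm_ring_1) mpoly)"
  using vars_add[of p "- q"] by simp

lemma vars_mult: "vars (p * q) \<subseteq> vars p \<union> vars q"
proof
  fix v assume "v \<in> vars (p * q)"
  then obtain m where m: "m \<in> keys (p * q)" "v \<in> keys m" by (auto simp: vars_def)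
  then obtain a b where "m = a + b" "a \<in> keys p" "b \<in> keys q"
    using Poly_Mapping.keys_mult[of p q] by auto
  then show "v \<in> vars p \<union> vars q"
    using m by (auto simp: vars_def keys_nat_add)
qed

lemma vars_add_sub: "vars p \<subseteq> V \<Longrightarrow> vars q \<subseteq> V \<Longrightarrow> vars (p + q) \<subseteq> V"
  using vars_add[of p q] by blast

lemma vars_diff_sub: "vars p \<subseteq> V \<Longrightarrow> vars q \<subseteq> V \<Longrightarrow> vars (p - q :: ('v, 'a::comm_ring_1) mpoly) \<subseteq> V"
  using vars_diff[of p q] by blast

lemma vars_mult_sub: "vars p \<subseteq> V \<Longrightarrow> vars q \<subseteq> V \<Longrightarrow> vars (p * q) \<subseteq> V"
  using vars_mult[of p q] by blast

lemma vars_sum_sub: "(\<And>x. x \<in> A \<Longrightarrow> vars (f x) \<subseteq> V) \<Longrightarrow> vars (\<Sum>x\<in>A. f x) \<subseteq> V"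
  by (induction A rule: infinite_finite_induct) (simp_all add: vars_add_sub)

lemma vars_prod_sub: "(\<And>x. x \<in> A \<Longrightarrow> vars (f x) \<subseteq> V) \<Longrightarrow> vars (\<Prod>x\<in>A. f x :: ('v, 'a::comm_ring_1) mpoly) \<subseteq> V"
  by (induction A rule: infinite_finite_induct) (simp_all add: vars_mult_sub)

lemma vars_power_sub: "vars p \<subseteq> V \<Longrightarrow> vars (p ^ n :: ('v, 'a::comm_ring_1) mpoly) \<subseteq> V"
  by (induction n) (simp_all add: vars_mult_sub)

lemma vars_single_sub: "keys m \<subseteq> V \<Longrightarrow> vars (single m c) \<subseteq> V"
  using vars_single[of m c] by blast

lemma vars_subst_sub:
  assumes "\<And>v. v \<in> vars p \<Longrightarrow> vars (\<sigma> v) \<subseteq> V"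
  shows "vars (subst_vars \<sigma> p) \<subseteq> V"
  unfolding subst_vars_def
  by (intro vars_sum_sub vars_mult_sub vars_prod_sub vars_power_sub assms)
     (auto simp: vars_def)

lemma keys_sub_vars: "m \<in> keys p \<Longrightarrow> vars p \<subseteq> V \<Longrightarrow> keys m \<subseteq> V"
  by (auto simp: vars_def)

subsection \<open>The polynomial ring\<close>

lemma mpoly_ring_simps [simp]:
  "carrier (mpoly_ring V) = {p. vars p \<subseteq> V}"
  "p \<otimes>\<^bsub>mpoly_ring V\<^esub> q = p * q" "\<one>\<^bsub>mpoly_ring V\<^esub> = 1"
  "\<zero>\<^bsub>mpoly_ring V\<^esub> = 0" "p \<oplus>\<^bsub>mpoly_ring V\<^esub> q = p + q"
  by (simp_all add: mpoly_ring_def)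

lemma cring_mpoly: "cring (mpoly_ring V :: ('v, 'a::comm_ring_1) mpoly ring)"
proof (rule cringI)
  show "abelian_group (mpoly_ring V :: ('v, 'a) mpoly ring)"
  proof (rule abelian_groupI)
    fix x :: "('v, 'a) mpoly" assume "x \<in> carrier (mpoly_ring V)"
    then show "\<exists>y\<in>carrier (mpoly_ring V). y \<oplus>\<^bsub>mpoly_ring V\<^esub> x = \<zero>\<^bsub>mpoly_ring V\<^esub>"
      by (intro bexI[of _ "- x"]) auto
  qed (simp_all add: vars_add_sub ac_simps)
  show "Group.comm_monoid (mpoly_ring V :: ('v, 'a) mpoly ring)"
    by (rule comm_monoidI) (simp_all add: vars_mult_sub ac_simps)
qed (simp add: distrib_right)

lemma ring_mpoly: "ring (mpoly_ring V :: ('v, 'a::comm_ring_1) mpoly ring)"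
  using cring_mpoly by (rule cring.axioms(1))

lemma mpoly_ring_minus [simp]:
  fixes q :: "('v, 'a::comm_ring_1) mpoly"
  assumes "vars q \<subseteq> V"
  shows "\<ominus>\<^bsub>mpoly_ring V\<^esub> q = - q" "p \<ominus>\<^bsub>mpoly_ring V\<^esub> q = p - q"
proof -
  interpret ring "mpoly_ring V :: ('v, 'a) mpoly ring" by (rule ring_mpoly)
  show *: "\<ominus>\<^bsub>mpoly_ring V\<^esub> q = - q"
    by (rule minus_equality) (use assms in auto)
  show "p \<ominus>\<^bsub>mpoly_ring V\<^esub> q = p - q"
    by (simp add: a_minus_def *)
qed

lemma ideal_mpolyI:
  fixes Q :: "('v, 'a::comm_ring_1) mpoly set"
  assumes "\<And>p. p \<in> Q \<Longrightarrow> vars p \<subseteq> V" "0 \<in> Q" "\<And>p q. p \<in> Q \<Longrightarrow> q \<in> Q \<Longrightarrow> p + q \<in> Q"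
    and m: "\<And>p q. vars p \<subseteq> V \<Longrightarrow> q \<in> Q \<Longrightarrow> p * q \<in> Q"
  shows "ideal Q (mpoly_ring V)"
proof (rule idealI)
  show "ring (mpoly_ring V :: ('v, 'a) mpoly ring)" by (rule ring_mpoly)
  have neg: "- p \<in> Q" if "p \<in> Q" for p
    using m[of "-1" p] that by simp
  have one: "(1 :: ('v, 'a) mpoly) \<in> carrier (mpoly_ring V)" by simp
  interpret R: ring "mpoly_ring V :: ('v, 'a) mpoly ring" by (rule ring_mpoly)
  show "subgroup Q (add_monoid (mpoly_ring V))"
  proof (rule R.add.subgroupI)
    show "\<ominus>\<^bsub>mpoly_ring V\<^esub> a \<in> Q" if a: "a \<in> Q" for a
      using neg[OF a] assms(1)[OF a] by simp
    show "Q \<noteq> {}" using assms(2) by blast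
  qed (use assms(1,3) in \<open>simp_all add: subset_iff\<close>)
  fix a x :: "('v, 'a) mpoly" assume "a \<in> Q" "x \<in> carrier (mpoly_ring V)"
  then show "x \<otimes>\<^bsub>mpoly_ring V\<^esub> a \<in> Q" "a \<otimes>\<^bsub>mpoly_ring V\<^esub> x \<in> Q"
    using m[of x a] by (simp_all add: mult.commute)
qed

context
  fixes Q :: "('v, 'a::comm_ring_1) mpoly set" and V
  assumes Q: "ideal Q (mpoly_ring V)"
begin

lemma mpoly_ideal_sub: "p \<in> Q \<Longrightarrow> vars p \<subseteq> V"
  using ideal.Icarr[OF Q] by auto

lemma mpoly_ideal_0: "0 \<in> Q"
  using additive_subgroup.zero_closed[OF ideal.axioms(1)[OF Q]] by simp

lemma mpoly_ideal_add: "p \<in> Q \<Longrightarrow> q \<in> Q \<Longrightarrow> p + q \<in> Q"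
  using additive_subgroup.a_closed[OF ideal.axioms(1)[OF Q], of p q] by simp

lemma mpoly_ideal_mult: "vars p \<subseteq> V \<Longrightarrow> q \<in> Q \<Longrightarrow> p * q \<in> Q"
  using ideal.I_l_closed[OF Q, of q p] by simp

lemma mpoly_ideal_mult': "vars p \<subseteq> V \<Longrightarrow> q \<in> Q \<Longrightarrow> q * p \<in> Q"
  using mpoly_ideal_mult by (simp add: mult.commute)

lemma mpoly_ideal_uminus: "p \<in> Q \<Longrightarrow> - p \<in> Q"
  using mpoly_ideal_mult[of "-1" p] by simp

lemma mpoly_ideal_diff: "p \<in> Q \<Longrightarrow> q \<in> Q \<Longrightarrow> p - q \<in> Q"
  using mpoly_ideal_add[of p "- q"] mpoly_ideal_uminus[of q] by simp

lemma mpoly_ideal_sum: "(\<And>x. x \<in> A \<Longrightarrow> f x \<in> Q) \<Longrightarrow> (\<Sum>x\<in>A. f x) \<in> Q"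
  by (induction A rule: infinite_finite_induct) (simp_all add: mpoly_ideal_0 mpoly_ideal_add)

end

lemma ideal_preimage:
  fixes Q :: "('w, 'a::comm_ring_1) mpoly set" and \<sigma> :: "'v \<Rightarrow> ('w, 'a) mpoly"
  assumes Q: "ideal Q (mpoly_ring W)" and s: "\<And>v. v \<in> V \<Longrightarrow> vars (\<sigma> v) \<subseteq> W"
  shows "ideal {p. vars p \<subseteq> V \<and> subst_vars \<sigma> p \<in> Q} (mpoly_ring V)"
proof (rule ideal_mpolyI)
  fix p q :: "('v, 'a) mpoly" assume pq: "vars p \<subseteq> V" "q \<in> {p. vars p \<subseteq> V \<and> subst_vars \<sigma> p \<in> Q}"
  have "vars (subst_vars \<sigma> p) \<subseteq> W"
    using pq s by (intro vars_subst_sub) blast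
  then show "p * q \<in> {p. vars p \<subseteq> V \<and> subst_vars \<sigma> p \<in> Q}"
    using pq mpoly_ideal_mult[OF Q] by (simp add: vars_mult_sub subst_vars_mult)
qed (simp_all add: mpoly_ideal_0[OF Q] vars_add_sub subst_vars_add mpoly_ideal_add[OF Q])

lemma ideal_kernel:
  "ideal {p :: ('v, 'a::comm_ring_1) mpoly. vars p \<subseteq> V \<and> subst_vars \<sigma> p = 0} (mpoly_ring V)"
  by (rule ideal_mpolyI) (simp_all add: vars_add_sub vars_mult_sub subst_vars_add subst_vars_mult)

text \<open>The target is an integral domain, so the kernel is prime. The linear order on the target
  variables makes its monomials an ordered monoid, which is what puts the polynomial type into
  \<open>idom\<close>.\<close>

lemma primeideal_kernel:
  fixes \<sigma> :: "'v \<Rightarrow> ('w::linorder, 'a::idom) mpoly"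
  shows "primeideal {p :: ('v, 'a) mpoly. vars p \<subseteq> V \<and> subst_vars \<sigma> p = 0} (mpoly_ring V)"
proof (rule primeidealI[OF ideal_kernel cring_mpoly])
  have "1 \<in> carrier (mpoly_ring V) - {p. vars p \<subseteq> V \<and> subst_vars \<sigma> p = 0}"
    by simp
  then show "carrier (mpoly_ring V) \<noteq> {p. vars p \<subseteq> V \<and> subst_vars \<sigma> p = 0}"
    by blast
qed (auto simp: subst_vars_mult)

lemma Idl_least: "ideal Q (mpoly_ring V) \<Longrightarrow> S \<subseteq> Q \<Longrightarrow> Idl\<^bsub>mpoly_ring V\<^esub> S \<subseteq> Q"
  by (auto simp: genideal_def)

lemma Idl_self: "p \<in> S \<Longrightarrow> p \<in> Idl\<^bsub>R\<^esub> S"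
  by (auto simp: genideal_def)

lemma Idl_ideal:
  "S \<subseteq> {p. vars p \<subseteq> V} \<Longrightarrow> ideal (Idl\<^bsub>mpoly_ring V\<^esub> S) (mpoly_ring V :: ('v, 'a::comm_ring_1) mpoly ring)"
  using ring.genideal_ideal[OF ring_mpoly[of V]] by simp

text \<open>Congruence modulo an ideal passes from the variables to sums and products. In the join
  it trades \<open>x\<close> for \<open>y + z\<close>.\<close>

lemma ideal_subst_vars_diff:
  fixes Q :: "('w, 'a::comm_ring_1) mpoly set"
  assumes Q: "ideal Q (mpoly_ring W)"
    and d: "\<And>v. v \<in> V \<Longrightarrow> \<sigma> v - \<tau> v \<in> Q" and s: "\<And>v. v \<in> V \<Longrightarrow> vars (\<sigma> v) \<subseteq> W"
    and t: "\<And>v. v \<in> V \<Longrightarrow> vars (\<tau> v) \<subseteq> W" and p: "vars p \<subseteq> V"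
  shows "subst_vars \<sigma> p - subst_vars \<tau> p \<in> Q"
proof -
  have mult: "a * b - a' * b' \<in> Q" if aq: "a - a' \<in> Q" "b - b' \<in> Q" "vars a' \<subseteq> W" "vars b \<subseteq> W" for a b a' b'
  proof -
    have "a * b - a' * b' = (a - a') * b + a' * (b - b')" by (simp add: algebra_simps)
    then show ?thesis
      using that by (simp add: mpoly_ideal_add[OF Q] mpoly_ideal_mult[OF Q] mpoly_ideal_mult'[OF Q])
  qed
  have pow: "a ^ n - a' ^ n \<in> Q" if "a - a' \<in> Q" "vars a \<subseteq> W" "vars a' \<subseteq> W" for a a' and n :: nat
    by (induction n) (simp_all add: mpoly_ideal_0[OF Q] mult that vars_power_sub)
  have prd: "(\<Prod>v\<in>S. f v) - (\<Prod>v\<in>S. g v) \<in> Q"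
    if "finite S" "\<And>v. v \<in> S \<Longrightarrow> f v - g v \<in> Q" "\<And>v. v \<in> S \<Longrightarrow> vars (f v) \<subseteq> W"
      "\<And>v. v \<in> S \<Longrightarrow> vars (g v) \<subseteq> W" for S and f g :: "'v \<Rightarrow> ('w, 'a) mpoly"
    using that by (induction S) (simp_all add: mpoly_ideal_0[OF Q] mult vars_prod_sub)
  have "subst_vars \<sigma> p - subst_vars \<tau> p = (\<Sum>m\<in>keys p. single 0 (lookup p m) *
     ((\<Prod>v\<in>keys m. \<sigma> v ^ lookup m v) - (\<Prod>v\<in>keys m. \<tau> v ^ lookup m v)))"
    by (simp add: subst_vars_def sum_subtractf right_diff_distrib)
  also have "\<dots> \<in> Q"
  proof (intro mpoly_ideal_sum[OF Q] mpoly_ideal_mult[OF Q] prd pow)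
    fix m v assume "m \<in> keys p" "v \<in> keys m"
    then have "v \<in> V" using p by (auto simp: vars_def)
    then show "\<sigma> v - \<tau> v \<in> Q" "vars (\<sigma> v) \<subseteq> W" "vars (\<tau> v) \<subseteq> W"
      "vars (\<sigma> v ^ lookup m v) \<subseteq> W" "vars (\<tau> v ^ lookup m v) \<subseteq> W"
      using d s t by (simp_all add: vars_power_sub)
  qed auto
  finally show ?thesis .
qed

section \<open>Chains and windows\<close>

text \<open>The order relation \<open>a + L \<le> b\<close> is a unit interval order: its antichains are the sets that lie
  in a window of \<open>L\<close> consecutive numbers.\<close>

definition chain :: "nat \<Rightarrow> nat list \<Rightarrow> bool" where
  "chain L c \<longleftrightarrow> sorted_wrt (\<lambda>a b. a + L \<le> b) c"

text \<open>Labels below \<open>r\<close> name the window to which a number is assigned; any other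
  label marks the number as left over. With one label per number, overlapping windows cause no
  double counting.\<close>

definition window_label :: "nat \<Rightarrow> nat \<Rightarrow> (nat \<Rightarrow> nat) \<Rightarrow> (nat \<Rightarrow> nat) \<Rightarrow> bool" where
  "window_label L r w lab \<longleftrightarrow> (\<forall>n. lab n < r \<longrightarrow> w (lab n) \<le> n \<and> n < w (lab n) + L)"

text \<open>The duality is proved for all initial segments at once: a window placed at the end
  leaves an initial segment to the other windows.\<close>

definition below :: "nat \<Rightarrow> nat list \<Rightarrow> nat list" where
  "below b = filter (\<lambda>n. n < b)"

lemma below_simps [simp]: "below b [] = []" "below b (x # xs) = (if x < b then x # below b xs else below b xs)"
  "below b (xs @ ys) = below b xs @ below b ys"
  by (simp_all add: below_def)

lemma below_id: "(\<And>x. x \<in> set xs \<Longrightarrow> x < b) \<Longrightarrow> below b xs = xs"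
  by (auto simp: below_def filter_id_conv)

lemma chain_snoc: "chain L (c @ [x]) \<longleftrightarrow> chain L c \<and> (\<forall>y\<in>set c. y + L \<le> x)"
  by (auto simp: chain_def sorted_wrt_append)

lemma chain_last_le:
  assumes "chain L c" "y \<in> set c" shows "y \<le> last c"
proof -
  have "c \<noteq> []" using assms(2) by auto
  then have "chain L (butlast c @ [last c])" "set c = insert (last c) (set (butlast c))"
    using assms(1) append_butlast_last_id[of c] by (simp_all, metis list.set(2) list.simps(15) rotate1.simps(2) set_rotate1)
  then show ?thesis using assms(2) by (fastforce simp: chain_snoc)
qed

text \<open>The gap \<open>L\<close> leaves room for only one element of \<open>c\<close> in the
  window that ends at \<open>x\<close>, and this is its last one. Cutting it off lowers the bound
  from \<open>r\<close> to \<open>r - 1\<close>, and the window makes up for it.\<close>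

lemma chain_busy:
  assumes c: "chain L c" and L: "L > 0" and len: "r \<le> length c" and r: "r > 0"
    and last: "last c + L > x" and le: "\<And>y. y \<in> set c \<Longrightarrow> y \<le> x"
  shows "min (length c) r \<le> min (length (below (x + 1 - L) c)) (r - 1) + length (filter (\<lambda>n. x + 1 - L \<le> n) c)"
proof -
  have ne: "c \<noteq> []" using len r by auto
  have "chain L (butlast c @ [last c])" using c ne by simp
  then have *: "\<And>y. y \<in> set (butlast c) \<Longrightarrow> y + L \<le> last c" by (simp add: chain_snoc)
  have lx: "last c \<le> x" using le ne by simp
  have b: "below (x + 1 - L) (butlast c @ [last c]) = butlast c"
  proof -
    have "y < x + 1 - L" if "y \<in> set (butlast c)" for y
      using *[OF that] lx by linarith
    then have "below (x + 1 - L) (butlast c) = butlast c" by (rule below_id)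
    then show ?thesis using last by simp
  qed
  have f: "length (filter (\<lambda>n. x + 1 - L \<le> n) (butlast c @ [last c])) \<ge> 1"
    using last by auto
  have "length (below (x + 1 - L) c) = length c - 1" "length (filter (\<lambda>n. x + 1 - L \<le> n) c) \<ge> 1"
    using b f ne by simp_all
  then show ?thesis using len r by linarith
qed

lemma length_split: "length c = length (below b c) + length (filter (\<lambda>n. b \<le> n) c)"
  by (induction c) auto

text \<open>Greene--Kleitman duality for the unit interval order. The chains are built by appending
  each number to a longest chain that can be extended by it; if the chain receiving \<open>x\<close> has at most
  \<open>r\<close> elements then every chain of length at least \<open>r\<close> has an element in the window that ends
  at \<open>x\<close>, so that this window is a good choice.\<close>

lemma greene_kleitman_prefix:
  assumes L: "L > 0" and "sorted xs"
  shows "\<exists>Cs. (\<forall>c\<in>set Cs. chain L c) \<and> mset (concat Cs) = mset xs \<and>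
    (\<forall>r b. \<exists>w lab. window_label L r w lab \<and>
       (\<Sum>c\<leftarrow>Cs. min (length (below b c)) r) \<le> length (filter (\<lambda>n. lab n < r) (below b xs)))"
  using assms(2)
proof (induction xs rule: rev_induct)
  case Nil
  have "window_label L r (\<lambda>_. 0) (\<lambda>_. r)" for r by (simp add: window_label_def)
  then show ?case by (intro exI[of _ "[]"]) auto
next
  case (snoc x xs)
  then have le: "\<And>y. y \<in> set xs \<Longrightarrow> y \<le> x" by (simp add: sorted_append)
  from snoc obtain Cs where chains: "\<forall>c\<in>set Cs. chain L c" and mset: "mset (concat Cs) = mset xs"
    and IH: "\<And>r b. \<exists>w lab. window_label L r w lab \<and>
       (\<Sum>c\<leftarrow>Cs. min (length (below b c)) r) \<le> length (filter (\<lambda>n. lab n < r) (below b xs))"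
    by (fastforce simp: sorted_append)
  have setCs: "set (concat Cs) = set xs" using mset by (metis set_mset_mset)
  have leC: "y \<le> x" if "c \<in> set Cs" "y \<in> set c" for c y
    using that setCs le by auto
  text \<open>Opening a new chain with \<open>x\<close> means extending the empty chain.\<close>
  define Cs0 where "Cs0 = [] # Cs"
  define av where "av c \<longleftrightarrow> c \<in> set Cs0 \<and> (\<forall>y\<in>set c. y + L \<le> x)" for c
  have fin: "finite {c. av c}" by (rule finite_subset[of _ "set Cs0"]) (auto simp: av_def)
  have "[] \<in> {c. av c}" by (simp add: av_def Cs0_def)
  then have ne: "length ` {c. av c} \<noteq> {}" by blast
  obtain c0 where c0: "av c0" "length c0 = Max (length ` {c. av c})"
    using Max_in[OF finite_imageI[OF fin] ne] by auto
  have max: "length c \<le> length c0" if "av c" for c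
    unfolding c0(2) using that fin by (intro Max_ge) auto
  obtain D1 D2 where D: "Cs0 = D1 @ c0 # D2" using c0(1) by (auto simp: av_def in_set_conv_decomp)
  define Cs' where "Cs' = D1 @ (c0 @ [x]) # D2"
  have chains0: "\<forall>c\<in>set Cs0. chain L c" using chains by (auto simp: Cs0_def chain_def)
  have ch0: "chain L (c0 @ [x])" using c0(1) chains0 by (auto simp: av_def chain_snoc)
  have m0: "mset (concat Cs0) = mset xs" using mset by (simp add: Cs0_def)
  have sum0: "(\<Sum>c\<leftarrow>Cs0. min (length (below b c)) r) = (\<Sum>c\<leftarrow>Cs. min (length (below b c)) r)" for b r
    by (simp add: Cs0_def)
  show ?case
  proof (intro exI[of _ Cs'] conjI allI)
    show "\<forall>c\<in>set Cs'. chain L c" using chains0 ch0 by (auto simp: Cs'_def D)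
    show "mset (concat Cs') = mset (xs @ [x])" using m0 by (simp add: Cs'_def D)
    fix r b
    \<comment> \<open>If \<open>x\<close> is not below \<open>b\<close>, or extends a chain that
      already has \<open>r\<close> elements, the sum over the chains is unchanged and the old
      windows still serve.\<close>
    have keep: "\<exists>w lab. window_label L r w lab \<and>
        (\<Sum>c\<leftarrow>Cs'. min (length (below b c)) r) \<le> length (filter (\<lambda>n. lab n < r) (below b (xs @ [x])))"
      if "(\<Sum>c\<leftarrow>Cs'. min (length (below b c)) r) = (\<Sum>c\<leftarrow>Cs0. min (length (below b c)) r)"
    proof -
      obtain w lab where "window_label L r w lab"
        "(\<Sum>c\<leftarrow>Cs. min (length (below b c)) r) \<le> length (filter (\<lambda>n. lab n < r) (below b xs))"
        using IH by blast
      then show ?thesis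
        by (intro exI[of _ w] exI[of _ lab]) (simp add: that sum0)
    qed
    show "\<exists>w lab. window_label L r w lab \<and>
        (\<Sum>c\<leftarrow>Cs'. min (length (below b c)) r) \<le> length (filter (\<lambda>n. lab n < r) (below b (xs @ [x])))"
    proof (cases "x < b \<and> length c0 < r")
      case False
      have "below b c0 = c0" if "x < b"
        using that c0(1) L by (intro below_id) (fastforce simp: av_def)
      then show ?thesis
        using False by (intro keep) (auto simp: Cs'_def D)
    next
      case True
      then have r: "r > 0" by simp
      \<comment> \<open>The new window ends at \<open>x\<close>. For \<open>x + 1 < L\<close>
        truncated subtraction makes it start at 0, and it still contains every number up to
        \<open>x\<close>.\<close>
      define b' where "b' = x + 1 - L"
      obtain w lab where wl: "window_label L (r - 1) w lab"
        and wn: "(\<Sum>c\<leftarrow>Cs. min (length (below b' c)) (r - 1)) \<le> length (filter (\<lambda>n. lab n < r - 1) (below b' xs))"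
        using IH by blast
      \<comment> \<open>The induction hypothesis for \<open>r - 1\<close> windows may use the label
        \<open>r - 1\<close> for left-over numbers; it now names the new window, so these numbers
        get the label \<open>r\<close> instead.\<close>
      define lab' where "lab' n = (if b' \<le> n \<and> n < b' + L then r - 1 else if lab n < r - 1 then lab n else r)" for n
      define w' where "w' = w(r - 1 := b')"
      have "window_label L r w' lab'"
        using wl r by (auto simp: window_label_def w'_def lab'_def)
      moreover have "(\<Sum>c\<leftarrow>Cs'. min (length (below b c)) r) \<le> length (filter (\<lambda>n. lab' n < r) (below b (xs @ [x])))"
      proof -
        have one: "min (length (below b c)) r \<le> min (length (below b' c)) (r - 1) + length (filter (\<lambda>n. b' \<le> n) c)"
          if "c \<in> set Cs'" for c
        proof -
          have lec: "\<And>y. y \<in> set c \<Longrightarrow> y \<le> x"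
          proof -
            have "c = c0 @ [x] \<or> c \<in> set Cs0" using that by (auto simp: Cs'_def D)
            moreover have "y \<le> x" if "e \<in> set Cs0" "y \<in> set e" for e y
              using that leC by (auto simp: Cs0_def)
            moreover have "c0 \<in> set Cs0" using c0(1) by (simp add: av_def)
            ultimately show "y \<le> x" if "y \<in> set c" for y using that by auto
          qed
          then have bc: "below b c = c" using True by (intro below_id) fastforce
          show ?thesis
          proof (cases "length (below b' c) \<le> r - 1")
            case True
            then show ?thesis unfolding bc using length_split[of c b'] by simp
          next
            \<comment> \<open>In the other case the right-hand side counts all of \<open>c\<close>.
              Here \<open>c\<close> is longer than \<open>c0\<close>, so by the maximal choice of
              \<open>c0\<close> it cannot be extended by \<open>x\<close>: its last element lies in
              the window.\<close>
            case False
            then have len: "r \<le> length c" using length_split[of c b'] by simp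
            have ne: "c \<noteq> []" using len r by auto
            have cne: "c \<noteq> c0 @ [x]"
            proof
              assume "c = c0 @ [x]"
              moreover have "\<not> x < b'" using L by (simp add: b'_def)
              ultimately have "length (below b' c) \<le> length c0" by (simp add: below_def)
              then show False using False True by linarith
            qed
            then have "c \<in> set Cs0" using that by (auto simp: Cs'_def D)
            then have "\<not> av c" using max[of c] len \<open>x < b \<and> length c0 < r\<close> by auto
            then obtain y where "y \<in> set c" "y + L > x" using \<open>c \<in> set Cs0\<close> by (auto simp: av_def)
            then have "last c + L > x" using chain_last_le[of L c y] chains0 \<open>c \<in> set Cs0\<close> by fastforce
            then show ?thesis
              unfolding bc b'_def using chains0 \<open>c \<in> set Cs0\<close> L len r lec by (intro chain_busy) auto
          qed
        qed
        have "(\<Sum>c\<leftarrow>Cs'. min (length (below b c)) r)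
            \<le> (\<Sum>c\<leftarrow>Cs'. min (length (below b' c)) (r - 1) + length (filter (\<lambda>n. b' \<le> n) c))"
          by (intro sum_list_mono one)
        also have "\<dots> = (\<Sum>c\<leftarrow>Cs'. min (length (below b' c)) (r - 1)) + length (filter (\<lambda>n. b' \<le> n) (concat Cs'))"
          by (simp add: sum_list_addf filter_concat length_concat comp_def)
        also have "length (filter (\<lambda>n. b' \<le> n) (concat Cs')) = length (filter (\<lambda>n. b' \<le> n) (xs @ [x]))"
        proof -
          have "mset (filter (\<lambda>n. b' \<le> n) (concat Cs')) = mset (filter (\<lambda>n. b' \<le> n) (xs @ [x]))"
            using m0 by (simp only: mset_filter) (simp add: Cs'_def D)
          then show ?thesis by (metis size_mset)
        qed
        also have "(\<Sum>c\<leftarrow>Cs'. min (length (below b' c)) (r - 1)) = (\<Sum>c\<leftarrow>Cs0. min (length (below b' c)) (r - 1))"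
          using L by (simp add: Cs'_def D b'_def)
        also have "\<dots> \<le> length (filter (\<lambda>n. lab n < r - 1) (below b' xs))"
          using wn by (simp add: sum0)
        also have "length (filter (\<lambda>n. lab n < r - 1) (below b' xs)) + length (filter (\<lambda>n. b' \<le> n) (xs @ [x]))
           \<le> length (filter (\<lambda>n. lab' n < r) (xs @ [x]))"
        proof -
          have aux: "length (filter (\<lambda>n. lab n < r - 1) (below b' zs)) + length (filter (\<lambda>n. b' \<le> n) zs)
            \<le> length (filter (\<lambda>n. lab' n < r) zs)" if "\<forall>z\<in>set zs. z \<le> x" for zs
          proof -
            have "x < b' + L" by (simp add: b'_def)
            then have k: "lab' z < r" if "z \<le> x" "b' \<le> z \<or> lab z < r - 1" for z
              using that r unfolding lab'_def by auto
            show ?thesis using that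
            proof (induction zs)
              case (Cons z zs)
              then show ?case using k[of z] by (cases "b' \<le> z") auto
            qed simp
          qed
          have "below b' (xs @ [x]) = below b' xs" using L by (simp add: b'_def)
          then show ?thesis using aux[of "xs @ [x]"] le by simp
        qed
        also have "xs @ [x] = below b (xs @ [x])"
          using le True by (intro below_id[symmetric]) fastforce
        finally show ?thesis by simp
      qed
      ultimately show ?thesis by blast
    qed
  qed
qed

text \<open>A bound \<open>b\<close> above all numbers removes the truncation. The reverse
  inequality is automatic, because a window meets a chain at most once.\<close>

lemma greene_kleitman:
  assumes "L > 0"
  shows "\<exists>Cs w lab. (\<forall>c\<in>set Cs. chain L c) \<and> mset (concat Cs) = mset xs \<and> window_label L r w lab \<and>
       (\<Sum>c\<leftarrow>Cs. min (length c) r) \<le> length (filter (\<lambda>n. lab n < r) xs)"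
proof -
  obtain Cs where Cs: "\<forall>c\<in>set Cs. chain L c" "mset (concat Cs) = mset (sort xs)"
    and *: "\<And>r b. \<exists>w lab. window_label L r w lab \<and>
       (\<Sum>c\<leftarrow>Cs. min (length (below b c)) r) \<le> length (filter (\<lambda>n. lab n < r) (below b (sort xs)))"
    using greene_kleitman_prefix[OF assms, of "sort xs"] by auto
  define b where "b = Suc (Max (insert 0 (set xs)))"
  have lt: "n < b" if "n \<in> set xs" for n
    using that by (simp add: b_def le_imp_less_Suc)
  have set: "set (concat Cs) = set xs" using Cs(2) by (metis set_mset_mset set_sort)
  obtain w lab where wl: "window_label L r w lab"
    "(\<Sum>c\<leftarrow>Cs. min (length (below b c)) r) \<le> length (filter (\<lambda>n. lab n < r) (below b (sort xs)))"
    using * by blast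
  have "below b c = c" if "c \<in> set Cs" for c
    using that set lt by (intro below_id) auto
  then have "(\<Sum>c\<leftarrow>Cs. min (length (below b c)) r) = (\<Sum>c\<leftarrow>Cs. min (length c) r)"
    by (intro arg_cong[of _ _ sum_list] map_cong) auto
  moreover have "below b (sort xs) = sort xs" using lt by (intro below_id) auto
  moreover have "length (filter (\<lambda>n. lab n < r) (sort xs)) = length (filter (\<lambda>n. lab n < r) xs)"
    by (metis mset_filter mset_sort size_mset)
  ultimately show ?thesis using Cs wl by (intro exI[of _ Cs] exI[of _ w] exI[of _ lab]) auto
qed

text \<open>Initial segments of chains are chains, so surplus can be cut off. Chains of at most
  \<open>r\<close> elements count zero by truncated subtraction and are dropped.\<close>

lemma trim_chains:
  assumes "s \<le> (\<Sum>c\<leftarrow>Cs. length c - r)" "\<forall>c\<in>set Cs. chain L c"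
  shows "\<exists>Ds. (\<forall>c\<in>set Ds. chain L c \<and> r < length c) \<and> mset (concat Ds) \<subseteq># mset (concat Cs) \<and>
    (\<Sum>c\<leftarrow>Ds. length c - r) = s"
  using assms
proof (induction Cs arbitrary: s)
  case Nil
  then show ?case by (intro exI[of _ "[]"]) auto
next
  case (Cons c Cs)
  obtain Ds where Ds: "\<forall>c\<in>set Ds. chain L c \<and> r < length c" "mset (concat Ds) \<subseteq># mset (concat Cs)"
    "(\<Sum>c\<leftarrow>Ds. length c - r) = s - (length c - r)"
  proof -
    have "s - (length c - r) \<le> (\<Sum>c\<leftarrow>Cs. length c - r)" using Cons.prems(1) by simp
    then show ?thesis using Cons.IH that Cons.prems(2) by (metis list.set_intros(2))
  qed
  \<comment> \<open>The share of \<open>s\<close> that this chain takes over; the remaining chains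
    supply the rest.\<close>
  define t where "t = min s (length c - r)"
  show ?case
  proof (cases "t = 0")
    case True
    then show ?thesis using Ds by (intro exI[of _ Ds]) (auto simp: t_def subset_mset.add_increasing)
  next
    case False
    let ?c = "take (r + t) c"
    have "chain L ?c" using Cons.prems(2) by (auto simp: chain_def intro: sorted_wrt_take)
    moreover have "length ?c = r + t" using False by (auto simp: t_def min_def split: if_splits)
    moreover have "mset ?c \<subseteq># mset c" by (metis append_take_drop_id mset_append mset_subset_eq_add_left)
    ultimately show ?thesis
      using Ds False by (intro exI[of _ "?c # Ds"]) (auto simp: t_def intro: subset_mset.add_mono)
  qed
qed

section \<open>Monomials as multisets of positions\<close>

text \<open>The variable \<open>x\<^sub>i\<^sub>j\<close> has the position \<open>i K + j\<close>, where \<open>K = k + 1\<close>. A minor of a scroll matrix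
  has its diagonal entries at positions that grow by more than \<open>K\<close> in each step.\<close>

definition pos_var :: "nat \<Rightarrow> nat \<Rightarrow> nat \<times> nat" where
  "pos_var K n = (n div K, n mod K)"

definition mon :: "nat \<Rightarrow> nat multiset \<Rightarrow> (nat \<times> nat) monomial" where
  "mon K M = (\<Sum>n\<in>#M. single (pos_var K n) 1)"

lemma inj_pos_var: "inj (pos_var K)"
  by (auto simp: inj_on_def pos_var_def) (metis div_mult_mod_eq)

lemma pos_var_eq [simp]: "pos_var K m = pos_var K n \<longleftrightarrow> m = n"
  using inj_pos_var by (auto simp: inj_on_def)

lemma mon_empty [simp]: "mon K {#} = 0"
  by (simp add: mon_def)

lemma mon_add_mset: "mon K (add_mset n M) = single (pos_var K n) 1 + mon K M"
  by (simp add: mon_def)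

lemma mon_plus: "mon K (M + N) = mon K M + mon K N"
  by (simp add: mon_def)

lemma lookup_mon: "lookup (mon K M) (pos_var K n) = count M n"
  by (induction M) (simp_all add: mon_add_mset lookup_add lookup_single when_def)

lemma mon_inject [simp]: "mon K M = mon K N \<longleftrightarrow> M = N"
  by (metis lookup_mon multiset_eq_iff)

lemma keys_mon: "keys (mon K M) = pos_var K ` set_mset M"
  by (induction M) (simp_all add: mon_add_mset keys_nat_add)

lemma pos_var_in_scroll_vars [simp]:
  "pos_var (Suc k) n \<in> scroll_vars d k \<longleftrightarrow> n < Suc d * Suc k"
proof -
  have "n div Suc k \<le> d \<longleftrightarrow> n < Suc d * Suc k"
    by (metis div_less_iff_less_mult less_Suc_eq_le zero_less_Suc)
  moreover have "n mod Suc k \<le> k"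
    using mod_less_divisor[of "Suc k" n] by linarith
  ultimately show ?thesis by (simp add: pos_var_def scroll_vars_def)
qed

lemma keys_mon_scroll:
  "keys (mon (Suc k) M) \<subseteq> scroll_vars d k \<longleftrightarrow> set_mset M \<subseteq> {..<Suc d * Suc k}"
  by (auto simp: keys_mon)

lemma scroll_vars_pos:
  assumes "v \<in> scroll_vars d k"
  obtains n where "n < Suc d * Suc k" "v = pos_var (Suc k) n"
proof -
  obtain i j where ij: "v = (i, j)" "i \<le> d" "j \<le> k" using assms by (auto simp: scroll_vars_def)
  have "v = pos_var (Suc k) (j + i * Suc k)"
    using ij div_mult_self1[of "Suc k" j i] mod_mult_self1[of j i "Suc k"]
    by (simp add: pos_var_def del: mult_Suc_right)
  then show ?thesis using that assms by (metis pos_var_in_scroll_vars)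
qed

lemma ex_mon:
  assumes "keys m \<subseteq> scroll_vars d k"
  obtains M where "m = mon (Suc k) M" "set_mset M \<subseteq> {..<Suc d * Suc k}"
proof -
  have "\<exists>M. m = mon (Suc k) M" if "keys m \<subseteq> scroll_vars d k" for m
    using that
  proof (induction "\<Sum>v\<in>keys m. lookup m v" arbitrary: m)
    case 0
    then have "m = 0" by (auto simp: in_keys_iff intro!: poly_mapping_eqI)
    then show ?case by (metis mon_empty)
  next
    case (Suc n)
    then have "keys m \<noteq> {}" by auto
    then obtain v where v: "v \<in> keys m" by blast
    define m' where "m' = m - single v 1"
    have m: "m = m' + single v 1"
    proof (rule poly_mapping_eqI)
      fix w show "lookup m w = lookup (m' + single v 1) w"
        using v by (auto simp: m'_def lookup_add lookup_minus lookup_single when_def in_keys_iff)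
    qed
    have "(\<Sum>v\<in>keys m. lookup m v) = (\<Sum>w\<in>keys m. lookup m' w) + (\<Sum>w\<in>keys m. lookup (single v 1) w)"
      by (subst m) (simp add: lookup_add sum.distrib)
    also have "(\<Sum>w\<in>keys m. lookup m' w) = (\<Sum>w\<in>keys m'. lookup m' w)"
      by (rule sum.mono_neutral_right) (auto simp: m keys_nat_add in_keys_iff)
    also have "(\<Sum>w\<in>keys m. lookup (single v 1) w) = 1"
      using v by (simp add: lookup_single when_def)
    finally have "n = (\<Sum>w\<in>keys m'. lookup m' w)" using Suc(2) by simp
    moreover have "keys m' \<subseteq> scroll_vars d k" using Suc(3) by (simp add: m keys_nat_add)
    ultimately obtain M' where "m' = mon (Suc k) M'" using Suc(1) by blast
    moreover obtain p where "v = pos_var (Suc k) p" using scroll_vars_pos v Suc(3) by blast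
    ultimately have "m = mon (Suc k) (add_mset p M')" by (simp add: m mon_add_mset add.commute)
    then show ?case ..
  qed
  then show ?thesis using assms that keys_mon_scroll by metis
qed

subsection \<open>Swaps\<close>

text \<open>The minor of \<open>X_1\<close> with columns \<open>n < m\<close> has the diagonal
  \<open>n, m + K\<close> and the antidiagonal \<open>n + K, m\<close>; a swap replaces the first
  pair by the second inside a monomial.\<close>

inductive swap :: "nat \<Rightarrow> nat multiset \<Rightarrow> nat multiset \<Rightarrow> bool" for K where
  swap: "n < m \<Longrightarrow> swap K (add_mset n (add_mset (m + K) U)) (add_mset (n + K) (add_mset m U))"

text \<open>The exponent of \<open>t\<close> and the exponents of the \<open>y_j\<close> in the
  image of the monomial under the parametrization \<open>t^i y_j\<close> of the scroll.\<close>

definition toric_class :: "nat \<Rightarrow> nat multiset \<Rightarrow> nat \<times> nat multiset" where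
  "toric_class K M = ((\<Sum>n\<in>#M. n div K), image_mset (\<lambda>n. n mod K) M)"

text \<open>Both ends are included, so the window has \<open>K + 1\<close> positions, and its ends
  are congruent modulo \<open>K\<close>.\<close>

definition in_window :: "nat \<Rightarrow> nat multiset \<Rightarrow> bool" where
  "in_window K M \<longleftrightarrow> (\<exists>b. \<forall>n\<in>#M. b \<le> n \<and> n \<le> b + K)"

lemma swap_class: "swap K M M' \<Longrightarrow> K > 0 \<Longrightarrow> toric_class K M' = toric_class K M"
  by (auto elim!: swap.cases simp: toric_class_def)

lemma swaps_class: "(swap K)\<^sup>*\<^sup>* M M' \<Longrightarrow> K > 0 \<Longrightarrow> toric_class K M' = toric_class K M"
  by (induction rule: rtranclp_induct) (simp_all add: swap_class)

lemma swap_bound: "swap K M M' \<Longrightarrow> set_mset M \<subseteq> {..<N} \<Longrightarrow> set_mset M' \<subseteq> {..<N}"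
  by (auto elim!: swap.cases)

lemma swaps_bound: "(swap K)\<^sup>*\<^sup>* M M' \<Longrightarrow> set_mset M \<subseteq> {..<N} \<Longrightarrow> set_mset M' \<subseteq> {..<N}"
  by (induction rule: rtranclp_induct) (simp_all add: swap_bound)

text \<open>A swap keeps the sum of the positions and moves two of them closer together, so the sum
  of squares drops, namely by \<open>2 K (m - n)\<close>.\<close>

lemma swap_decreases:
  assumes "swap K M M'" "K > 0" shows "(\<Sum>n\<in>#M'. n * n) < (\<Sum>n\<in>#M. n * n)"
  using assms(1)
proof cases
  case (swap n m U)
  have e: "(n + K) * (n + K) + m * m = n * n + m * m + K * K + 2 * (K * n)"
    "n * n + (m + K) * (m + K) = n * n + m * m + K * K + 2 * (K * m)"
    by (simp_all add: algebra_simps)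
  have "2 * (K * n) < 2 * (K * m)" using swap assms(2) by simp
  then have "(n + K) * (n + K) + m * m < n * n + (m + K) * (m + K)"
    unfolding e by (rule add_strict_left_mono)
  then show ?thesis by (simp add: swap)
qed

text \<open>Outside a window some position exceeds the minimum by more than \<open>K\<close>, and
  this pair admits a swap. The sum of squares makes the process stop.\<close>

lemma swaps_to_window:
  assumes "K > 0"
  shows "\<exists>M'. (swap K)\<^sup>*\<^sup>* M M' \<and> in_window K M'"
proof (induction "\<Sum>n\<in>#M. n * n" arbitrary: M rule: less_induct)
  case less
  show ?case
  proof (cases "in_window K M")
    case False
    then have ne: "M \<noteq> {#}" by (auto simp: in_window_def)
    define b where "b = Min (set_mset M)"
    have b: "b \<in># M" "\<And>n. n \<in># M \<Longrightarrow> b \<le> n" using ne by (auto simp: b_def)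
    obtain p where p: "p \<in># M" "p > b + K"
      using False b by (auto simp: in_window_def) (metis not_le)
    obtain U where U: "M = add_mset b U" using b by (metis mset_add)
    then have "p \<in># U" using p by auto
    then obtain U' where U': "U = add_mset p U'" by (metis mset_add)
    define m where "m = p - K"
    have "swap K (add_mset b (add_mset (m + K) U')) (add_mset (b + K) (add_mset m U'))"
      using p by (intro swap.swap) (simp add: m_def)
    then have s: "swap K M (add_mset (b + K) (add_mset m U'))"
      using p by (simp add: U U' m_def)
    from less[OF swap_decreases[OF s assms]] s show ?thesis
      by (meson converse_rtranclp_into_rtranclp)
  qed blast
qed

text \<open>The \<open>K\<close> positions after \<open>b\<close> form a complete residue system, so
  a position there is recovered from its residue.\<close>

lemma next_congruent:
  fixes n :: nat
  assumes "K > 0" "b < n" "n \<le> b + K"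
  shows "(LEAST p. b < p \<and> p mod K = n mod K) = n"
proof (rule Least_equality)
  fix p assume p: "b < p \<and> p mod K = n mod K"
  show "n \<le> p"
  proof (rule ccontr)
    assume "\<not> n \<le> p"
    then have "K dvd n - p" using p by (metis mod_eq_dvd_iff_nat nat_le_linear)
    then have "K \<le> n - p" using \<open>\<not> n \<le> p\<close> by (intro dvd_imp_le) auto
    then show False using p assms by linarith
  qed
qed (use assms in simp)

text \<open>This makes the sum of the positions an invariant of the toric class.\<close>

lemma sum_positions:
  "(\<Sum>n\<in>#M. n) = K * fst (toric_class K M) + sum_mset (snd (toric_class K M))"
  by (induction M) (simp_all add: toric_class_def algebra_simps)

lemma sum_mset_eq_pointwise:
  fixes f g :: "'b \<Rightarrow> nat"
  assumes "\<forall>n\<in>#M. f n \<le> g n" "(\<Sum>n\<in>#M. f n) = (\<Sum>n\<in>#M. g n)" "n \<in># M"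
  shows "f n = g n"
proof -
  obtain U where U: "M = add_mset n U" using assms(3) by (metis mset_add)
  have "(\<Sum>n\<in>#U. f n) \<le> (\<Sum>n\<in>#U. g n)"
    using assms(1) by (intro sum_mset_mono) (simp add: U)
  then show ?thesis using assms by (simp add: U)
qed

text \<open>Here \<open>h\<close> maps a residue to its representative in the \<open>K\<close>
  positions after \<open>b\<close>. The class fixes both the multiset of these representatives and
  the sum of the positions, and the comparison of the two sums decides everything.\<close>

lemma window_unique_aux:
  assumes K: "K > 0" and c: "toric_class K M = toric_class K M'"
    and M: "\<forall>n\<in>#M. b \<le> n \<and> n \<le> b + K" and M': "\<forall>n\<in>#M'. b' \<le> n \<and> n \<le> b' + K" and le: "b \<le> b'"
  shows "M = M'"
proof -
  define h where "h j = (LEAST p. b < p \<and> p mod K = j)" for j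
  have h1: "h (n mod K) = n" if "b < n" "n \<le> b + K" for n
    unfolding h_def using next_congruent[OF K that] .
  have h2: "h (b mod K) = b + K"
    using h1[of "b + K"] K by simp
  have h3: "h (n mod K) \<le> n" if "b < n" for n
    unfolding h_def by (rule Least_le) (use that in simp)
  have cm: "image_mset (\<lambda>n. n mod K) M = image_mset (\<lambda>n. n mod K) M'"
    using c by (simp add: toric_class_def)
  then have ch: "image_mset (\<lambda>n. h (n mod K)) M = image_mset (\<lambda>n. h (n mod K)) M'"
  proof -
    have "image_mset (\<lambda>n. h (n mod K)) A = image_mset h (image_mset (\<lambda>n. n mod K) A)" for A
      by (simp add: image_mset.compositionality comp_def)
    then show ?thesis using cm by simp
  qed
  have cs: "(\<Sum>n\<in>#M. n) = (\<Sum>n\<in>#M'. n)" by (metis sum_positions c)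
  have csh: "(\<Sum>n\<in>#M. h (n mod K)) = (\<Sum>n\<in>#M'. h (n mod K))" using ch by simp
  show ?thesis
  proof (cases "b = b'")
    case False
    \<comment> \<open>For \<open>b < b'\<close> the representatives bound \<open>M\<close> from
      above and \<open>M'\<close> from below. As the sums agree, both bounds are attained at every
      position.\<close>
    have l1: "\<forall>n\<in>#M. n \<le> h (n mod K)"
    proof
      fix n assume "n \<in># M"
      then show "n \<le> h (n mod K)" using M h1[of n] h2 by (cases "n = b") auto
    qed
    have l2: "\<forall>n\<in>#M'. h (n mod K) \<le> n" using M' False le by (auto intro!: h3)
    have "(\<Sum>n\<in>#M. n) \<le> (\<Sum>n\<in>#M. h (n mod K))" "(\<Sum>n\<in>#M'. h (n mod K)) \<le> (\<Sum>n\<in>#M'. n)"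
      using l1 l2 sum_mset_mono[of M "\<lambda>n. n" "\<lambda>n. h (n mod K)"]
        sum_mset_mono[of M' "\<lambda>n. h (n mod K)" "\<lambda>n. n"] by simp_all
    then have e: "(\<Sum>n\<in>#M. n) = (\<Sum>n\<in>#M. h (n mod K))" "(\<Sum>n\<in>#M'. h (n mod K)) = (\<Sum>n\<in>#M'. n)"
      using cs csh by auto
    have "image_mset (\<lambda>n. h (n mod K)) M = image_mset (\<lambda>n. n) M"
      by (rule image_mset_cong) (rule sum_mset_eq_pointwise[OF l1 e(1), symmetric])
    moreover have "image_mset (\<lambda>n. h (n mod K)) M' = image_mset (\<lambda>n. n) M'"
      by (rule image_mset_cong) (rule sum_mset_eq_pointwise[OF l2 e(2)])
    ultimately have "image_mset (\<lambda>n. n) M = image_mset (\<lambda>n. n) M'" using ch by argo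
    then show ?thesis by simp
  next
    case True
    \<comment> \<open>For a common window only the residue of \<open>b\<close> is ambiguous:
      \<open>h\<close> moves \<open>b\<close> to \<open>b + K\<close> and fixes the other positions.
      The growth of the sum, \<open>K\<close> per occurrence of \<open>b\<close>, gives the
      multiplicity of \<open>b\<close>.\<close>
    have A: "image_mset (\<lambda>n. h (n mod K)) A = filter_mset (\<lambda>n. n \<noteq> b) A + replicate_mset (count A b) (b + K)"
      "A = filter_mset (\<lambda>n. n \<noteq> b) A + replicate_mset (count A b) b"
      if "\<forall>n\<in>#A. b \<le> n \<and> n \<le> b + K" for A
      using that
    proof (induction A)
      case (add x A)
      { case 1 then show ?case using add(1) h1[of x] h2 by (cases "x = b") auto }
      { case 2 then show ?case using add(2) by (cases "x = b") auto }
    qed auto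
    have S: "(\<Sum>n\<in>#A. h (n mod K)) = (\<Sum>n\<in>#A. n) + K * count A b" if "\<forall>n\<in>#A. b \<le> n \<and> n \<le> b + K" for A
    proof -
      have "(\<Sum>n\<in>#A. h (n mod K)) = sum_mset (filter_mset (\<lambda>n. n \<noteq> b) A) + count A b * (b + K)"
        by (subst A(1)[OF that]) simp
      moreover have "(\<Sum>n\<in>#A. n) = sum_mset (filter_mset (\<lambda>n. n \<noteq> b) A) + count A b * b"
        using arg_cong[OF A(2)[OF that], of sum_mset] by simp
      ultimately show ?thesis by (simp add: algebra_simps)
    qed
    have "count M b = count M' b"
      using S[OF M] S[of M'] M' True cs csh K by simp
    moreover from this have "filter_mset (\<lambda>n. n \<noteq> b) M = filter_mset (\<lambda>n. n \<noteq> b) M'"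
      using ch A(1)[OF M] A(1)[of M'] M' True by simp
    ultimately show ?thesis
      using A(2)[OF M] A(2)[of M'] M' True by metis
  qed
qed

lemma window_unique:
  assumes "K > 0" "toric_class K M = toric_class K M'" "in_window K M" "in_window K M'"
  shows "M = M'"
proof -
  obtain b b' where b: "\<forall>n\<in>#M. b \<le> n \<and> n \<le> b + K" "\<forall>n\<in>#M'. b' \<le> n \<and> n \<le> b' + K"
    using assms(3,4) unfolding in_window_def by blast
  show ?thesis
    using window_unique_aux[OF assms(1,2) b] window_unique_aux[OF assms(1) assms(2)[symmetric] b(2,1)]
    by (metis nat_le_linear)
qed

text \<open>The window monomial is the common normal form of its toric class, so the swaps are
  confluent.\<close>

lemma same_class_common_swaps:
  assumes "K > 0" "toric_class K M = toric_class K M'"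
  obtains W where "(swap K)\<^sup>*\<^sup>* M W" "(swap K)\<^sup>*\<^sup>* M' W" "in_window K W"
proof -
  obtain W W' where "(swap K)\<^sup>*\<^sup>* M W" "in_window K W" "(swap K)\<^sup>*\<^sup>* M' W'" "in_window K W'"
    using swaps_to_window[OF assms(1)] by metis
  moreover from this have "W = W'"
    using assms by (intro window_unique) (simp_all add: swaps_class)
  ultimately show ?thesis using that by blast
qed

subsection \<open>Minors of the scroll matrices\<close>

text \<open>The columns are given by the positions of their top entries, and going down one row adds
  \<open>K\<close>. In this numbering the column with index \<open>n\<close> of every
  \<open>X_r\<close> has its top entry at position \<open>n\<close>.\<close>

definition scroll_minor :: "nat \<Rightarrow> nat \<Rightarrow> (nat \<Rightarrow> nat) \<Rightarrow> (nat \<times> nat, 'a::comm_ring_1) mpoly" where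
  "scroll_minor K t c = det (mat t t (\<lambda>(a, b). Var (pos_var K (c b + a * K))))"

lemma pick_strict_mono:
  assumes "strict_mono_on {..<t} c" "b < t"
  shows "pick (c ` {..<t}) b = c b"
proof -
  have "{a \<in> c ` {..<t}. a < c b} = c ` {..<b}"
    using assms strict_mono_on_less[OF assms(1)] by (auto simp: image_iff)
  moreover have "card (c ` {..<b}) = b"
    using assms strict_mono_on_imp_inj_on[OF assms(1)]
    by (subst card_image) (auto intro: inj_on_subset)
  ultimately show ?thesis using pick_card_in_set[of "c b" "c ` {..<t}"] assms(2) by simp
qed

lemma submatrix_scroll:
  assumes "strict_mono_on {..<Suc r} c" "\<And>b. b < Suc r \<Longrightarrow> c b < (d - r + 1) * Suc k"
  shows "submatrix (scroll_mat d k r) {..<Suc r} (c ` {..<Suc r})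
    = mat (Suc r) (Suc r) (\<lambda>(a, b). Var (pos_var (Suc k) (c b + a * Suc k)))"
proof -
  have "card {j. j < (d - r + 1) * Suc k \<and> j \<in> c ` {..<Suc r}} = card (c ` {..<Suc r})"
    using assms(2) by (intro arg_cong[of _ _ card]) auto
  also have "\<dots> = Suc r"
    using strict_mono_on_imp_inj_on[OF assms(1)] by (simp add: card_image)
  finally have cc: "card {j. j < (d - r + 1) * Suc k \<and> j \<in> c ` {..<Suc r}} = Suc r" .
  have cr: "card {i. i < Suc r \<and> i \<in> {..<Suc r}} = Suc r" by simp
  have pr: "pick {..<Suc r} a = a" if "a < Suc r" for a
    using pick_strict_mono[of "Suc r" "\<lambda>x. x" a] that by (simp add: strict_mono_on_def)
  show ?thesis
  proof (rule eq_matI)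
    fix a b assume "a < dim_row (mat (Suc r) (Suc r) (\<lambda>(a, b). Var (pos_var (Suc k) (c b + a * Suc k))))"
      "b < dim_col (mat (Suc r) (Suc r) (\<lambda>(a, b). Var (pos_var (Suc k) (c b + a * Suc k))))"
    then have ab: "a < Suc r" "b < Suc r" by simp_all
    have "submatrix (scroll_mat d k r) {..<Suc r} (c ` {..<Suc r}) $$ (a, b)
        = scroll_mat d k r $$ (pick {..<Suc r} a, pick (c ` {..<Suc r}) b)"
      by (rule submatrix_index) (use ab cc cr in \<open>simp_all add: scroll_mat_def\<close>)
    also have "\<dots> = scroll_mat d k r $$ (a, c b)"
      using ab assms(1) by (simp add: pr pick_strict_mono)
    also have "\<dots> = Var (pos_var (Suc k) (c b + a * Suc k))"
      using ab assms(2)[OF ab(2)] div_mult_self1[of "Suc k" "c b" a] mod_mult_self1[of "c b" a "Suc k"]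
      by (simp add: scroll_mat_def pos_var_def add.commute[of a] del: mult_Suc_right)
    finally show "submatrix (scroll_mat d k r) {..<Suc r} (c ` {..<Suc r}) $$ (a, b)
      = mat (Suc r) (Suc r) (\<lambda>(a, b). Var (pos_var (Suc k) (c b + a * Suc k))) $$ (a, b)"
      using ab by simp
  qed (use cc cr in \<open>simp_all add: dim_submatrix scroll_mat_def\<close>)
qed

text \<open>A maximal minor uses all rows, so an increasing enumeration of its columns describes it
  completely.\<close>

lemma minors_scroll_mat:
  "minors (Suc r) (scroll_mat d k r) = {scroll_minor (Suc k) (Suc r) c | c.
     strict_mono_on {..<Suc r} c \<and> (\<forall>b<Suc r. c b < (d - r + 1) * Suc k)}" (is "?L = ?R")
proof (intro equalityI subsetI)
  fix f assume "f \<in> ?R"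
  then obtain c where c: "strict_mono_on {..<Suc r} c" "\<forall>b<Suc r. c b < (d - r + 1) * Suc k"
    and f: "f = scroll_minor (Suc k) (Suc r) c" by blast
  have "f = det (submatrix (scroll_mat d k r) {..<Suc r} (c ` {..<Suc r}))"
    using c by (simp add: f scroll_minor_def submatrix_scroll)
  moreover have "card (c ` {..<Suc r}) = Suc r"
    using strict_mono_on_imp_inj_on[OF c(1)] by (simp add: card_image)
  ultimately show "f \<in> ?L"
    unfolding minors_def mem_Collect_eq using c(2)
    by (intro exI[of _ "{..<Suc r}"] exI[of _ "c ` {..<Suc r}"]) (auto simp: scroll_mat_def)
next
  fix f assume "f \<in> ?L"
  then obtain S T where ST: "S \<subseteq> {..<Suc r}" "T \<subseteq> {..<(d - r + 1) * Suc k}" "card S = Suc r" "card T = Suc r"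
    and f: "f = det (submatrix (scroll_mat d k r) S T)"
    by (auto simp: minors_def scroll_mat_def)
  have S: "S = {..<Suc r}" using ST by (intro card_subset_eq) auto
  have finT: "finite T" using ST by (metis card.infinite nat.distinct(1))
  have c: "strict_mono_on {..<Suc r} (pick T)"
    using ST(4) by (auto intro!: strict_mono_onI pick_mono)
  have inT: "pick T b \<in> T" if "b < Suc r" for b
    using that ST(4) by (intro pick_in_set) auto
  have T: "T = pick T ` {..<Suc r}"
    using inT ST(4) strict_mono_on_imp_inj_on[OF c] finT
    by (intro card_subset_eq[symmetric]) (auto simp: card_image)
  have "f = scroll_minor (Suc k) (Suc r) (pick T)"
    unfolding f S scroll_minor_def
    by (subst T, subst submatrix_scroll) (use c inT ST in auto)
  then show "f \<in> ?R" using c inT ST(2) by blast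
qed

text \<open>\<open>X_r\<close> has \<open>r + 1\<close> rows, hence no larger minors.\<close>

lemma minors_ge_scroll_mat:
  fixes A :: "(nat \<times> nat, 'a::comm_ring_1) mpoly mat"
  assumes A: "A = scroll_mat d k r"
  shows "minors_ge (r + 1) A = minors (Suc r) A"
proof -
  have E: "minors t A = {}" if "t > Suc r" for t
  proof -
    have le: "card S \<le> Suc r" if "S \<subseteq> {..<Suc r}" for S
      using card_mono[OF _ that] by simp
    then have "\<not> (S \<subseteq> {..<Suc r} \<and> card S = t)" for S using le[of S] that by (metis not_le)
    then show ?thesis by (simp add: A minors_def scroll_mat_def) blast
  qed
  then have "minors t A \<subseteq> minors (Suc r) A" if "t \<ge> Suc r" for t
    using that E[of t] by (cases "t = Suc r") simp_all
  then show ?thesis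
    unfolding minors_ge_def by auto
qed

section \<open>Secant ideals as kernels\<close>

text \<open>The scroll is parametrized by \<open>x\<^sub>i\<^sub>j = t\<^sup>i y\<^sub>j\<close> and its \<open>r\<close>-th secant variety by sums of \<open>r\<close>
  copies of this. In the \<open>p\<close>-th copy, \<open>t\<close> is the variable \<open>(0, p, 0)\<close> and \<open>y\<^sub>j\<close> is
  \<open>(1, p, j)\<close>.\<close>

definition param_monom :: "nat \<Rightarrow> nat \<times> nat \<Rightarrow> (nat \<times> nat \<times> nat) monomial" where
  "param_monom p v = single (0, p, 0) (fst v) + single (1, p, snd v) 1"

definition secant_param :: "nat \<Rightarrow> nat \<times> nat \<Rightarrow> (nat \<times> nat \<times> nat, 'a::comm_ring_1) mpoly" where
  "secant_param r v = (\<Sum>p<r. single (param_monom p v) 1)"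

definition secant_kernel :: "(nat \<times> nat) set \<Rightarrow> nat \<Rightarrow> (nat \<times> nat, 'a::comm_ring_1) mpoly set" where
  "secant_kernel V r = {f. vars f \<subseteq> V \<and> subst_vars (secant_param r) f = 0}"

text \<open>The image of a monomial under the parametrization by copy \<open>p\<close>; it depends
  on the toric class alone and determines it.\<close>

definition class_monom :: "nat \<Rightarrow> nat \<times> nat multiset \<Rightarrow> (nat \<times> nat \<times> nat) monomial" where
  "class_monom p c = single (0, p, 0) (fst c) + (\<Sum>j\<in>#snd c. single (1, p, j) 1)"

lemma sum_param_monom:
  "(\<Sum>n\<in>#M. param_monom p (pos_var K n)) = class_monom p (toric_class K M)"
  by (induction M)
     (simp_all add: class_monom_def toric_class_def param_monom_def pos_var_def single_add algebra_simps)

lemma lookup_class_monom: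
  "lookup (class_monom p c) (0, p, 0) = fst c" "lookup (class_monom p c) (1, p, j) = count (snd c) j"
proof -
  have "lookup (\<Sum>j\<in>#J. single (1, p, j) 1 :: (nat \<times> nat \<times> nat) monomial) (0, p, 0) = 0" for J
    by (induction J) (simp_all add: lookup_add lookup_single when_def)
  then show "lookup (class_monom p c) (0, p, 0) = fst c"
    by (simp add: class_monom_def lookup_add)
  have "lookup (\<Sum>j\<in>#J. single (1, p, j) 1 :: (nat \<times> nat \<times> nat) monomial) (1, p, j) = count J j" for J
    by (induction J) (simp_all add: lookup_add lookup_single when_def)
  then show "lookup (class_monom p c) (1, p, j) = count (snd c) j"
    by (simp add: class_monom_def lookup_add lookup_single when_def)
qed

lemma class_monom_inject [simp]: "class_monom p c = class_monom p c' \<longleftrightarrow> c = c'"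
  by (metis lookup_class_monom multiset_eq_iff prod_eq_iff)

lemma keys_class_monom: "keys (class_monom p c) \<subseteq> {v. fst v < 2 \<and> fst (snd v) = p}"
proof -
  have "keys (\<Sum>j\<in>#J. single (1, p, j) 1 :: (nat \<times> nat \<times> nat) monomial) \<subseteq> {v. fst v < 2 \<and> fst (snd v) = p}" for J
    by (induction J) (auto simp: keys_nat_add)
  then show ?thesis by (auto simp: class_monom_def keys_nat_add split: if_splits)
qed

lemma monom_eval_mon: "monom_eval \<sigma> (mon K M) = (\<Prod>n\<in>#M. \<sigma> (pos_var K n))"
  by (induction M) (simp_all add: mon_add_mset monom_eval_add)

lemma prod_mset_single:
  "(\<Prod>n\<in>#M. single (g n) 1 :: ('v, 'a::comm_ring_1) mpoly) = single (\<Sum>n\<in>#M. g n) 1"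
  by (induction M) (simp_all add: mult_single)

lemma monom_eval_param:
  "monom_eval (\<lambda>v. single (param_monom p v) 1 :: (_, 'a::comm_ring_1) mpoly) (mon K M)
    = single (class_monom p (toric_class K M)) 1"
  by (simp add: monom_eval_mon prod_mset_single sum_param_monom)

section \<open>Binomial generators of the scroll ideal\<close>

lemma det_2_mat: "det (mat 2 2 f :: 'a::comm_ring_1 mat) = f (0, 0) * f (1, 1) - f (0, 1) * f (1, 0)"
proof -
  have 2: "{0..<2::nat} = {0, Suc 0}" by auto
  have *: "{p. p permutes {0..<2::nat}} = {id, Transposition.transpose 0 (Suc 0)}"
    unfolding 2 by (simp only: permutes_doubleton_iff) auto
  have "id \<noteq> Transposition.transpose 0 (Suc 0)"
    by (metis id_apply transpose_apply_first zero_neq_one One_nat_def)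
  moreover have "det (mat 2 2 f) = (\<Sum>p\<in>{id, Transposition.transpose 0 (Suc 0)}.
      signof p * (\<Prod>i\<in>{0, Suc 0}. mat 2 2 f $$ (i, p i)))"
    unfolding *[symmetric] 2[symmetric] by (rule det_def') simp
  ultimately show ?thesis
    by (simp add: sign_swap_id sign_id)
qed

lemma Var_mult: "Var u * Var v = (single (single u 1 + single v 1) 1 :: ('v, 'a::comm_ring_1) mpoly)"
  by (simp add: Var_def mult_single)

text \<open>The generators of the scroll ideal are the binomials of the swaps within the range of
  positions; all later arguments about the ideal use this form.\<close>

lemma minors_2_scroll:
  assumes "d \<ge> 1"
  shows "minors 2 (scroll_mat d k 1) = {single (mon (Suc k) {#n, m + Suc k#}) 1
      - single (mon (Suc k) {#n + Suc k, m#}) 1 | n m. n < m \<and> m + Suc k < Suc d * Suc k}"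
proof -
  have sm: "scroll_minor (Suc k) 2 c
    = single (mon (Suc k) {#c 0, c 1 + Suc k#}) 1 - single (mon (Suc k) {#c 0 + Suc k, c 1#}) 1" for c
    unfolding scroll_minor_def det_2_mat by (simp add: Var_mult mon_add_mset add.commute)
  have "minors 2 (scroll_mat d k 1) = {scroll_minor (Suc k) 2 c | c.
     strict_mono_on {..<2} c \<and> (\<forall>b<2. c b < (d - 1 + 1) * Suc k)}"
    using minors_scroll_mat[of 1 d k] by (simp add: numeral_2_eq_2)
  also have "\<dots> = {single (mon (Suc k) {#n, m + Suc k#}) 1
      - single (mon (Suc k) {#n + Suc k, m#}) 1 | n m. n < m \<and> m + Suc k < Suc d * Suc k}" (is "?L = ?R")
  proof (intro equalityI subsetI)
    fix f assume "f \<in> ?L"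
    then obtain c where c: "strict_mono_on {..<2} c" "\<forall>b<2. c b < (d - 1 + 1) * Suc k" "f = scroll_minor (Suc k) 2 c"
      by blast
    have "c 0 < c 1" using c(1) by (auto simp: strict_mono_on_def)
    moreover have "c 1 < d * Suc k" using c(2)[rule_format, of 1] assms by simp
    ultimately show "f \<in> ?R" unfolding c(3) sm by force
  next
    fix f assume "f \<in> ?R"
    then obtain n m where nm: "n < m" "m + Suc k < Suc d * Suc k" and
      f: "f = single (mon (Suc k) {#n, m + Suc k#}) 1 - single (mon (Suc k) {#n + Suc k, m#}) 1" by blast
    define c where "c b = (if b = 0 then n else m)" for b :: nat
    have "f = scroll_minor (Suc k) 2 c" unfolding sm f by (simp add: c_def)
    moreover have "strict_mono_on {..<2} c" using nm by (auto simp: strict_mono_on_def c_def)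
    moreover have "\<forall>b<2. c b < (d - 1 + 1) * Suc k" using nm assms by (auto simp: c_def)
    ultimately show "f \<in> ?L" by blast
  qed
  finally show ?thesis .
qed

lemma scroll_ideal_ideal:
  assumes "d \<ge> 1"
  shows "ideal (scroll_ideal d k :: (nat \<times> nat, 'a::comm_ring_1) mpoly set) (mpoly_ring (scroll_vars d k))"
  unfolding scroll_ideal_def
proof (rule Idl_ideal, rule subsetI)
  fix g :: "(nat \<times> nat, 'a) mpoly" assume "g \<in> minors 2 (scroll_mat d k 1)"
  then obtain n m where nm: "n < m" "m + Suc k < Suc d * Suc k"
    and g: "g = single (mon (Suc k) {#n, m + Suc k#}) 1 - single (mon (Suc k) {#n + Suc k, m#}) 1"
    unfolding minors_2_scroll[OF assms(1)] by blast
  have "vars g \<subseteq> scroll_vars d k"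
    unfolding g by (intro vars_diff_sub vars_single_sub) (use nm in \<open>auto simp: keys_mon\<close>)
  then show "g \<in> {p. vars p \<subseteq> scroll_vars d k}" by simp
qed

text \<open>A generator is the difference of two monomials related by a swap, and swaps preserve the
  toric class.\<close>

lemma scroll_ideal_param:
  assumes "d \<ge> 1" "f \<in> scroll_ideal d k"
  shows "subst_vars (\<lambda>v. single (param_monom p v) 1) f = (0 :: (_, 'a::comm_ring_1) mpoly)"
proof -
  let ?Q = "{f. vars f \<subseteq> scroll_vars d k \<and> subst_vars (\<lambda>v. single (param_monom p v) 1) f = (0 :: (_, 'a) mpoly)}"
  have "scroll_ideal d k \<subseteq> ?Q"
    unfolding scroll_ideal_def
  proof (rule Idl_least[OF ideal_kernel], rule subsetI)
    fix g :: "(nat \<times> nat, 'a) mpoly" assume "g \<in> minors 2 (scroll_mat d k 1)"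
    then obtain n m where nm: "n < m" "m + Suc k < Suc d * Suc k"
      and g: "g = single (mon (Suc k) {#n, m + Suc k#}) 1 - single (mon (Suc k) {#n + Suc k, m#}) 1"
      unfolding minors_2_scroll[OF assms(1)] by blast
    have "toric_class (Suc k) {#n + Suc k, m#} = toric_class (Suc k) {#n, m + Suc k#}"
      by (rule swap_class) (use swap.intros[of n m "Suc k" "{#}"] nm in simp_all)
    then have "subst_vars (\<lambda>v. single (param_monom p v) 1) g = (0 :: (_, 'a) mpoly)"
      unfolding g by (simp only: subst_vars_diff subst_vars_single monom_eval_param) simp
    moreover have "vars g \<subseteq> scroll_vars d k"
      unfolding g by (intro vars_diff_sub vars_single_sub) (use nm in \<open>auto simp: keys_mon\<close>)
    ultimately show "g \<in> ?Q" by simp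
  qed
  then show ?thesis using assms(2) by blast
qed

section \<open>Linear independence of monomials and rewriting modulo the scroll\<close>

lemma lookup_mult_single:
  "lookup (p * single b 1 :: ('v, 'a::comm_ring_1) mpoly) (a + b) = lookup p a"
proof -
  have "p * single b 1 = (\<Sum>m\<in>keys p. single (m + b) (lookup p m))"
    by (subst sum_singles[of p]) (simp add: sum_distrib_right mult_single)
  then have "lookup (p * single b 1) (a + b) = (\<Sum>m\<in>keys p. if m = a then lookup p m else 0)"
    by (simp add: lookup_sum lookup_single when_def)
  then show ?thesis by (simp add: in_keys_iff)
qed

text \<open>A monomial splits uniquely into a part in the variables \<open>A\<close> and a part
  outside, so distinct monomials \<open>e c\<close> are independent over the polynomials in
  \<open>A\<close>.\<close>

lemma separate_variables:
  fixes P :: "'c \<Rightarrow> ('v, 'a::comm_ring_1) mpoly"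
  assumes C: "finite C" "inj_on e C" and A: "\<And>c. c \<in> C \<Longrightarrow> vars (P c) \<subseteq> A"
    and B: "\<And>c. c \<in> C \<Longrightarrow> keys (e c) \<inter> A = {}"
    and 0: "(\<Sum>c\<in>C. P c * single (e c) 1) = 0" and c: "c \<in> C"
  shows "P c = 0"
proof (rule poly_mapping_eqI)
  fix a
  show "lookup (P c) a = lookup 0 a"
  proof (rule ccontr)
    assume ne: "lookup (P c) a \<noteq> lookup 0 a"
    then have a: "a \<in> keys (P c)" by (simp add: in_keys_iff)
    have z: "lookup (P c' * single (e c') 1) (a + e c) = 0" if "c' \<in> C - {c}" for c'
    proof (rule ccontr)
      assume "lookup (P c' * single (e c') 1) (a + e c) \<noteq> 0"
      then have "a + e c \<in> keys (P c' * single (e c') 1)" by (simp add: in_keys_iff)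
      then obtain a' where a': "a' \<in> keys (P c')" "a + e c = a' + e c'"
        using Poly_Mapping.keys_mult[of "P c'" "single (e c') 1"] by (auto split: if_splits)
      have "keys a \<subseteq> A" "keys a' \<subseteq> A"
        using a a'(1) A c that by (auto dest!: keys_sub_vars)
      have "e c = e c'"
      proof (rule poly_mapping_eqI)
        fix v show "lookup (e c) v = lookup (e c') v"
        proof (cases "v \<in> A")
          case True
          then have "v \<notin> keys (e c)" "v \<notin> keys (e c')" using B[OF c] B[of c'] that by auto
          then show ?thesis by (simp add: in_keys_iff)
        next
          case False
          then have "lookup a v = 0" "lookup a' v = 0"
            using \<open>keys a \<subseteq> A\<close> \<open>keys a' \<subseteq> A\<close> by (auto simp: in_keys_iff)
          then show ?thesis using arg_cong[OF a'(2), of "\<lambda>m. lookup m v"] by (simp add: lookup_add)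
        qed
      qed
      then show False using C(2) c that by (auto simp: inj_on_def)
    qed
    have "0 = lookup (\<Sum>c\<in>C. P c * single (e c) 1) (a + e c)" by (simp add: 0)
    also have "\<dots> = (\<Sum>c'\<in>C. lookup (P c' * single (e c') 1) (a + e c))" by (simp add: lookup_sum)
    also have "\<dots> = lookup (P c * single (e c) 1) (a + e c)"
      using z by (subst sum.remove[OF C(1) c]) simp
    finally show False using ne by (simp add: lookup_mult_single)
  qed
qed

lemma scroll_swap:
  assumes d: "d \<ge> 1" and "swap (Suc k) M M'" "set_mset M \<subseteq> {..<Suc d * Suc k}"
  shows "single (mon (Suc k) M) 1 - single (mon (Suc k) M') 1 \<in> (scroll_ideal d k :: (_, 'a::comm_ring_1) mpoly set)"
  using assms(2)
proof cases
  case (swap n m U)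
  define g :: "(nat \<times> nat, 'a) mpoly" where "g = single (mon (Suc k) {#n, m + Suc k#}) 1 - single (mon (Suc k) {#n + Suc k, m#}) 1"
  have "m + Suc k < Suc d * Suc k" using assms(3) swap by auto
  then have "g \<in> minors 2 (scroll_mat d k 1)"
    unfolding minors_2_scroll[OF d] g_def using swap by blast
  then have g: "g \<in> scroll_ideal d k" unfolding scroll_ideal_def by (rule Idl_self)
  have "single (mon (Suc k) M) 1 - single (mon (Suc k) M') 1 = single (mon (Suc k) U) 1 * g"
    by (simp add: swap g_def right_diff_distrib mult_single mon_add_mset algebra_simps)
  also have "\<dots> \<in> scroll_ideal d k"
  proof (rule mpoly_ideal_mult[OF scroll_ideal_ideal[OF d] _ g], rule vars_single_sub)
    have "set_mset U \<subseteq> {..<Suc d * Suc k}" using assms(3) swap by auto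
    then show "keys (mon (Suc k) U) \<subseteq> scroll_vars d k" by (simp only: keys_mon_scroll)
  qed
  finally show ?thesis .
qed

lemma scroll_swaps:
  assumes d: "d \<ge> 1" and "(swap (Suc k))\<^sup>*\<^sup>* M M'" "set_mset M \<subseteq> {..<Suc d * Suc k}"
  shows "single (mon (Suc k) M) 1 - single (mon (Suc k) M') 1 \<in> (scroll_ideal d k :: (_, 'a::comm_ring_1) mpoly set)"
  using assms(2)
proof (induction rule: rtranclp_induct)
  case base
  then show ?case using mpoly_ideal_0[OF scroll_ideal_ideal[OF d]] by simp
next
  case (step M1 M2)
  have "single (mon (Suc k) M1) 1 - single (mon (Suc k) M2) 1 \<in> (scroll_ideal d k :: (_, 'a) mpoly set)"
    using step(2) swaps_bound[OF step(1) assms(3)] by (rule scroll_swap[OF d])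
  from mpoly_ideal_add[OF scroll_ideal_ideal[OF d] step(3) this] show ?case by simp
qed

text \<open>Both monomials can be swapped into the same window monomial, and every swap on the way
  stays in the range of positions and changes the monomial by an element of the ideal.\<close>

lemma scroll_binomial:
  assumes d: "d \<ge> 1" and M: "set_mset M \<subseteq> {..<Suc d * Suc k}" "set_mset M' \<subseteq> {..<Suc d * Suc k}"
    and "toric_class (Suc k) M = toric_class (Suc k) M'"
  shows "single (mon (Suc k) M) 1 - single (mon (Suc k) M') 1 \<in> (scroll_ideal d k :: (_, 'a::comm_ring_1) mpoly set)"
proof -
  obtain W where W: "(swap (Suc k))\<^sup>*\<^sup>* M W" "(swap (Suc k))\<^sup>*\<^sup>* M' W"
    using same_class_common_swaps[OF _ assms(4)] by blast
  from mpoly_ideal_diff[OF scroll_ideal_ideal[OF d] scroll_swaps[OF d W(1) M(1)] scroll_swaps[OF d W(2) M(2)]]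
  show ?thesis by simp
qed

definition yz_part :: "('u \<Rightarrow> 'w) \<Rightarrow> 'w monomial \<Rightarrow> 'u monomial" where
  "yz_part g m = Poly_Mapping.map_key g m"

lemma lookup_yz_part: "inj g \<Longrightarrow> lookup (yz_part g m) v = lookup m (g v)"
  by (simp add: yz_part_def map_key.rep_eq)

lemma keys_yz_part: "inj g \<Longrightarrow> keys (yz_part g m) = g -` keys m"
  by (auto simp: in_keys_iff lookup_yz_part)

lemma monom_eval_yz:
  fixes m :: "('v + 'v + 'v) monomial"
  assumes m: "keys m \<subseteq> range Inr"
  shows "monom_eval \<sigma> m = monom_eval (\<lambda>v. \<sigma> (Inr (Inl v))) (yz_part (\<lambda>v. Inr (Inl v)) m)
    * monom_eval (\<lambda>v. \<sigma> (Inr (Inr v))) (yz_part (\<lambda>v. Inr (Inr v)) m)"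
proof -
  let ?y = "\<lambda>v :: 'v. Inr (Inl v) :: 'v + 'v + 'v" and ?z = "\<lambda>v :: 'v. Inr (Inr v) :: 'v + 'v + 'v"
  have inj: "inj ?y" "inj ?z" by (simp_all add: inj_on_def)
  have fin: "finite (?y -` keys m)" "finite (?z -` keys m)"
    using inj by (simp_all add: finite_vimageI)
  have k: "keys m = ?y ` (?y -` keys m) \<union> ?z ` (?z -` keys m)"
  proof (intro equalityI subsetI)
    fix x assume "x \<in> keys m"
    moreover from this obtain w where "x = Inr w" using m by blast
    ultimately show "x \<in> ?y ` (?y -` keys m) \<union> ?z ` (?z -` keys m)" by (cases w) auto
  qed auto
  have "monom_eval \<sigma> m = (\<Prod>w\<in>?y ` (?y -` keys m). \<sigma> w ^ lookup m w) * (\<Prod>w\<in>?z ` (?z -` keys m). \<sigma> w ^ lookup m w)"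
    unfolding monom_eval_def by (subst k, rule prod.union_disjoint) (use fin in auto)
  also have "(\<Prod>w\<in>?y ` (?y -` keys m). \<sigma> w ^ lookup m w) = monom_eval (\<lambda>v. \<sigma> (?y v)) (yz_part ?y m)"
    by (subst prod.reindex) (use inj in \<open>simp_all add: inj_on_def monom_eval_def keys_yz_part lookup_yz_part\<close>)
  also have "(\<Prod>w\<in>?z ` (?z -` keys m). \<sigma> w ^ lookup m w) = monom_eval (\<lambda>v. \<sigma> (?z v)) (yz_part ?z m)"
    by (subst prod.reindex) (use inj in \<open>simp_all add: inj_on_def monom_eval_def keys_yz_part lookup_yz_part\<close>)
  finally show ?thesis .
qed

lemma vars_secant_param: "vars (secant_param r v) \<subseteq> {v. fst (snd v) < r}"
  unfolding secant_param_def
  by (intro vars_sum_sub vars_single_sub) (auto simp: param_monom_def keys_nat_add split: if_splits)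

lemma secant_param_Suc: "secant_param (Suc r) v = secant_param r v + single (param_monom r v) 1"
  by (simp add: secant_param_def)

text \<open>Modulo the equations of the scroll in the variables \<open>z\<close>, every \<open>z\<close>-monomial may be replaced by
  a representative of its toric class; then the coefficients of distinct representatives must
  vanish on the \<open>r\<close>-th secant variety one by one.\<close>

lemma join_membership:
  fixes F :: "((nat \<times> nat) + (nat \<times> nat) + (nat \<times> nat), 'a::comm_ring_1) mpoly"
  defines "\<theta> \<equiv> \<lambda>r. case_sum (\<lambda>_. 0) (case_sum (secant_param r) (\<lambda>v. single (param_monom r v) 1))
      :: (nat \<times> nat) + (nat \<times> nat) + (nat \<times> nat) \<Rightarrow> (nat \<times> nat \<times> nat, 'a) mpoly"
  assumes d: "d \<ge> 1" and V: "V = scroll_vars d k"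
    and F: "vars F \<subseteq> Inr ` (V <+> V)" "subst_vars (\<theta> r) F = 0"
    and Q: "ideal Q (mpoly_ring (V <+> V <+> V))"
    and Qy: "subst_vars var_y ` secant_kernel V r \<subseteq> Q" and Qz: "subst_vars var_z ` scroll_ideal d k \<subseteq> Q"
  shows "F \<in> Q"
proof -
  let ?K = "Suc k" and ?N = "Suc d * Suc k"
  let ?Y = "yz_part (\<lambda>v. Inr (Inl v)) :: _ \<Rightarrow> (nat \<times> nat) monomial"
  let ?Z = "yz_part (\<lambda>v. Inr (Inr v)) :: _ \<Rightarrow> (nat \<times> nat) monomial"
  have km: "keys m \<subseteq> Inr ` (V <+> V)" if "m \<in> keys F" for m
    using keys_sub_vars[OF that F(1)] .
  have kr: "keys m \<subseteq> range Inr" if "m \<in> keys F" for m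
    using km[OF that] by blast
  have kY: "keys (?Y m) \<subseteq> V" and kZ: "keys (?Z m) \<subseteq> V" if "m \<in> keys F" for m
    using km[OF that] by (auto simp: keys_yz_part inj_on_def)
  have "\<exists>M. ?Z m = mon ?K M \<and> set_mset M \<subseteq> {..<?N}" if "m \<in> keys F" for m
    using ex_mon[of "?Z m" d k] kZ[OF that] unfolding V by metis
  then obtain z where z: "\<And>m. m \<in> keys F \<Longrightarrow> ?Z m = mon ?K (z m) \<and> set_mset (z m) \<subseteq> {..<?N}"
    by metis
  define cl where "cl m = toric_class ?K (z m)" for m
  define rep where "rep c = (SOME M. set_mset M \<subseteq> {..<?N} \<and> toric_class ?K M = c)" for c
  have rep: "set_mset (rep (cl m)) \<subseteq> {..<?N} \<and> toric_class ?K (rep (cl m)) = cl m" if "m \<in> keys F" for m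
    unfolding rep_def by (rule someI[of _ "z m"]) (use z[OF that] in \<open>simp add: cl_def\<close>)
  \<comment> \<open>The coefficient of the representative of the class \<open>c\<close>, with the
    \<open>y\<close>-variables renamed to those of the ring of the scroll.\<close>
  define G where "G c = (\<Sum>m | m \<in> keys F \<and> cl m = c. single (?Y m) (lookup F m))" for c
  let ?zm = "\<lambda>M. subst_vars var_z (single (mon ?K M) 1 :: (_, 'a) mpoly)"
  have F_eq: "F = (\<Sum>m\<in>keys F. single 0 (lookup F m) * monom_eval var_y (?Y m) * ?zm (z m))"
  proof -
    have "F = (\<Sum>m\<in>keys F. single 0 (lookup F m) * monom_eval Var m)"
      by (simp add: monom_eval_Var mult_single sum_singles[symmetric])
    also have "\<dots> = (\<Sum>m\<in>keys F. single 0 (lookup F m) * monom_eval var_y (?Y m) * ?zm (z m))"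
    proof (rule sum.cong[OF refl])
      fix m assume m: "m \<in> keys F"
      show "single 0 (lookup F m) * monom_eval Var m = single 0 (lookup F m) * monom_eval var_y (?Y m) * ?zm (z m)"
        using z[OF m] by (simp add: monom_eval_yz[OF kr[OF m]] subst_vars_single mult.assoc)
    qed
    finally show ?thesis .
  qed
  \<comment> \<open>This is \<open>F\<close> with every \<open>z\<close>-monomial replaced by the
    representative of its class.\<close>
  define F' where "F' = (\<Sum>m\<in>keys F. single 0 (lookup F m) * monom_eval var_y (?Y m) * ?zm (rep (cl m)))"
  have vy: "vars (monom_eval var_y (?Y m) :: (_, 'a) mpoly) \<subseteq> V <+> V <+> V" if "m \<in> keys F" for m
    unfolding monom_eval_def using kY[OF that] by (intro vars_prod_sub vars_power_sub) auto
  have "F - F' = (\<Sum>m\<in>keys F. single 0 (lookup F m) * monom_eval var_y (?Y m) * (?zm (z m) - ?zm (rep (cl m))))"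
    by (subst F_eq) (simp add: F'_def sum_subtractf right_diff_distrib)
  also have "\<dots> \<in> Q"
  proof (rule mpoly_ideal_sum[OF Q])
    fix m assume m: "m \<in> keys F"
    have "single (mon ?K (z m)) 1 - single (mon ?K (rep (cl m))) 1 \<in> (scroll_ideal d k :: (_, 'a) mpoly set)"
      using z[OF m] rep[OF m] by (intro scroll_binomial[OF d]) (auto simp: cl_def)
    then have "?zm (z m) - ?zm (rep (cl m)) \<in> Q"
      using Qz by (auto simp: subst_vars_diff[symmetric])
    then show "single 0 (lookup F m) * monom_eval var_y (?Y m) * (?zm (z m) - ?zm (rep (cl m))) \<in> Q"
      using vy[OF m] by (intro mpoly_ideal_mult[OF Q] vars_mult_sub) auto
  qed
  finally have 1: "F - F' \<in> Q" .
  let ?C = "cl ` keys F"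
  \<comment> \<open>Distinct classes give distinct monomials in the variables of copy
    \<open>r\<close>, while the coefficients only involve the copies below \<open>r\<close>.\<close>
  have G0: "subst_vars (secant_param r) (G c) = (0 :: (_, 'a) mpoly)" if c: "c \<in> ?C" for c
  proof (rule separate_variables[where C = ?C and e = "class_monom r" and A = "{v. fst (snd v) < r}"])
    show "inj_on (class_monom r) ?C" by (simp add: inj_on_def)
    show "keys (class_monom r c') \<inter> {v. fst (snd v) < r} = {}" for c'
      using keys_class_monom[of r c'] by fastforce
    show "vars (subst_vars (secant_param r) (G c') :: (_, 'a) mpoly) \<subseteq> {v. fst (snd v) < r}" for c'
      by (intro vars_subst_sub vars_secant_param)
    have t: "subst_vars (\<theta> r) F = (\<Sum>m\<in>keys F. subst_vars (secant_param r) (single (?Y m) (lookup F m))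
         * single (class_monom r (cl m)) 1)"
    proof -
      have "subst_vars (\<theta> r) F = (\<Sum>m\<in>keys F. single 0 (lookup F m) * monom_eval (\<theta> r) m)"
        by (rule subst_vars_superset) auto
      also have "\<dots> = (\<Sum>m\<in>keys F. subst_vars (secant_param r) (single (?Y m) (lookup F m))
         * single (class_monom r (cl m)) 1)"
      proof (rule sum.cong[OF refl])
        fix m assume m: "m \<in> keys F"
        have "monom_eval (\<theta> r) m = monom_eval (secant_param r) (?Y m) * single (class_monom r (cl m)) 1"
          unfolding cl_def monom_eval_param[symmetric] using z[OF m]
          by (simp add: monom_eval_yz[OF kr[OF m]] \<theta>_def)
        then show "single 0 (lookup F m) * monom_eval (\<theta> r) m =
          subst_vars (secant_param r) (single (?Y m) (lookup F m)) * single (class_monom r (cl m)) 1"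
          by (simp add: subst_vars_single mult.assoc)
      qed
      finally show ?thesis .
    qed
    have "(\<Sum>c\<in>?C. subst_vars (secant_param r) (G c) * single (class_monom r c) 1)
      = (\<Sum>c\<in>?C. \<Sum>m | m \<in> keys F \<and> cl m = c. subst_vars (secant_param r) (single (?Y m) (lookup F m))
         * single (class_monom r (cl m)) 1)"
      unfolding G_def subst_vars_sum sum_distrib_right by (intro sum.cong refl) auto
    also have "\<dots> = subst_vars (\<theta> r) F"
      unfolding t by (rule sum.image_gen[symmetric]) simp
    finally show "(\<Sum>c\<in>?C. subst_vars (secant_param r) (G c) * single (class_monom r c) 1) = (0 :: (_, 'a) mpoly)"
      using F(2) by simp
  qed (use c in auto)
  have "F' = (\<Sum>c\<in>?C. \<Sum>m | m \<in> keys F \<and> cl m = c. single 0 (lookup F m) * monom_eval var_y (?Y m) * ?zm (rep (cl m)))"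
    unfolding F'_def by (rule sum.image_gen) simp
  also have "\<dots> = (\<Sum>c\<in>?C. subst_vars var_y (G c) * ?zm (rep c))"
    unfolding G_def subst_vars_sum sum_distrib_right subst_vars_single[of var_y]
    by (intro sum.cong refl) auto
  also have "\<dots> \<in> Q"
  proof (rule mpoly_ideal_sum[OF Q])
    fix c assume c: "c \<in> ?C"
    have "vars (G c) \<subseteq> V"
      unfolding G_def by (intro vars_sum_sub vars_single_sub) (use kY in auto)
    then have "G c \<in> secant_kernel V r" using G0[OF c] by (simp add: secant_kernel_def)
    then have "subst_vars var_y (G c) \<in> Q" using Qy by blast
    moreover have "vars (?zm (rep c)) \<subseteq> V <+> V <+> V"
    proof (intro vars_subst_sub)
      fix v assume "v \<in> vars (single (mon (Suc k) (rep c)) 1 :: (_, 'a) mpoly)"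
      then have "v \<in> keys (mon (Suc k) (rep c))"
        using vars_single[of "mon (Suc k) (rep c)" "1::'a"] by blast
      moreover have "set_mset (rep c) \<subseteq> {..<?N}" using c rep by auto
      ultimately have "v \<in> V" unfolding V keys_mon_scroll[symmetric] by blast
      then show "vars (var_z v :: (_, 'a) mpoly) \<subseteq> V <+> V <+> V" by auto
    qed
    ultimately show "subst_vars var_y (G c) * ?zm (rep c) \<in> Q" by (intro mpoly_ideal_mult'[OF Q])
  qed
  finally have 2: "F' \<in> Q" .
  from mpoly_ideal_add[OF Q 1 2] show ?thesis by simp
qed

lemma secant_kernel_prime:
  "primeideal (secant_kernel V r :: (nat \<times> nat, 'a::idom) mpoly set) (mpoly_ring V)"
  unfolding secant_kernel_def by (rule primeideal_kernel)

lemma secant_kernel_ideal: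
  "ideal (secant_kernel V r :: (nat \<times> nat, 'a::comm_ring_1) mpoly set) (mpoly_ring V)"
  unfolding secant_kernel_def by (rule ideal_kernel)

lemma subst_vars_zero_map: "subst_vars (\<lambda>_. 0) g = single 0 (lookup g 0)"
proof -
  have z: "monom_eval (\<lambda>_. 0) m = (0 :: ('u, 'b::comm_ring_1) mpoly)" if "m \<noteq> 0" for m :: "'v monomial"
  proof -
    have "keys m \<noteq> {}" using that by simp
    then obtain v where "v \<in> keys m" by blast
    then show ?thesis
      unfolding monom_eval_def
      by (intro prod_zero bexI[of _ v]) (simp_all add: in_keys_iff power_0_left)
  qed
  have "subst_vars (\<lambda>_. 0) g = (\<Sum>m\<in>insert 0 (keys g). single 0 (lookup g m) * monom_eval (\<lambda>_. 0) m)"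
    by (rule subst_vars_superset) auto
  also have "\<dots> = (\<Sum>m\<in>insert 0 (keys g). if m = 0 then single 0 (lookup g 0) else 0)"
    by (rule sum.cong[OF refl]) (simp add: z)
  finally show ?thesis by simp
qed

text \<open>The inclusion of the kernel is the case \<open>r = 0\<close> of
  \<open>join_membership\<close>: the empty sum parametrizes the origin, and the join of the origin
  with the scroll is the scroll.\<close>

lemma scroll_ideal_eq_kernel:
  assumes d: "d \<ge> 1"
  shows "(scroll_ideal d k :: (_, 'a::comm_ring_1) mpoly set) = secant_kernel (scroll_vars d k) 1"
proof (intro equalityI subsetI)
  have sp: "secant_param (Suc 0) = (\<lambda>v. single (param_monom 0 v) 1 :: (_, 'a) mpoly)"
    by (simp add: secant_param_def fun_eq_iff)
  fix f :: "(nat \<times> nat, 'a) mpoly"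
  { assume f: "f \<in> scroll_ideal d k"
    then show "f \<in> secant_kernel (scroll_vars d k) 1"
      using scroll_ideal_param[OF d f, of 0] mpoly_ideal_sub[OF scroll_ideal_ideal[OF d] f]
      by (simp add: secant_kernel_def sp) }
  assume f: "f \<in> secant_kernel (scroll_vars d k) 1"
  let ?V = "scroll_vars d k"
  define \<pi> :: "(nat \<times> nat) + (nat \<times> nat) + (nat \<times> nat) \<Rightarrow> (nat \<times> nat, 'a) mpoly"
    where "\<pi> = case_sum (\<lambda>_. 0) (case_sum (\<lambda>_. 0) Var)"
  \<comment> \<open>The preimage of the scroll ideal under \<open>y = 0\<close>,
    \<open>z = x\<close>. It contains every polynomial in \<open>y\<close> without constant term, as
    the case \<open>r = 0\<close> demands.\<close>
  define Q where "Q = {p. vars p \<subseteq> ?V <+> ?V <+> ?V \<and> subst_vars \<pi> p \<in> scroll_ideal d k}"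
  have v0: "subst_vars (\<lambda>_. 0) g = subst_vars (secant_param 0) g" for g :: "(nat \<times> nat, 'a) mpoly"
    by (simp add: subst_vars_def secant_param_def)
  have vz: "vars (subst_vars var_z g :: (_, 'a) mpoly) \<subseteq> Inr ` (?V <+> ?V)" if "vars g \<subseteq> ?V" for g
    using that by (intro vars_subst_sub) auto
  have "subst_vars var_z f \<in> Q"
  proof (rule join_membership[OF d refl, where r = 0])
    show "ideal Q (mpoly_ring (?V <+> ?V <+> ?V))"
      unfolding Q_def by (rule ideal_preimage[OF scroll_ideal_ideal[OF d]]) (auto simp: \<pi>_def)
    show "subst_vars var_y ` secant_kernel ?V 0 \<subseteq> Q"
    proof (rule image_subsetI)
      fix g :: "(nat \<times> nat, 'a) mpoly" assume g: "g \<in> secant_kernel ?V 0"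
      then have "vars (subst_vars var_y g :: (_, 'a) mpoly) \<subseteq> ?V <+> ?V <+> ?V"
        by (intro vars_subst_sub) (auto simp: secant_kernel_def)
      moreover have "subst_vars (\<lambda>_. 0) g = (0 :: (nat \<times> nat, 'a) mpoly)"
      proof -
        have "single 0 (lookup g 0) = (0 :: (nat \<times> nat \<times> nat, 'a) mpoly)"
          using g by (simp add: secant_kernel_def subst_vars_zero_map flip: v0)
        then have "lookup g 0 = 0" by (metis lookup_single_eq lookup_zero)
        then show ?thesis by (simp add: subst_vars_zero_map)
      qed
      ultimately show "subst_vars var_y g \<in> Q"
        by (simp add: Q_def subst_vars_comp \<pi>_def mpoly_ideal_0[OF scroll_ideal_ideal[OF d]])
    qed
    show "subst_vars var_z ` scroll_ideal d k \<subseteq> Q"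
      using vz mpoly_ideal_sub[OF scroll_ideal_ideal[OF d]]
      by (auto simp: Q_def subst_vars_comp \<pi>_def subst_vars_self)
    show "vars (subst_vars var_z f :: (_, 'a) mpoly) \<subseteq> Inr ` (?V <+> ?V)"
      using f by (intro vz) (simp add: secant_kernel_def)
    show "subst_vars (case_sum (\<lambda>_. 0) (case_sum (secant_param 0) (\<lambda>v. single (param_monom 0 v) 1)))
       (subst_vars var_z f) = (0 :: (_, 'a) mpoly)"
      using f by (simp add: subst_vars_comp secant_kernel_def sp)
  qed
  then show "f \<in> scroll_ideal d k"
    by (simp add: Q_def subst_vars_comp \<pi>_def subst_vars_self)
qed

text \<open>The evaluation \<open>\<theta>\<close> respects \<open>x = y + z\<close> because the
  parametrization by \<open>r + 1\<close> copies is the one by \<open>r\<close> copies plus one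
  more; so it kills the join generators. Conversely, modulo \<open>x - y - z\<close> a polynomial in
  \<open>x\<close> is its value at \<open>y + z\<close>, which \<open>join_membership\<close>
  handles.\<close>

lemma join_secant_kernel:
  assumes d: "d \<ge> 1" and V: "V = scroll_vars d k"
  shows "join_ideal V (secant_kernel V r) (scroll_ideal d k :: (_, 'a::comm_ring_1) mpoly set) = secant_kernel V (Suc r)"
proof -
  let ?W = "V <+> V <+> V"
  let ?S = "subst_vars var_y ` secant_kernel V r \<union> subst_vars var_z ` scroll_ideal d k
     \<union> {var_x a - var_y a - var_z a | a. a \<in> V} :: (_, 'a) mpoly set"
  define Q where "Q = Idl\<^bsub>mpoly_ring ?W\<^esub> ?S"
  have Iv: "vars f \<subseteq> V" if "f \<in> scroll_ideal d k" for f :: "(nat \<times> nat, 'a) mpoly"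
    using mpoly_ideal_sub[OF scroll_ideal_ideal[OF d] that] by (simp add: V)
  have SW: "vars p \<subseteq> ?W" if "p \<in> ?S" for p
  proof -
    have y: "vars (subst_vars var_y g :: (_, 'a) mpoly) \<subseteq> ?W" if "vars g \<subseteq> V" for g
      using that by (intro vars_subst_sub) auto
    have z: "vars (subst_vars var_z g :: (_, 'a) mpoly) \<subseteq> ?W" if "vars g \<subseteq> V" for g
      using that by (intro vars_subst_sub) auto
    have xyz: "vars (var_x a - var_y a - var_z a :: (_, 'a) mpoly) \<subseteq> ?W" if "a \<in> V" for a
      using that by (intro vars_diff_sub) auto
    from \<open>p \<in> ?S\<close> show ?thesis
      using y z xyz Iv
      by (elim UnE imageE CollectE exE conjE) (simp_all add: secant_kernel_def)
  qed
  have Q: "ideal Q (mpoly_ring ?W)"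
    unfolding Q_def by (rule Idl_ideal) (use SW in blast)
  have SQ: "?S \<subseteq> Q" unfolding Q_def by (rule subsetI) (rule Idl_self)
  define \<theta> :: "(nat \<times> nat) + (nat \<times> nat) + (nat \<times> nat) \<Rightarrow> (nat \<times> nat \<times> nat, 'a) mpoly"
    where "\<theta> = case_sum (secant_param (Suc r)) (case_sum (secant_param r) (\<lambda>v. single (param_monom r v) 1))"
  have Q0: "subst_vars \<theta> p = 0" if "p \<in> Q" for p
  proof -
    have "Q \<subseteq> {p. vars p \<subseteq> ?W \<and> subst_vars \<theta> p = 0}"
      unfolding Q_def
    proof (rule Idl_least[OF ideal_kernel], rule subsetI, rule CollectI, rule conjI)
      fix p assume p: "p \<in> ?S"
      then show "vars p \<subseteq> ?W" by (rule SW)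
      from p show "subst_vars \<theta> p = 0"
        by (elim UnE imageE CollectE exE conjE) (simp_all add: subst_vars_comp \<theta>_def secant_kernel_def scroll_ideal_param[OF d]
            subst_vars_diff secant_param_Suc)
    qed
    from subsetD[OF this that] show ?thesis by simp
  qed
  have "f \<in> join_ideal V (secant_kernel V r) (scroll_ideal d k) \<longleftrightarrow> f \<in> secant_kernel V (Suc r)"
    for f :: "(nat \<times> nat, 'a) mpoly"
  proof
    assume f: "f \<in> join_ideal V (secant_kernel V r) (scroll_ideal d k)"
    then have "subst_vars var_x f \<in> Q" by (simp add: join_ideal_def Q_def)
    from Q0[OF this] show "f \<in> secant_kernel V (Suc r)"
      using f by (simp add: join_ideal_def secant_kernel_def subst_vars_comp \<theta>_def)
  next
    assume f: "f \<in> secant_kernel V (Suc r)"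
    then have fV: "vars f \<subseteq> V" by (simp add: secant_kernel_def)
    let ?F = "subst_vars (\<lambda>a. var_y a + var_z a) f :: (_, 'a) mpoly"
    have yz: "vars (var_y a + var_z a :: (_, 'a) mpoly) \<subseteq> Inr ` (V <+> V)" if "a \<in> V" for a
      using that by (intro vars_add_sub) auto
    have "subst_vars var_x f - ?F \<in> Q"
    proof (rule ideal_subst_vars_diff[OF Q _ _ _ fV])
      fix a assume a: "a \<in> V"
      then have "var_x a - var_y a - var_z a \<in> ?S" by blast
      then show "var_x a - (var_y a + var_z a) \<in> Q"
        using SQ by (simp only: diff_diff_eq subsetD)
      show "vars (var_x a :: (_, 'a) mpoly) \<subseteq> ?W" using a by auto
      show "vars (var_y a + var_z a :: (_, 'a) mpoly) \<subseteq> ?W"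
        using a by (intro vars_add_sub) auto
    qed
    moreover have "?F \<in> Q"
    proof (rule join_membership[OF d V, where r = r])
      show "vars ?F \<subseteq> Inr ` (V <+> V)"
        by (rule vars_subst_sub) (use fV yz in blast)
      show "subst_vars (case_sum (\<lambda>_. 0) (case_sum (secant_param r) (\<lambda>v. single (param_monom r v) 1))) ?F
         = (0 :: (_, 'a) mpoly)"
        using f by (simp add: subst_vars_comp subst_vars_add secant_kernel_def secant_param_Suc[abs_def])
    qed (use Q SQ in auto)
    ultimately have "subst_vars var_x f \<in> Q" using mpoly_ideal_add[OF Q] by fastforce
    then show "f \<in> join_ideal V (secant_kernel V r) (scroll_ideal d k)"
      using fV by (simp add: join_ideal_def Q_def)
  qed
  then show ?thesis by blast
qed

lemma secant_ideal_scroll: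
  assumes "d \<ge> 1" "V = scroll_vars d k" "r \<ge> 1"
  shows "secant_ideal V (scroll_ideal d k :: (_, 'a::comm_ring_1) mpoly set) r = secant_kernel V r"
proof -
  have "((\<lambda>J. join_ideal V J (scroll_ideal d k)) ^^ n) (scroll_ideal d k :: (_, 'a) mpoly set) = secant_kernel V (Suc n)" for n
  proof (induction n)
    case 0
    then show ?case using scroll_ideal_eq_kernel[OF assms(1), of k] by (simp add: assms(2))
  next
    case (Suc n)
    then show ?case by (simp only: funpow.simps comp_apply join_secant_kernel[OF assms(1,2)])
  qed
  then show ?thesis using assms(3) by (simp add: secant_ideal_def)
qed

section \<open>Symbolic powers\<close>

lemma ideals_set_simps [simp]:
  "carrier (ideals_set R) = {I. ideal I R}" "I \<otimes>\<^bsub>ideals_set R\<^esub> J = ideal_prod R I J"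
  "I \<oplus>\<^bsub>ideals_set R\<^esub> J = I <+>\<^bsub>R\<^esub> J" "\<zero>\<^bsub>ideals_set R\<^esub> = {\<zero>\<^bsub>R\<^esub>}"
  "\<one>\<^bsub>ideals_set R\<^esub> = carrier R"
  by (simp_all add: ideals_set_def)

abbreviation ideal_power :: "'v set \<Rightarrow> ('v, 'a::comm_ring_1) mpoly set \<Rightarrow> nat \<Rightarrow> ('v, 'a) mpoly set" where
  "ideal_power V P s \<equiv> P [^]\<^bsub>ideals_set (mpoly_ring V)\<^esub> s"

lemma ideal_power_0 [simp]: "ideal_power V P 0 = {p. vars p \<subseteq> V}"
  by (simp add: nat_pow_def ideals_set_def)

lemma ideal_power_Suc [simp]: "ideal_power V P (Suc s) = ideal_prod (mpoly_ring V) (ideal_power V P s) P"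
  by (simp add: nat_pow_def ideals_set_def)

context
  fixes P :: "('v, 'a::comm_ring_1) mpoly set" and V
  assumes P: "ideal P (mpoly_ring V)"
begin

lemma ideal_power_ideal: "ideal (ideal_power V P s) (mpoly_ring V)"
proof (induction s)
  case 0
  show ?case using ring.oneideal[OF ring_mpoly[of V]] by simp
next
  case (Suc s)
  then show ?case using ring.ideal_prod_is_ideal[OF ring_mpoly _ P] by simp
qed

lemma ideal_power_add:
  "ideal_prod (mpoly_ring V) (ideal_power V P s) (ideal_power V P t) = ideal_power V P (s + t)"
proof (induction t)
  case 0
  show ?case using ring.ideal_prod_one[OF ring_mpoly ideal_power_ideal, of s] by simp
next
  case (Suc t)
  then show ?case
    using ring.ideal_prod_assoc[OF ring_mpoly ideal_power_ideal ideal_power_ideal P, of s t] by simp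
qed

lemma ideal_power_mult: "a \<in> ideal_power V P s \<Longrightarrow> b \<in> ideal_power V P t \<Longrightarrow> a * b \<in> ideal_power V P (s + t)"
  using ideal_prod.prod[of a "ideal_power V P s" b "ideal_power V P t" "mpoly_ring V"]
  by (simp add: ideal_power_add)

lemma ideal_power_prod:
  assumes "finite A" "\<And>x. x \<in> A \<Longrightarrow> f x \<in> P"
  shows "(\<Prod>x\<in>A. f x) \<in> ideal_power V P (card A)"
  using assms
proof (induction A)
  case (insert x A)
  then have "(\<Prod>x\<in>A. f x) * f x \<in> ideal_power V P (Suc (card A))"
    using ideal_prod.prod[of "\<Prod>x\<in>A. f x" _ "f x" P "mpoly_ring V"] by simp
  then show ?case using insert by (simp add: mult.commute)
qed simp

end

lemma minimal_primes_prime: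
  assumes "primeideal P R" shows "minimal_primes R P = {P}"
  using assms by (auto simp: minimal_primes_def)

text \<open>A prime ideal is its own only minimal prime. In a domain the witness \<open>v\<close>
  can be cancelled, since it lies outside an ideal and so is not zero.\<close>

lemma symbolic_power_prime:
  fixes P :: "('v::linorder, 'a::idom) mpoly set"
  assumes P: "primeideal P (mpoly_ring V)"
  shows "symbolic_power (mpoly_ring V) P s
    = {f. vars f \<subseteq> V \<and> (\<exists>u. vars u \<subseteq> V \<and> u \<notin> P \<and> u * f \<in> ideal_power V P s)}"
proof -
  have I: "ideal P (mpoly_ring V)" using P by (rule primeideal.axioms(1))
  have 0: "0 \<in> P" by (rule mpoly_ideal_0[OF I])
  have "(\<exists>g\<in>ideal_power V P s. \<exists>u\<in>{p. vars p \<subseteq> V} - P. \<exists>v\<in>{p. vars p \<subseteq> V} - P.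
      v \<otimes>\<^bsub>mpoly_ring V\<^esub> (u \<otimes>\<^bsub>mpoly_ring V\<^esub> f \<ominus>\<^bsub>mpoly_ring V\<^esub> g) = \<zero>\<^bsub>mpoly_ring V\<^esub>) \<longleftrightarrow>
    (\<exists>u. vars u \<subseteq> V \<and> u \<notin> P \<and> u * f \<in> ideal_power V P s)" for f
  proof -
    have g: "vars g \<subseteq> V" if "g \<in> ideal_power V P s" for g
      using mpoly_ideal_sub[OF ideal_power_ideal[OF I] that] .
    show ?thesis
    proof
      assume "\<exists>g\<in>ideal_power V P s. \<exists>u\<in>{p. vars p \<subseteq> V} - P. \<exists>v\<in>{p. vars p \<subseteq> V} - P.
        v \<otimes>\<^bsub>mpoly_ring V\<^esub> (u \<otimes>\<^bsub>mpoly_ring V\<^esub> f \<ominus>\<^bsub>mpoly_ring V\<^esub> g) = \<zero>\<^bsub>mpoly_ring V\<^esub>"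
      then obtain g u v where h: "g \<in> ideal_power V P s" "vars u \<subseteq> V" "u \<notin> P" "vars v \<subseteq> V" "v \<notin> P"
        "v * (u * f - g) = 0" by (auto simp: g)
      then have "u * f = g" using 0 by auto
      then show "\<exists>u. vars u \<subseteq> V \<and> u \<notin> P \<and> u * f \<in> ideal_power V P s" using h by blast
    next
      assume "\<exists>u. vars u \<subseteq> V \<and> u \<notin> P \<and> u * f \<in> ideal_power V P s"
      then obtain u where "vars u \<subseteq> V" "u \<notin> P" "u * f \<in> ideal_power V P s" by blast
      then show "\<exists>g\<in>ideal_power V P s. \<exists>u\<in>{p. vars p \<subseteq> V} - P. \<exists>v\<in>{p. vars p \<subseteq> V} - P.
        v \<otimes>\<^bsub>mpoly_ring V\<^esub> (u \<otimes>\<^bsub>mpoly_ring V\<^esub> f \<ominus>\<^bsub>mpoly_ring V\<^esub> g) = \<zero>\<^bsub>mpoly_ring V\<^esub>"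
        using g by (intro bexI[of _ "u * f"] bexI[of _ u]) auto
    qed
  qed
  then show ?thesis
    unfolding symbolic_power_def Let_def minimal_primes_prime[OF P] by simp
qed

context
  fixes P :: "('v::linorder, 'a::idom) mpoly set" and V
  assumes P: "primeideal P (mpoly_ring V)"
begin

lemma symbolic_powerI:
  "vars f \<subseteq> V \<Longrightarrow> vars u \<subseteq> V \<Longrightarrow> u \<notin> P \<Longrightarrow> u * f \<in> ideal_power V P s \<Longrightarrow> f \<in> symbolic_power (mpoly_ring V) P s"
  unfolding symbolic_power_prime[OF P] by blast

lemma symbolic_powerE:
  assumes "f \<in> symbolic_power (mpoly_ring V) P s"
  obtains u where "vars f \<subseteq> V" "vars u \<subseteq> V" "u \<notin> P" "u * f \<in> ideal_power V P s"
  using assms unfolding symbolic_power_prime[OF P] by blast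

lemma prime_mult: "vars a \<subseteq> V \<Longrightarrow> vars b \<subseteq> V \<Longrightarrow> a \<notin> P \<Longrightarrow> b \<notin> P \<Longrightarrow> a * b \<notin> P"
  using primeideal.I_prime[OF P, of a b] by auto

lemma symbolic_power_mult:
  assumes "f \<in> symbolic_power (mpoly_ring V) P s" "g \<in> symbolic_power (mpoly_ring V) P t"
  shows "f * g \<in> symbolic_power (mpoly_ring V) P (s + t)"
proof -
  note I = primeideal.axioms(1)[OF P]
  obtain u where u: "vars f \<subseteq> V" "vars u \<subseteq> V" "u \<notin> P" "u * f \<in> ideal_power V P s"
    using assms(1) by (rule symbolic_powerE)
  obtain v where v: "vars g \<subseteq> V" "vars v \<subseteq> V" "v \<notin> P" "v * g \<in> ideal_power V P t"
    using assms(2) by (rule symbolic_powerE)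
  have "(u * f) * (v * g) \<in> ideal_power V P (s + t)" by (rule ideal_power_mult[OF I u(4) v(4)])
  then have "(u * v) * (f * g) \<in> ideal_power V P (s + t)" by (simp add: ac_simps)
  then show ?thesis
    using u v by (intro symbolic_powerI[of _ "u * v"] vars_mult_sub prime_mult)
qed

lemma symbolic_power_ideal: "ideal (symbolic_power (mpoly_ring V) P s) (mpoly_ring V)"
proof (rule ideal_mpolyI)
  note I = primeideal.axioms(1)[OF P]
  have one: "1 \<notin> P"
    using primeideal.I_notcarr[OF P] ideal.one_imp_carrier[OF I] by auto
  show "vars p \<subseteq> V" if "p \<in> symbolic_power (mpoly_ring V) P s" for p
    using that unfolding symbolic_power_prime[OF P] by blast
  show "0 \<in> symbolic_power (mpoly_ring V) P s"
    by (rule symbolic_powerI[of _ 1]) (use one mpoly_ideal_0[OF ideal_power_ideal[OF I]] in auto)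
  show "p + q \<in> symbolic_power (mpoly_ring V) P s"
    if p: "p \<in> symbolic_power (mpoly_ring V) P s" and q: "q \<in> symbolic_power (mpoly_ring V) P s" for p q
  proof -
    obtain u where u: "vars p \<subseteq> V" "vars u \<subseteq> V" "u \<notin> P" "u * p \<in> ideal_power V P s"
      using p by (rule symbolic_powerE)
    obtain v where v: "vars q \<subseteq> V" "vars v \<subseteq> V" "v \<notin> P" "v * q \<in> ideal_power V P s"
      using q by (rule symbolic_powerE)
    have "v * (u * p) + u * (v * q) \<in> ideal_power V P s"
      by (rule mpoly_ideal_add[OF ideal_power_ideal[OF I] mpoly_ideal_mult[OF ideal_power_ideal[OF I] v(2) u(4)]
            mpoly_ideal_mult[OF ideal_power_ideal[OF I] u(2) v(4)]])
    then have "(u * v) * (p + q) \<in> ideal_power V P s" by (simp add: algebra_simps)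
    then show ?thesis
      using u v by (intro symbolic_powerI[of _ "u * v"] vars_mult_sub prime_mult vars_add_sub)
  qed
  show "p * q \<in> symbolic_power (mpoly_ring V) P s"
    if p: "vars p \<subseteq> V" and q: "q \<in> symbolic_power (mpoly_ring V) P s" for p q
  proof -
    obtain v where v: "vars q \<subseteq> V" "vars v \<subseteq> V" "v \<notin> P" "v * q \<in> ideal_power V P s"
      using q by (rule symbolic_powerE)
    have "p * (v * q) \<in> ideal_power V P s"
      by (rule mpoly_ideal_mult[OF ideal_power_ideal[OF I] p v(4)])
    then have "v * (p * q) \<in> ideal_power V P s" by (simp add: ac_simps)
    then show ?thesis
      using v p by (intro symbolic_powerI[of _ v] vars_mult_sub)
  qed
qed

end

section \<open>Vanishing order along a secant variety\<close>

text \<open>Adding a new variable \<open>w\<^sub>i\<^sub>j = (2, i, j)\<close> to the coordinate \<open>x\<^sub>i\<^sub>j\<close> of the generic point of the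
  secant variety, the order of vanishing along the variety becomes the order in the \<open>w\<^sub>i\<^sub>j\<close>.
  Unlike derivatives, this works in every characteristic.\<close>

definition normal_param :: "nat \<Rightarrow> nat \<times> nat \<Rightarrow> (nat \<times> nat \<times> nat, 'a::comm_ring_1) mpoly" where
  "normal_param r v = secant_param r v + Var (2, v)"

definition normal_degree :: "(nat \<times> nat \<times> nat) monomial \<Rightarrow> nat" where
  "normal_degree m = (\<Sum>v | v \<in> keys m \<and> fst v = 2. lookup m v)"

definition order_ge :: "nat \<Rightarrow> (nat \<times> nat \<times> nat, 'a::comm_ring_1) mpoly set" where
  "order_ge s = {p. \<forall>m\<in>keys p. s \<le> normal_degree m}"

lemma normal_degree_superset:
  "finite S \<Longrightarrow> keys m \<subseteq> S \<Longrightarrow> normal_degree m = (\<Sum>v | v \<in> S \<and> fst v = 2. lookup m v)"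
  unfolding normal_degree_def by (rule sum.mono_neutral_left) (auto simp: in_keys_iff)

lemma normal_degree_add: "normal_degree (m + n) = normal_degree m + normal_degree n"
proof -
  let ?S = "keys m \<union> keys n"
  have "normal_degree (m + n) = (\<Sum>v | v \<in> ?S \<and> fst v = 2. lookup (m + n) v)"
    by (rule normal_degree_superset) (auto simp: keys_nat_add)
  then show ?thesis
    by (simp add: lookup_add sum.distrib normal_degree_superset[of ?S])
qed

lemma normal_degree_0 [simp]: "normal_degree 0 = 0"
  by (simp add: normal_degree_def)

lemma normal_degree_single: "normal_degree (single v e) = (if fst v = 2 then e else 0)"
proof -
  have "{w. w = v \<and> fst w = 2} = (if fst v = 2 then {v} else {})" by auto
  then show ?thesis by (cases "e = 0") (simp_all add: normal_degree_def)
qed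

lemma order_ge_add: "p \<in> order_ge s \<Longrightarrow> q \<in> order_ge s \<Longrightarrow> p + q \<in> order_ge s"
  using Poly_Mapping.keys_add[of p q] by (auto simp: order_ge_def)

lemma order_ge_diff: "p \<in> order_ge s \<Longrightarrow> q \<in> order_ge s \<Longrightarrow> p - q \<in> order_ge s"
proof -
  have "keys (p - q) \<subseteq> keys p \<union> keys q" by (auto simp: in_keys_iff lookup_minus)
  then show "p \<in> order_ge s \<Longrightarrow> q \<in> order_ge s \<Longrightarrow> p - q \<in> order_ge s" by (auto simp: order_ge_def)
qed

lemma order_ge_mult: "p \<in> order_ge s \<Longrightarrow> q \<in> order_ge t \<Longrightarrow> p * q \<in> order_ge (s + t)"
  using Poly_Mapping.keys_mult[of p q] by (fastforce simp: order_ge_def normal_degree_add add_mono)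

lemma order_ge_0 [simp]: "p \<in> order_ge 0" "0 \<in> order_ge s"
  by (simp_all add: order_ge_def)

definition normal_part :: "nat \<Rightarrow> (nat \<times> nat \<times> nat, 'a::comm_ring_1) mpoly \<Rightarrow> (nat \<times> nat \<times> nat, 'a) mpoly" where
  "normal_part t p = (\<Sum>m | m \<in> keys p \<and> normal_degree m = t. single m (lookup p m))"

lemma lookup_normal_part: "lookup (normal_part t p) m = (if normal_degree m = t then lookup p m else 0)"
proof -
  have "lookup (normal_part t p) m = (\<Sum>n | n \<in> keys p \<and> normal_degree n = t. if n = m then lookup p n else 0)"
    by (simp add: normal_part_def lookup_sum lookup_single when_def)
  then show ?thesis by (auto simp: in_keys_iff)
qed

text \<open>Over a domain the order in the normal variables is a valuation: the product of the
  lowest forms is not zero and is the lowest form of the product. Since \<open>u\<close> has order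
  zero, it does not change the order of \<open>f\<close>.\<close>

lemma order_ge_cancel:
  fixes u f :: "(nat \<times> nat \<times> nat, 'a::idom) mpoly"
  assumes u: "u \<notin> order_ge 1" and uf: "u * f \<in> order_ge s"
  shows "f \<in> order_ge s"
proof (rule ccontr)
  assume f: "f \<notin> order_ge s"
  define t where "t = Min (normal_degree ` keys f)"
  obtain m0 where m0: "m0 \<in> keys f" "normal_degree m0 < s" using f by (auto simp: order_ge_def not_le)
  then have ne: "normal_degree ` keys f \<noteq> {}" by blast
  have t_le: "t \<le> normal_degree m" if "m \<in> keys f" for m
    unfolding t_def using that by (intro Min_le) auto
  then have ts: "t < s" using m0 by (meson le_less_trans)
  obtain m1 where m1: "m1 \<in> keys f" "normal_degree m1 = t"
    using Min_in[OF _ ne] by (auto simp: t_def)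
  obtain m2 where m2: "m2 \<in> keys u" "normal_degree m2 = 0" using u by (auto simp: order_ge_def)
  have "lookup (normal_part 0 u) m2 \<noteq> 0" "lookup (normal_part t f) m1 \<noteq> 0"
    using m1 m2 by (simp_all add: lookup_normal_part in_keys_iff)
  then have "normal_part 0 u * normal_part t f \<noteq> 0" by auto
  then have "keys (normal_part 0 u * normal_part t f) \<noteq> {}" by simp
  then obtain m where m: "m \<in> keys (normal_part 0 u * normal_part t f)" by blast
  then obtain a b where ab: "m = a + b" "a \<in> keys (normal_part 0 u)" "b \<in> keys (normal_part t f)"
    using Poly_Mapping.keys_mult by blast
  then have deg: "normal_degree m = t"
    by (auto simp: in_keys_iff lookup_normal_part normal_degree_add split: if_splits)
  have 1: "f - normal_part t f \<in> order_ge (Suc t)"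
  proof -
    have "Suc t \<le> normal_degree m" if "m \<in> keys (f - normal_part t f)" for m
      using that t_le[of m] by (auto simp: in_keys_iff lookup_minus lookup_normal_part split: if_splits)
    then show ?thesis by (simp add: order_ge_def)
  qed
  have 2: "u - normal_part 0 u \<in> order_ge 1"
    by (auto simp: order_ge_def in_keys_iff lookup_minus lookup_normal_part Suc_le_eq split: if_splits)
  have 3: "f \<in> order_ge t" using t_le by (auto simp: order_ge_def)
  \<comment> \<open>Everything in \<open>u * f\<close> beyond the product of the lowest forms has
    order larger than \<open>t\<close>, so the monomial \<open>m\<close> cannot be
    cancelled.\<close>
  have "u * f - normal_part 0 u * normal_part t f
      = normal_part 0 u * (f - normal_part t f) + (u - normal_part 0 u) * f"
    by (simp add: algebra_simps)
  also have "\<dots> \<in> order_ge (Suc t)"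
    using order_ge_mult[OF order_ge_0(1)[of "normal_part 0 u"] 1] order_ge_mult[OF 2 3]
    by (intro order_ge_add) simp_all
  finally have "lookup (u * f - normal_part 0 u * normal_part t f) m = 0"
    using deg by (force simp: order_ge_def in_keys_iff)
  then have "m \<in> keys (u * f)" using m by (simp add: in_keys_iff lookup_minus)
  then show False using uf deg ts by (auto simp: order_ge_def)
qed

lemma subst_kill_normal:
  "subst_vars (\<lambda>v. if fst v = 2 then 0 else Var v) p = normal_part 0 (p :: (_, 'a::comm_ring_1) mpoly)"
proof -
  have "monom_eval (\<lambda>v. if fst v = 2 then 0 else Var v) m
      = (if normal_degree m = 0 then single m 1 else 0 :: (_, 'a) mpoly)" for m
  proof (cases "normal_degree m = 0")
    case True
    have "fst v \<noteq> 2" if "v \<in> keys m" for v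
    proof
      assume "fst v = 2"
      then have "lookup m v \<le> normal_degree m"
        unfolding normal_degree_def using that by (intro member_le_sum) auto
      then show False using True that by (simp add: in_keys_iff)
    qed
    then have "monom_eval (\<lambda>v. if fst v = 2 then 0 else Var v) m = (monom_eval Var m :: (_, 'a) mpoly)"
      unfolding monom_eval_def by (intro prod.cong) auto
    then show ?thesis using True by (simp add: monom_eval_Var)
  next
    case False
    then obtain v where v: "v \<in> keys m" "fst v = 2"
      unfolding normal_degree_def by (metis (mono_tags, lifting) mem_Collect_eq sum.neutral)
    then have "monom_eval (\<lambda>v. if fst v = 2 then 0 else Var v) m = (0 :: (_, 'a) mpoly)"
      unfolding monom_eval_def by (intro prod_zero bexI[of _ v]) (simp_all add: in_keys_iff power_0_left)
    then show ?thesis using False by simp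
  qed
  then have "subst_vars (\<lambda>v. if fst v = 2 then 0 else Var v) p
     = (\<Sum>m\<in>keys p. if normal_degree m = 0 then single m (lookup p m) else 0)"
    by (subst subst_vars_superset[of "keys p"]) (auto simp: mult_single intro!: sum.cong)
  also have "\<dots> = normal_part 0 p"
    unfolding normal_part_def by (rule sum.inter_filter[symmetric]) simp
  finally show ?thesis .
qed

lemma normal_part_0_eq_0: "normal_part 0 p = 0 \<longleftrightarrow> p \<in> order_ge 1"
proof -
  have "normal_part 0 p = 0 \<longleftrightarrow> (\<forall>m. normal_degree m = 0 \<longrightarrow> lookup p m = 0)"
    by (auto simp: poly_mapping_eq_iff fun_eq_iff lookup_normal_part)
  also have "\<dots> \<longleftrightarrow> p \<in> order_ge 1"
    unfolding order_ge_def mem_Collect_eq Ball_def in_keys_iff by (metis less_one not_less)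
  finally show ?thesis .
qed

text \<open>Setting the normal variables to zero turns \<open>normal_param\<close> into
  \<open>secant_param\<close> and leaves only the part of order zero.\<close>

lemma secant_kernel_iff_order:
  "f \<in> secant_kernel V r \<longleftrightarrow> vars f \<subseteq> V \<and> subst_vars (normal_param r) f \<in> order_ge 1"
proof -
  have "subst_vars (\<lambda>v. if fst v = 2 then 0 else Var v) (normal_param r v)
      = (secant_param r v :: (_, 'a::comm_ring_1) mpoly)" for v
  proof -
    have "subst_vars (\<lambda>v. if fst v = 2 then 0 else Var v) (secant_param r v)
        = subst_vars Var (secant_param r v :: (_, 'a) mpoly)"
    proof (rule subst_vars_cong)
      have "vars (secant_param r v :: (_, 'a) mpoly) \<subseteq> {v. fst v < 2}"
        unfolding secant_param_def
        by (intro vars_sum_sub vars_single_sub) (auto simp: param_monom_def keys_nat_add split: if_splits)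
      then show "(if fst w = 2 then 0 else Var w) = (Var w :: (_, 'a) mpoly)"
        if "w \<in> vars (secant_param r v :: (_, 'a) mpoly)" for w
        using that by auto
    qed
    then show ?thesis by (simp add: normal_param_def subst_vars_add subst_vars_self)
  qed
  then have "subst_vars (secant_param r) f = normal_part 0 (subst_vars (normal_param r) f)"
    by (simp add: subst_kill_normal[symmetric] subst_vars_comp)
  then show ?thesis
    by (simp add: secant_kernel_def normal_part_0_eq_0)
qed

text \<open>Elements of the kernel have order at least 1, so its \<open>s\<close>-th power has order
  at least \<open>s\<close>; the multiplier outside the kernel has order 0 and can be
  cancelled.\<close>

lemma symbolic_power_order:
  fixes f :: "(nat \<times> nat, 'a::idom) mpoly"
  assumes "f \<in> symbolic_power (mpoly_ring V) (secant_kernel V r) s"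
  shows "subst_vars (normal_param r) f \<in> order_ge s"
proof -
  let ?\<psi> = "subst_vars (normal_param r) :: (nat \<times> nat, 'a) mpoly \<Rightarrow> _"
  obtain u where u: "vars u \<subseteq> V" "u \<notin> secant_kernel V r" "u * f \<in> ideal_power V (secant_kernel V r) s"
    using assms symbolic_powerE[OF secant_kernel_prime] by blast
  have pow: "?\<psi> g \<in> order_ge s" if "g \<in> ideal_power V (secant_kernel V r) s" for g s
    using that
  proof (induction s arbitrary: g)
    case (Suc s)
    have "g \<in> ideal_prod (mpoly_ring V) (ideal_power V (secant_kernel V r) s) (secant_kernel V r)"
      using Suc.prems by simp
    then show ?case
    proof (induction g rule: ideal_prod.induct)
      case (prod i j)
      then have "?\<psi> i \<in> order_ge s" "?\<psi> j \<in> order_ge 1"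
        using Suc.IH by (simp_all add: secant_kernel_iff_order)
      from order_ge_mult[OF this] show ?case by (simp add: subst_vars_mult)
    next
      case (sum s1 s2)
      then show ?case by (simp add: subst_vars_add order_ge_add)
    qed
  qed simp
  have "?\<psi> u * ?\<psi> f \<in> order_ge s" using pow[OF u(3)] by (simp add: subst_vars_mult)
  moreover have "?\<psi> u \<notin> order_ge 1" using u by (simp add: secant_kernel_iff_order)
  ultimately show ?thesis by (rule order_ge_cancel[rotated])
qed

section \<open>Leading monomials of polynomials of high order\<close>

text \<open>The part of the diagonal condition that concerns the 2-minors of \<open>X_1\<close>:
  swaps never raise a monomial. The analysis of leading monomials takes nothing else from the
  diagonal condition.\<close>

definition swap_order :: "nat \<Rightarrow> nat \<Rightarrow> (nat \<times> nat) monomial rel \<Rightarrow> bool" where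
  "swap_order K N tord \<longleftrightarrow>
     (\<forall>n m. n < m \<and> m + K < N \<longrightarrow> (mon K {#n + K, m#}, mon K {#n, m + K#}) \<in> tord)"

section \<open>Sums, products and leading monomials under a term order\<close>

context
  fixes V :: "'v set" and tord :: "'v monomial rel"
  assumes tord: "term_order_on V tord"
begin

lemma tord_refl: "keys m \<subseteq> V \<Longrightarrow> (m, m) \<in> tord"
  using tord unfolding term_order_on_def Let_def linear_order_on_def partial_order_on_def preorder_on_def
  by (auto simp: refl_on_def)

lemma tord_trans: "(a, b) \<in> tord \<Longrightarrow> (b, c) \<in> tord \<Longrightarrow> (a, c) \<in> tord"
  using tord unfolding term_order_on_def Let_def linear_order_on_def partial_order_on_def preorder_on_def
  by (meson transD)

lemma tord_antisym: "(a, b) \<in> tord \<Longrightarrow> (b, a) \<in> tord \<Longrightarrow> a = b"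
  using tord unfolding term_order_on_def Let_def linear_order_on_def partial_order_on_def preorder_on_def
  by (meson antisymD)

lemma tord_add: "(a, b) \<in> tord \<Longrightarrow> keys a \<subseteq> V \<Longrightarrow> keys b \<subseteq> V \<Longrightarrow> keys c \<subseteq> V \<Longrightarrow> (a + c, b + c) \<in> tord"
  using tord unfolding term_order_on_def Let_def by blast

lemma tord_add2:
  assumes "(a, b) \<in> tord" "(c, e) \<in> tord" "keys a \<subseteq> V" "keys b \<subseteq> V" "keys c \<subseteq> V" "keys e \<subseteq> V"
  shows "(a + c, b + e) \<in> tord"
  using tord_trans[OF tord_add[OF assms(1,3,4,5)] tord_add[OF assms(2,5,6,4), unfolded add.commute[of _ b]]] .

lemma tord_sum:
  assumes "finite S" "\<And>p. p \<in> S \<Longrightarrow> keys (a p) \<subseteq> V" "\<And>p. p \<in> S \<Longrightarrow> keys (b p) \<subseteq> V"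
    "\<And>p. p \<in> S \<Longrightarrow> (a p, b p) \<in> tord"
  shows "(\<Sum>p\<in>S. a p, \<Sum>p\<in>S. b p) \<in> tord \<and> keys (\<Sum>p\<in>S. a p) \<subseteq> V \<and> keys (\<Sum>p\<in>S. b p) \<subseteq> V"
  using assms
proof (induction S)
  case empty
  then show ?case using tord_refl[of 0] by simp
next
  case (insert p S)
  then show ?case by (simp add: tord_add2 keys_nat_add)
qed

text \<open>Addition of monomials is cancellative and monotone, so a strict inequality in one
  summand would survive in the total.\<close>

lemma tord_sum_eq:
  assumes S: "finite S" and k: "\<And>p. p \<in> S \<Longrightarrow> keys (a p) \<subseteq> V" "\<And>p. p \<in> S \<Longrightarrow> keys (b p) \<subseteq> V"
    and le: "\<And>p. p \<in> S \<Longrightarrow> (a p, b p) \<in> tord" and ge: "(\<Sum>p\<in>S. b p, \<Sum>p\<in>S. a p) \<in> tord" and p: "p \<in> S"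
  shows "a p = b p"
proof -
  let ?A = "\<Sum>p\<in>S - {p}. a p" and ?B = "\<Sum>p\<in>S - {p}. b p"
  have rest: "(?A, ?B) \<in> tord \<and> keys ?A \<subseteq> V \<and> keys ?B \<subseteq> V"
    by (rule tord_sum) (use S k le in auto)
  have "(b p + ?B, a p + ?A) \<in> tord" using ge S p by (simp add: sum.remove)
  moreover have "(b p + ?A, b p + ?B) \<in> tord"
    using tord_add2[OF tord_refl[OF k(2)[OF p]] conjunct1[OF rest]] k(2)[OF p] rest by blast
  ultimately have "(b p + ?A, a p + ?A) \<in> tord" using tord_trans by blast
  moreover have "(a p + ?A, b p + ?A) \<in> tord" using tord_add le k p rest by blast
  ultimately have "a p + ?A = b p + ?A" using tord_antisym by blast
  then show ?thesis by simp
qed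

lemma ex_leading_monomial:
  assumes "p \<noteq> 0" "vars p \<subseteq> V"
  shows "\<exists>m. is_leading_monomial tord p m"
proof -
  have tot: "(a, b) \<in> tord \<or> (b, a) \<in> tord" if "keys a \<subseteq> V" "keys b \<subseteq> V" for a b
  proof (cases "a = b")
    case False
    then show ?thesis using that tord unfolding term_order_on_def Let_def linear_order_on_def total_on_def by blast
  qed (use tord_refl that in simp)
  have "\<exists>m\<in>S. \<forall>n\<in>S. (n, m) \<in> tord" if "finite S" "S \<noteq> {}" "\<And>m. m \<in> S \<Longrightarrow> keys m \<subseteq> V" for S
    using that
  proof (induction rule: finite_ne_induct)
    case (singleton x)
    then show ?case using tord_refl by simp
  next
    case (insert x S)
    then obtain m where m: "m \<in> S" "\<forall>n\<in>S. (n, m) \<in> tord" by auto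
    show ?case
    proof (cases "(x, m) \<in> tord")
      case False
      then have "(m, x) \<in> tord" using tot[of x m] insert.prems m by blast
      then have "\<forall>n\<in>insert x S. (n, x) \<in> tord" using m tord_trans tord_refl insert.prems by blast
      then show ?thesis by blast
    qed (use m in blast)
  qed
  from this[of "keys p"] assms show ?thesis
    unfolding is_leading_monomial_def using keys_sub_vars by (metis finite_keys keys_eq_empty)
qed

lemma leading_monomial_mult:
  fixes p q :: "('v, 'a::idom) mpoly"
  assumes p: "is_leading_monomial tord p m" "vars p \<subseteq> V" and q: "is_leading_monomial tord q n" "vars q \<subseteq> V"
  shows "is_leading_monomial tord (p * q) (m + n) \<and> lookup (p * q) (m + n) = lookup p m * lookup q n"
proof -
  have kp: "a \<in> keys p \<Longrightarrow> keys a \<subseteq> V" and kq: "b \<in> keys q \<Longrightarrow> keys b \<subseteq> V" for a b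
    using p(2) q(2) keys_sub_vars by blast+
  have mp: "m \<in> keys p" "\<And>a. a \<in> keys p \<Longrightarrow> (a, m) \<in> tord" using p(1) by (auto simp: is_leading_monomial_def)
  have nq: "n \<in> keys q" "\<And>b. b \<in> keys q \<Longrightarrow> (b, n) \<in> tord" using q(1) by (auto simp: is_leading_monomial_def)
  have le: "(a + b, m + n) \<in> tord" if "a \<in> keys p" "b \<in> keys q" for a b
    using that tord_add2 mp nq kp kq by simp
  have un: "a = m \<and> b = n" if "a \<in> keys p" "b \<in> keys q" "a + b = m + n" for a b
  proof -
    have "(m + b, m + n) \<in> tord"
      by (rule tord_add2[OF tord_refl[OF kp[OF mp(1)]] nq(2)[OF that(2)] kp[OF mp(1)] kp[OF mp(1)]
            kq[OF that(2)] kq[OF nq(1)]])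
    moreover have "(m + n, m + b) \<in> tord"
      using tord_add[OF mp(2)[OF that(1)] kp[OF that(1)] kp[OF mp(1)] kq[OF that(2)]] that(3) by simp
    ultimately have "m + b = m + n" by (rule tord_antisym)
    then show ?thesis using that(3) by simp
  qed
  have "lookup (p * q) (m + n) = (\<Sum>a\<in>keys p. \<Sum>b\<in>keys q. if a + b = m + n then lookup p a * lookup q b else 0)"
    by (subst sum_singles[of p], subst sum_singles[of q])
       (simp add: sum_product mult_single lookup_sum lookup_single when_def)
  also have "\<dots> = (\<Sum>a\<in>keys p. \<Sum>b\<in>keys q. if a = m \<and> b = n then lookup p a * lookup q b else 0)"
    by (intro sum.cong refl) (auto dest: un)
  also have "\<dots> = (\<Sum>a\<in>keys p. if a = m then (\<Sum>b\<in>keys q. if b = n then lookup p a * lookup q b else 0) else 0)"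
    by (intro sum.cong refl) auto
  also have "\<dots> = lookup p m * lookup q n"
    using mp(1) nq(1) by simp
  finally have l: "lookup (p * q) (m + n) = lookup p m * lookup q n" .
  then have "m + n \<in> keys (p * q)" using mp(1) nq(1) by (simp add: in_keys_iff)
  moreover have "(c, m + n) \<in> tord" if "c \<in> keys (p * q)" for c
    using Poly_Mapping.keys_mult[of p q] that le by auto
  ultimately show ?thesis using l by (simp add: is_leading_monomial_def)
qed

end

lemma swaps_decrease_order:
  assumes t: "term_order_on (scroll_vars d k) tord" and sw: "swap_order (Suc k) (Suc d * Suc k) tord"
    and "(swap (Suc k))\<^sup>*\<^sup>* M M'" "set_mset M \<subseteq> {..<Suc d * Suc k}"
  shows "(mon (Suc k) M', mon (Suc k) M) \<in> tord"
  using assms(3)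
proof (induction rule: rtranclp_induct)
  case base
  then show ?case using assms(4) by (intro tord_refl[OF t]) (simp only: keys_mon_scroll)
next
  case (step M1 M2)
  note bound = swaps_bound[OF step(1) assms(4)]
  from step(2) have "(mon (Suc k) M2, mon (Suc k) M1) \<in> tord"
  proof cases
    case (swap n m U)
    have nm: "n < Suc d * Suc k" "m + Suc k < Suc d * Suc k" and U: "set_mset U \<subseteq> {..<Suc d * Suc k}"
      using bound swap by auto
    have k: "keys (mon (Suc k) {#n + Suc k, m#}) \<subseteq> scroll_vars d k"
      "keys (mon (Suc k) {#n, m + Suc k#}) \<subseteq> scroll_vars d k" "keys (mon (Suc k) U) \<subseteq> scroll_vars d k"
      unfolding keys_mon_scroll using nm U swap by auto
    have "(mon (Suc k) {#n + Suc k, m#}, mon (Suc k) {#n, m + Suc k#}) \<in> tord"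
      using sw swap nm by (simp only: swap_order_def)
    from tord_add[OF t this k]
    show ?thesis by (simp add: swap mon_add_mset add.assoc)
  qed
  then show ?case using step(3) tord_trans[OF t] by blast
qed

text \<open>Swapping \<open>M\<close> into a window never raises it, and \<open>W\<close> is the
  only window monomial of its class.\<close>

lemma window_is_least:
  assumes t: "term_order_on (scroll_vars d k) tord" and sw: "swap_order (Suc k) (Suc d * Suc k) tord"
    and c: "toric_class (Suc k) M = toric_class (Suc k) W" and W: "in_window (Suc k) W"
    and M: "set_mset M \<subseteq> {..<Suc d * Suc k}"
  shows "(mon (Suc k) W, mon (Suc k) M) \<in> tord"
proof -
  obtain W' where W': "(swap (Suc k))\<^sup>*\<^sup>* M W'" "in_window (Suc k) W'"
    using swaps_to_window by blast
  have "W' = W"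
    by (rule window_unique) (use W W' c in \<open>simp_all add: swaps_class\<close>)
  then show ?thesis using swaps_decrease_order[OF t sw W'(1) M] by simp
qed

text \<open>Expanding the image of a monomial under \<open>normal_param\<close> amounts to labelling its positions; the
  label \<open>p < r\<close> selects the \<open>p\<close>-th parametrization and the label \<open>r\<close> the normal variable.\<close>

definition label_monom :: "nat \<Rightarrow> nat \<Rightarrow> nat \<times> nat \<Rightarrow> (nat \<times> nat \<times> nat) monomial" where
  "label_monom K r z = (if fst z < r then param_monom (fst z) (pos_var K (snd z)) else single (2, pos_var K (snd z)) 1)"

definition part :: "nat \<Rightarrow> (nat \<times> nat) multiset \<Rightarrow> nat multiset" where
  "part p Z = image_mset snd (filter_mset (\<lambda>z. fst z = p) Z)"

lemma part_simps [simp]: "part p {#} = {#}"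
  "part p (add_mset z Z) = (if fst z = p then add_mset (snd z) (part p Z) else part p Z)"
  by (simp_all add: part_def)

lemma count_part: "count (part p Z) n = count Z (p, n)"
  by (induction Z) (auto simp: prod_eq_iff)

lemma sum_parts:
  assumes "\<forall>z\<in>#Z. fst z \<le> r"
  shows "(\<Sum>p\<le>r. mon K (part p Z)) = mon K (image_mset snd Z)"
  using assms
proof (induction Z)
  case (add z Z)
  have "(\<Sum>p\<le>r. mon K (part p (add_mset z Z)))
      = (\<Sum>p\<le>r. (if p = fst z then single (pos_var K (snd z)) 1 else 0) + mon K (part p Z))"
    by (intro sum.cong) (auto simp: mon_add_mset)
  then show ?case using add by (simp add: sum.distrib mon_add_mset)
qed simp

lemma fst_snd_pos_var [simp]: "fst (pos_var K n) = n div K" "snd (pos_var K n) = n mod K"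
  by (simp_all add: pos_var_def)

lemma lookup_sum_label_monom:
  assumes "\<forall>z\<in>#Z. fst z \<le> r"
  shows "p < r \<Longrightarrow> lookup (\<Sum>z\<in>#Z. label_monom K r z) (0, p, 0) = fst (toric_class K (part p Z))"
    and "p < r \<Longrightarrow> lookup (\<Sum>z\<in>#Z. label_monom K r z) (1, p, j) = count (snd (toric_class K (part p Z))) j"
    and "lookup (\<Sum>z\<in>#Z. label_monom K r z) (2, pos_var K n) = count (part r Z) n"
    and "normal_degree (\<Sum>z\<in>#Z. label_monom K r z) = size (part r Z)"
  using assms
  by (induction Z)
     (auto simp: label_monom_def param_monom_def lookup_add lookup_single when_def toric_class_def
        normal_degree_add normal_degree_single)

text \<open>The copies use disjoint variables. From copy \<open>p\<close> the toric class of the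
  part labelled \<open>p\<close> can be read off; the normal variables show the part labelled
  \<open>r\<close> itself.\<close>

lemma labels_determined:
  assumes Z: "\<forall>z\<in>#Z. fst z \<le> r" and Z': "\<forall>z\<in>#Z'. fst z \<le> r"
    and eq: "(\<Sum>z\<in>#Z. label_monom K r z) = (\<Sum>z\<in>#Z'. label_monom K r z)"
  shows "p < r \<Longrightarrow> toric_class K (part p Z) = toric_class K (part p Z')" and "part r Z = part r Z'"
proof -
  show "part r Z = part r Z'"
    using lookup_sum_label_monom(3)[OF Z, of K] lookup_sum_label_monom(3)[OF Z', of K] eq
    by (simp add: multiset_eq_iff)
  show "toric_class K (part p Z) = toric_class K (part p Z')" if "p < r"
    using lookup_sum_label_monom(1,2)[OF Z that, of K] lookup_sum_label_monom(1,2)[OF Z' that, of K] eq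
    by (simp add: prod_eq_iff multiset_eq_iff)
qed

text \<open>Each part of \<open>Z'\<close> is the least monomial of its class or, for the label
  \<open>r\<close>, equal to that of \<open>Z\<close>. So \<open>Z\<close> is at least
  \<open>Z'\<close> part by part, while its total is at most that of \<open>Z'\<close>.\<close>

lemma windows_unique_labels:
  assumes t: "term_order_on (scroll_vars d k) tord" and sw: "swap_order (Suc k) (Suc d * Suc k) tord"
    and Z: "\<forall>z\<in>#Z. fst z \<le> r" and Z': "\<forall>z\<in>#Z'. fst z \<le> r"
    and eq: "(\<Sum>z\<in>#Z. label_monom (Suc k) r z) = (\<Sum>z\<in>#Z'. label_monom (Suc k) r z)"
    and win: "\<And>p. p < r \<Longrightarrow> in_window (Suc k) (part p Z')"
    and bZ: "snd ` set_mset Z \<subseteq> {..<Suc d * Suc k}" and bZ': "snd ` set_mset Z' \<subseteq> {..<Suc d * Suc k}"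
    and le: "(mon (Suc k) (image_mset snd Z), mon (Suc k) (image_mset snd Z')) \<in> tord"
  shows "Z = Z'"
proof -
  let ?K = "Suc k"
  have b: "set_mset (part p A) \<subseteq> snd ` set_mset A" for p and A :: "(nat \<times> nat) multiset"
    by (auto simp: part_def)
  have kp: "keys (mon ?K (part p Z')) \<subseteq> scroll_vars d k" "keys (mon ?K (part p Z)) \<subseteq> scroll_vars d k" for p
    unfolding keys_mon_scroll using b bZ bZ' by blast+
  have each: "(mon ?K (part p Z'), mon ?K (part p Z)) \<in> tord" if "p \<in> {..r}" for p
  proof (cases "p = r")
    case True
    then show ?thesis using labels_determined(2)[OF Z Z' eq] tord_refl[OF t] kp by simp
  next
    case False
    then have "p < r" using that by simp
    then show ?thesis
      using labels_determined(1)[OF Z Z' eq] win b bZ by (intro window_is_least[OF t sw]) blast+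
  qed
  have "part p Z' = part p Z" if "p \<in> {..r}" for p
  proof -
    have "mon ?K (part p Z') = mon ?K (part p Z)"
      by (rule tord_sum_eq[OF t _ _ _ each _ that]) (use le kp Z Z' in \<open>simp_all add: sum_parts\<close>)
    then show ?thesis by simp
  qed
  then have "count Z (p, n) = count Z' (p, n)" if "p \<le> r" for p n
    using that count_part by (metis atMost_iff)
  moreover have "count Z (p, n) = count Z' (p, n)" if "\<not> p \<le> r" for p n
  proof -
    have "(p, n) \<notin># Z" "(p, n) \<notin># Z'" using Z Z' that by auto
    then show ?thesis by (simp add: not_in_iff)
  qed
  ultimately have "count Z x = count Z' x" for x by (cases x) blast
  then show ?thesis by (rule multiset_eqI)
qed

lemma normal_param_labels:
  "normal_param r (pos_var K n) = (\<Sum>p\<le>r. single (label_monom K r (p, n)) 1 :: (_, 'a::comm_ring_1) mpoly)"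
proof -
  have "(\<Sum>p\<le>r. single (label_monom K r (p, n)) 1 :: (_, 'a) mpoly)
      = (\<Sum>p<r. single (label_monom K r (p, n)) 1) + single (label_monom K r (r, n)) 1"
    by (simp add: lessThan_Suc_atMost[symmetric])
  then show ?thesis by (simp add: normal_param_def secant_param_def label_monom_def Var_def)
qed

lemma image_mset_nth: "image_mset (\<lambda>i. f (ys ! i)) (mset_set {..<length ys}) = image_mset f (mset ys)"
proof -
  have "mset ys = image_mset ((!) ys) (mset [0..<length ys])"
    by (metis map_nth mset_map)
  then have "mset ys = image_mset ((!) ys) (mset_set {..<length ys})"
    by (simp only: mset_upt atLeast0LessThan)
  then have "image_mset f (mset ys) = image_mset f (image_mset ((!) ys) (mset_set {..<length ys}))"
    by (rule arg_cong)
  then show ?thesis by (simp add: image_mset.compositionality comp_def)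
qed

text \<open>Listing the positions as \<open>ys\<close> lets repeated positions carry different
  labels; distributing the product then gives one term for each labelling.\<close>

lemma monom_eval_normal_param:
  "monom_eval (normal_param r) (mon K (mset ys)) = (\<Sum>g\<in>PiE {..<length ys} (\<lambda>_. {..r}).
     single (\<Sum>i<length ys. label_monom K r (g i, ys ! i)) 1 :: (_, 'a::comm_ring_1) mpoly)"
proof -
  have "monom_eval (normal_param r) (mon K (mset ys)) = (\<Prod>i<length ys. normal_param r (pos_var K (ys ! i)))"
    unfolding monom_eval_mon prod_unfold_prod_mset
    by (rule arg_cong[of _ _ prod_mset]) (rule image_mset_nth[symmetric])
  also have "\<dots> = (\<Sum>g\<in>PiE {..<length ys} (\<lambda>_. {..r}). \<Prod>i<length ys.
      single (label_monom K r (g i, ys ! i)) 1)"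
    unfolding normal_param_labels by (rule prod_sum_PiE) auto
  also have "\<dots> = (\<Sum>g\<in>PiE {..<length ys} (\<lambda>_. {..r}). single (\<Sum>i<length ys. label_monom K r (g i, ys ! i)) 1)"
    by (simp add: prod_unfold_prod_mset prod_mset_single sum_unfold_sum_mset)
  finally show ?thesis .
qed

text \<open>Any other labelled monomial with the same image arises by replacing the part in some window by
  another monomial of the same toric class, hence is larger than the leading monomial.\<close>

lemma window_coefficient:
  fixes f :: "(nat \<times> nat, 'a::comm_ring_1) mpoly"
  assumes t: "term_order_on (scroll_vars d k) tord" and sw: "swap_order (Suc k) (Suc d * Suc k) tord"
    and f: "vars f \<subseteq> scroll_vars d k" and lm: "is_leading_monomial tord f (mon (Suc k) M)"
    and lab: "\<And>n. lab n \<le> r" and win: "\<And>p. p < r \<Longrightarrow> in_window (Suc k) (filter_mset (\<lambda>n. lab n = p) M)"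
  shows "lookup (subst_vars (normal_param r) f) (\<Sum>n\<in>#M. label_monom (Suc k) r (lab n, n))
    = lookup f (mon (Suc k) M)"
proof -
  let ?K = "Suc k" and ?N = "Suc d * Suc k"
  define Z' where "Z' = image_mset (\<lambda>n. (lab n, n)) M"
  define T where "T = (\<Sum>z\<in>#Z'. label_monom ?K r z)"
  have T: "(\<Sum>n\<in>#M. label_monom ?K r (lab n, n)) = T" by (simp add: T_def Z'_def image_mset.compositionality comp_def)
  have bound: "\<And>m. m \<in> keys f \<Longrightarrow> keys m \<subseteq> scroll_vars d k" using f keys_sub_vars by blast
  have Mf: "mon ?K M \<in> keys f" using lm by (simp add: is_leading_monomial_def)
  have bM: "set_mset M \<subseteq> {..<?N}" using bound[OF Mf] by (simp only: keys_mon_scroll)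
  have partZ': "part p Z' = filter_mset (\<lambda>n. lab n = p) M" for p
    unfolding Z'_def by (induction M) auto
  have Z'r: "\<forall>z\<in>#Z'. fst z \<le> r" using lab by (auto simp: Z'_def)
  have c: "lookup (monom_eval (normal_param r) m :: (_, 'a) mpoly) T = (if m = mon ?K M then 1 else 0)"
    if m: "m \<in> keys f" for m
  proof -
    obtain X where X: "m = mon ?K X" "set_mset X \<subseteq> {..<?N}" using ex_mon[OF bound[OF m]] .
    obtain ys where ys: "X = mset ys" by (metis ex_mset)
    let ?P = "PiE {..<length ys} (\<lambda>_. {..r})"
    define Z where "Z g = image_mset (\<lambda>i. (g i, ys ! i)) (mset_set {..<length ys})" for g :: "nat \<Rightarrow> nat"
    have sZ: "(\<Sum>i<length ys. label_monom ?K r (g i, ys ! i)) = (\<Sum>z\<in>#Z g. label_monom ?K r z)" for g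
      by (simp add: Z_def sum_unfold_sum_mset image_mset.compositionality comp_def)
    have sndZ: "image_mset snd (Z g) = X" for g
      using image_mset_nth[of "\<lambda>n. n" ys] by (simp add: Z_def ys image_mset.compositionality comp_def)
    have ZZ: "Z g = Z'" if g: "g \<in> ?P" and eq: "(\<Sum>z\<in>#Z g. label_monom ?K r z) = T" for g
    proof (rule windows_unique_labels[OF t sw _ Z'r])
      show "\<forall>z\<in>#Z g. fst z \<le> r" using g by (auto simp: Z_def PiE_def Pi_def)
      show "(\<Sum>z\<in>#Z g. label_monom ?K r z) = (\<Sum>z\<in>#Z'. label_monom ?K r z)" using eq by (simp add: T_def)
      show "in_window ?K (part p Z')" if "p < r" for p using win[OF that] by (simp add: partZ')
      have "snd ` set_mset (Z g) = set_mset X" using sndZ[of g] by (metis set_image_mset)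
      then show "snd ` set_mset (Z g) \<subseteq> {..<?N}" using X by simp
      show "snd ` set_mset Z' \<subseteq> {..<?N}" using bM by (auto simp: Z'_def)
      have "image_mset snd Z' = M" by (simp add: Z'_def image_mset.compositionality comp_def)
      then show "(mon ?K (image_mset snd (Z g)), mon ?K (image_mset snd Z')) \<in> tord"
        using lm m by (simp add: sndZ X is_leading_monomial_def)
    qed
    define g0 where "g0 = restrict (\<lambda>i. lab (ys ! i)) {..<length ys}"
    have g0P: "g0 \<in> ?P" using lab by (auto simp: g0_def)
    have "Z g0 = image_mset (\<lambda>n. (lab n, n)) X"
    proof -
      have "Z g0 = image_mset (\<lambda>i. (lab (ys ! i), ys ! i)) (mset_set {..<length ys})"
        unfolding Z_def by (rule image_mset_cong) (simp add: g0_def)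
      then show ?thesis using image_mset_nth[of "\<lambda>n. (lab n, n)" ys] by (simp add: ys)
    qed
    then have g0: "(\<Sum>z\<in>#Z g0. label_monom ?K r z) = T" if "X = M" using that by (simp add: T_def Z'_def)
    \<comment> \<open>Since \<open>lab\<close> depends on the position only, equal positions carry
      equal labels and \<open>Z'\<close> comes from a single \<open>g\<close>. Otherwise a
      multinomial coefficient would appear, which can vanish in positive characteristic.\<close>
    have only: "X = M \<and> g = g0" if "g \<in> ?P" "(\<Sum>z\<in>#Z g. label_monom ?K r z) = T" for g
    proof
      have e: "Z g = Z'" using ZZ[OF that] .
      then show "X = M" using sndZ[of g] by (simp add: Z'_def image_mset.compositionality comp_def)
      show "g = g0"
      proof (rule PiE_ext[OF that(1) g0P])
        fix i assume i: "i \<in> {..<length ys}"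
        then have "(g i, ys ! i) \<in># Z g" by (auto simp: Z_def)
        then show "g i = g0 i" using i unfolding e by (auto simp: Z'_def g0_def)
      qed
    qed
    have fin: "finite ?P" by (intro finite_PiE) auto
    have "lookup (monom_eval (normal_param r) m :: (_, 'a) mpoly) T
        = (\<Sum>g\<in>?P. if (\<Sum>z\<in>#Z g. label_monom ?K r z) = T then 1 else 0)"
      unfolding X ys monom_eval_normal_param lookup_sum sZ by (simp add: lookup_single when_def)
    also have "\<dots> = (\<Sum>g\<in>?P. if g = g0 then (if X = M then 1 else 0) else 0)"
    proof (rule sum.cong[OF refl])
      fix g assume "g \<in> ?P"
      from only[OF this] g0
      show "(if (\<Sum>z\<in>#Z g. label_monom ?K r z) = T then 1 else 0)
          = (if g = g0 then (if X = M then 1 else 0) else (0::'a))"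
        by (cases "(\<Sum>z\<in>#Z g. label_monom ?K r z) = T") auto
    qed
    also have "\<dots> = (if X = M then 1 else 0)" using fin g0P by simp
    finally show ?thesis by (simp add: X)
  qed
  have "lookup (subst_vars (normal_param r) f) T
      = (\<Sum>m\<in>keys f. lookup f m * lookup (monom_eval (normal_param r) m :: (_, 'a) mpoly) T)"
  proof -
    have "lookup (single 0 c * p) T = c * lookup p T" for c and p :: "(nat \<times> nat \<times> nat, 'a) mpoly"
      unfolding mult_map_scale_conv_mult[symmetric] by (simp add: Poly_Mapping.map.rep_eq when_def)
    then show ?thesis by (subst subst_vars_superset[of "keys f"]) (simp_all add: lookup_sum)
  qed
  also have "\<dots> = (\<Sum>m\<in>keys f. if m = mon ?K M then lookup f m else 0)"
    by (rule sum.cong[OF refl]) (simp add: c)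
  also have "\<dots> = lookup f (mon ?K M)" using Mf by simp
  finally show ?thesis unfolding T .
qed

text \<open>The windows cover at least the sum of all \<open>min (length c) r\<close>, and by the
  vanishing order at least \<open>s\<close> positions remain uncovered. Subtracting from the total
  number of positions shows that the chains have an excess of at least \<open>s\<close> over
  \<open>r\<close>, which is then trimmed to \<open>s\<close>.\<close>

lemma leading_chains:
  fixes f :: "(nat \<times> nat, 'a::comm_ring_1) mpoly"
  assumes t: "term_order_on (scroll_vars d k) tord" and sw: "swap_order (Suc k) (Suc d * Suc k) tord"
    and f: "vars f \<subseteq> scroll_vars d k" and lm: "is_leading_monomial tord f (mon (Suc k) M)"
    and ord: "subst_vars (normal_param r) f \<in> order_ge s"
  obtains Ds where "\<forall>c\<in>set Ds. chain (Suc (Suc k)) c \<and> r < length c" "mset (concat Ds) \<subseteq># M"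
    "(\<Sum>c\<leftarrow>Ds. length c - r) = s"
proof -
  let ?K = "Suc k"
  obtain xs where xs: "mset xs = M" by (metis ex_mset)
  obtain Cs w lab0 where Cs: "\<forall>c\<in>set Cs. chain (Suc ?K) c" "mset (concat Cs) = M"
    and wl: "window_label (Suc ?K) r w lab0"
    and cov: "(\<Sum>c\<leftarrow>Cs. min (length c) r) \<le> length (filter (\<lambda>n. lab0 n < r) xs)"
    using greene_kleitman[of "Suc ?K" xs r] xs by auto
  \<comment> \<open>All left-over labels are merged into \<open>r\<close>, the label of the normal
    variables.\<close>
  define lab where "lab n = min (lab0 n) r" for n
  define T where "T = (\<Sum>n\<in>#M. label_monom ?K r (lab n, n))"
  have "lookup (subst_vars (normal_param r) f) T = lookup f (mon ?K M)"
    unfolding T_def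
  proof (rule window_coefficient[OF t sw f lm])
    show "in_window ?K (filter_mset (\<lambda>n. lab n = p) M)" if p: "p < r" for p
      unfolding in_window_def
    proof (intro exI ballI)
      fix n assume "n \<in># filter_mset (\<lambda>n. lab n = p) M"
      then have "lab0 n = p" using p by (auto simp: lab_def min_def split: if_splits)
      then show "w p \<le> n \<and> n \<le> w p + ?K"
        using wl p by (auto simp: window_label_def less_Suc_eq_le)
    qed
  qed (simp add: lab_def)
  also have "\<dots> \<noteq> 0" using lm by (simp add: is_leading_monomial_def in_keys_iff)
  finally have "s \<le> normal_degree T" using ord by (simp add: order_ge_def in_keys_iff)
  also have "normal_degree T = size (filter_mset (\<lambda>n. lab n = r) M)"
  proof -
    let ?Z = "image_mset (\<lambda>n. (lab n, n)) M"
    have "T = (\<Sum>z\<in>#?Z. label_monom ?K r z)"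
      by (simp add: T_def image_mset.compositionality comp_def)
    moreover have "part r ?Z = filter_mset (\<lambda>n. lab n = r) M"
      by (induction M) simp_all
    moreover have "normal_degree (\<Sum>z\<in>#?Z. label_monom ?K r z) = size (part r ?Z)"
      by (rule lookup_sum_label_monom(4)) (simp add: lab_def)
    ultimately show ?thesis by argo
  qed
  finally have s: "s \<le> size (filter_mset (\<lambda>n. lab n = r) M)" .
  have split: "length xs = length (filter (\<lambda>n. lab0 n < r) xs) + size (filter_mset (\<lambda>n. lab n = r) M)"
  proof -
    have "lab n = r \<longleftrightarrow> \<not> lab0 n < r" for n by (simp add: lab_def min_def)
    then show ?thesis unfolding xs[symmetric] by (induction xs) simp_all
  qed
  have "length xs = (\<Sum>c\<leftarrow>Cs. length c)"
    using Cs(2) xs by (metis length_concat size_mset)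
  also have "\<dots> = (\<Sum>c\<leftarrow>Cs. min (length c) r) + (\<Sum>c\<leftarrow>Cs. length c - r)"
    by (simp add: sum_list_addf[symmetric] min_def) (intro arg_cong[of _ _ sum_list] map_cong, auto)
  finally have "s \<le> (\<Sum>c\<leftarrow>Cs. length c - r)" using s split cov by linarith
  from trim_chains[OF this Cs(1)] Cs(2) that show ?thesis by metis
qed

section \<open>A degree-lexicographic order\<close>

definition monom_degree :: "'v monomial \<Rightarrow> nat" where
  "monom_degree m = (\<Sum>v\<in>keys m. lookup m v)"

lemma monom_degree_add: "monom_degree (m + n) = monom_degree m + monom_degree n"
proof -
  let ?S = "keys m \<union> keys n"
  have sup: "monom_degree p = (\<Sum>v\<in>?S. lookup p v)" if "keys p \<subseteq> ?S" for p
    unfolding monom_degree_def by (rule sum.mono_neutral_left) (use that in \<open>auto simp: in_keys_iff\<close>)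
  have "monom_degree (m + n) = (\<Sum>v\<in>?S. lookup (m + n) v)"
    by (rule sup) (simp add: keys_nat_add)
  then show ?thesis by (simp add: lookup_add sum.distrib sup)
qed

lemma monom_degree_0 [simp]: "monom_degree 0 = 0"
  by (simp add: monom_degree_def)

lemma monom_degree_mon: "monom_degree (mon K M) = size M"
  by (induction M) (simp_all add: mon_add_mset monom_degree_add, simp add: monom_degree_def)

text \<open>With the degree first, only finitely many monomials lie below a given one. Ties are
  decided by the exponent of the smallest variable at which the monomials differ, which favours main
  diagonals.\<close>

definition deglex :: "nat \<Rightarrow> nat \<Rightarrow> (nat \<times> nat) monomial rel" where
  "deglex d k = {(m, n). keys m \<subseteq> scroll_vars d k \<and> keys n \<subseteq> scroll_vars d k \<and>
     (monom_degree m < monom_degree n \<or> monom_degree m = monom_degree n \<and> m \<le> n)}"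

lemma term_order_deglex: "term_order_on (scroll_vars d k) (deglex d k)"
  unfolding term_order_on_def Let_def
proof (intro conjI ballI impI)
  show "linear_order_on {m. keys m \<subseteq> scroll_vars d k} (deglex d k)"
    unfolding linear_order_on_def partial_order_on_def preorder_on_def
  proof (intro conjI)
    show "trans (deglex d k)"
    proof (rule transI)
      fix a b c assume "(a, b) \<in> deglex d k" "(b, c) \<in> deglex d k"
      then show "(a, c) \<in> deglex d k"
        unfolding deglex_def by (auto intro: order_trans less_trans)
    qed
    show "antisym (deglex d k)" by (rule antisymI) (auto simp: deglex_def)
    show "total_on {m. keys m \<subseteq> scroll_vars d k} (deglex d k)"
    proof (rule total_onI)
      fix a b :: "(nat \<times> nat) monomial"
      assume "a \<in> {m. keys m \<subseteq> scroll_vars d k}" "b \<in> {m. keys m \<subseteq> scroll_vars d k}"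
      then show "(a, b) \<in> deglex d k \<or> (b, a) \<in> deglex d k"
        using linear[of a b] less_linear[of "monom_degree a" "monom_degree b"]
        unfolding deglex_def mem_Collect_eq split_conv by metis
    qed
  qed (simp_all add: deglex_def refl_on_def subset_iff split_beta)
  fix m :: "(nat \<times> nat) monomial" assume m: "m \<in> {m. keys m \<subseteq> scroll_vars d k}"
  have "0 \<le> m" if "monom_degree m = 0"
  proof -
    have "m = 0"
    proof (rule poly_mapping_eqI)
      fix v
      have "lookup m v \<le> monom_degree m" if "v \<in> keys m"
        unfolding monom_degree_def using that by (intro member_le_sum) auto
      then show "lookup m v = lookup 0 v"
        using that by (cases "v \<in> keys m") (simp_all add: in_keys_iff)
    qed
    then show ?thesis by simp
  qed
  then show "(0, m) \<in> deglex d k" using m by (auto simp: deglex_def)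
next
  fix m n u :: "(nat \<times> nat) monomial"
  assume "u \<in> {m. keys m \<subseteq> scroll_vars d k}" "(m, n) \<in> deglex d k"
  then show "(m + u, n + u) \<in> deglex d k"
    by (auto simp: deglex_def monom_degree_add keys_nat_add add_right_mono)
qed

lemma pos_var_mono: "m \<le> n \<Longrightarrow> pos_var K m \<le> pos_var K n"
proof -
  assume mn: "m \<le> n"
  then have "m div K \<le> n div K" by (rule div_le_mono)
  moreover have "m mod K \<le> n mod K" if "m div K = n div K"
    using mn that by (metis add_le_cancel_left div_mult_mod_eq)
  ultimately show ?thesis by (auto simp: pos_var_def less_eq_prod_def le_less)
qed

text \<open>At every position below \<open>v\<close> the multiplicities agree, so \<open>v\<close>
  is the first difference.\<close>

lemma mon_less:
  assumes "\<forall>n\<in>#A. v < n" "\<forall>n\<in>#B. v < n"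
  shows "mon K (C + A) < mon K (C + add_mset v B)"
proof -
  have 0: "count A n = 0" "count B n = 0" if "n \<le> v" for n
    using assms that by (auto simp: not_in_iff[symmetric])
  have "lookup (mon K (C + A)) w = lookup (mon K (C + add_mset v B)) w" if w: "w < pos_var K v" for w
  proof (cases "\<exists>n. w = pos_var K n")
    case True
    then obtain n where n: "w = pos_var K n" by blast
    then have "n < v" using w pos_var_mono[of v n K] by (metis not_le)
    then show ?thesis unfolding n lookup_mon using 0[of n] by simp
  next
    case False
    then show ?thesis by (metis in_keys_iff keys_mon imageE)
  qed
  moreover have "lookup (mon K (C + A)) (pos_var K v) < lookup (mon K (C + add_mset v B)) (pos_var K v)"
    unfolding lookup_mon using 0[of v] by simp
  ultimately show ?thesis
    unfolding less_poly_mapping.rep_eq less_fun_def by blast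
qed

lemma swap_order_deglex: "swap_order (Suc k) (Suc d * Suc k) (deglex d k)"
  unfolding swap_order_def
proof (intro allI impI)
  fix n m assume nm: "n < m \<and> m + Suc k < Suc d * Suc k"
  have "mon (Suc k) {#n + Suc k, m#} < mon (Suc k) {#n, m + Suc k#}"
    using mon_less[of "{#n + Suc k, m#}" n "{#m + Suc k#}" "Suc k" "{#}"] nm by simp
  moreover have "set_mset {#n + Suc k, m#} \<subseteq> {..<Suc d * Suc k}" "set_mset {#n, m + Suc k#} \<subseteq> {..<Suc d * Suc k}"
    using nm by simp_all
  ultimately show "(mon (Suc k) {#n + Suc k, m#}, mon (Suc k) {#n, m + Suc k#}) \<in> deglex d k"
    unfolding deglex_def keys_mon_scroll[symmetric] by (simp add: monom_degree_mon)
qed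

section \<open>Leading terms of scroll minors\<close>

text \<open>The entries that the permutation picks in the Leibniz expansion; \<open>id\<close> gives
  the main diagonal.\<close>

definition minor_positions :: "nat \<Rightarrow> nat \<Rightarrow> (nat \<Rightarrow> nat) \<Rightarrow> (nat \<Rightarrow> nat) \<Rightarrow> nat multiset" where
  "minor_positions K t c \<pi> = image_mset (\<lambda>a. c (\<pi> a) + a * K) (mset_set {..<t})"

lemma size_minor_positions [simp]: "size (minor_positions K t c \<pi>) = t"
  by (simp add: minor_positions_def)

lemma scroll_minor_expansion:
  "scroll_minor K t c = (\<Sum>\<pi> | \<pi> permutes {..<t}. single (mon K (minor_positions K t c \<pi>)) (signof \<pi>) :: (_, 'a::comm_ring_1) mpoly)"
proof -
  have "scroll_minor K t c = (\<Sum>\<pi> | \<pi> permutes {..<t}. signof \<pi> * (\<Prod>a<t. Var (pos_var K (c (\<pi> a) + a * K))) :: (_, 'a) mpoly)"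
    unfolding scroll_minor_def
    by (subst det_def'[of _ t])
       (auto simp: atLeast0LessThan intro!: sum.cong arg_cong2[of _ _ _ _ "(*)"] prod.cong dest: permutes_in_image)
  also have "\<dots> = (\<Sum>\<pi> | \<pi> permutes {..<t}. single (mon K (minor_positions K t c \<pi>)) (signof \<pi>))"
  proof (rule sum.cong[OF refl])
    fix \<pi>
    have "(\<Prod>a<t. Var (pos_var K (c (\<pi> a) + a * K))) = (single (mon K (minor_positions K t c \<pi>)) 1 :: (_, 'a) mpoly)"
      by (simp add: Var_def prod_unfold_prod_mset prod_mset_single mon_def minor_positions_def
          image_mset.compositionality comp_def)
    then show "signof \<pi> * (\<Prod>a<t. Var (pos_var K (c (\<pi> a) + a * K)))
      = (single (mon K (minor_positions K t c \<pi>)) (signof \<pi>) :: (_, 'a) mpoly)"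
      by (cases "evenperm \<pi>") (simp_all add: sign_def single_uminus)
  qed
  finally show ?thesis .
qed

lemma keys_sum_single: "keys (\<Sum>x\<in>A. single (g x) (e x)) \<subseteq> g ` A"
proof
  fix m assume "m \<in> keys (\<Sum>x\<in>A. single (g x) (e x))"
  then have "(\<Sum>x\<in>A. lookup (single (g x) (e x)) m) \<noteq> 0" by (simp add: in_keys_iff lookup_sum)
  then obtain x where "x \<in> A" "lookup (single (g x) (e x)) m \<noteq> 0"
    using sum.neutral[of A "\<lambda>x. lookup (single (g x) (e x)) m"] by blast
  then show "m \<in> g ` A" by (auto simp: lookup_single when_def split: if_splits)
qed

lemma keys_scroll_minor:
  "keys (scroll_minor K t c :: (_, 'a::comm_ring_1) mpoly) \<subseteq> (\<lambda>\<pi>. mon K (minor_positions K t c \<pi>)) ` {\<pi>. \<pi> permutes {..<t}}"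
  unfolding scroll_minor_expansion by (rule keys_sum_single)

text \<open>Let \<open>a\<close> be the first row that the permutation moves. The rows before it
  agree; from row \<open>a\<close> on, the diagonal entry of row \<open>a\<close> has a smaller
  position than every other entry of either choice, so it is the first difference.\<close>

lemma minor_positions_less:
  assumes c: "strict_mono_on {..<t} c" and K: "K > 0" and \<pi>: "\<pi> permutes {..<t}" "\<pi> \<noteq> id"
  shows "mon K (minor_positions K t c \<pi>) < mon K (minor_positions K t c id)"
proof -
  have "\<exists>a. \<pi> a \<noteq> a" using \<pi>(2) by (auto simp: fun_eq_iff)
  define a where "a = (LEAST a. \<pi> a \<noteq> a)"
  have a: "\<pi> a \<noteq> a" "\<And>b. b < a \<Longrightarrow> \<pi> b = b"
    unfolding a_def using LeastI_ex[OF \<open>\<exists>a. \<pi> a \<noteq> a\<close>] not_less_Least by blast+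
  then have at: "a < t" using \<pi>(1) permutes_not_in[OF \<pi>(1), of a] by auto
  have inj: "inj \<pi>" using \<pi>(1) by (rule permutes_inj)
  \<comment> \<open>The columns before \<open>a\<close> are already taken by the fixed rows.\<close>
  have ge: "a \<le> \<pi> b" if "a \<le> b" for b
  proof (rule ccontr)
    assume "\<not> a \<le> \<pi> b"
    then have "\<pi> (\<pi> b) = \<pi> b" using a(2) by simp
    then show False using injD[OF inj, of "\<pi> b" b] that \<open>\<not> a \<le> \<pi> b\<close> by simp
  qed
  have lt: "\<pi> b < t" if "b < t" for b using permutes_in_image[OF \<pi>(1)] that by simp
  have split: "minor_positions K t c \<tau> = image_mset (\<lambda>b. c (\<tau> b) + b * K) (mset_set {..<a})
      + image_mset (\<lambda>b. c (\<tau> b) + b * K) (mset_set {a..<t})" for \<tau>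
  proof -
    have "{..<t} = {..<a} \<union> {a..<t}" using at by auto
    moreover have "mset_set ({..<a} \<union> {a..<t}) = mset_set {..<a} + mset_set {a..<t}"
      by (rule mset_set_Union) auto
    ultimately show ?thesis by (simp add: minor_positions_def)
  qed
  have split': "image_mset (\<lambda>b. c b + b * K) (mset_set {a..<t})
      = add_mset (c a + a * K) (image_mset (\<lambda>b. c b + b * K) (mset_set {Suc a..<t}))"
  proof -
    have "{a..<t} = insert a {Suc a..<t}" using at by auto
    then show ?thesis by simp
  qed
  have le: "c x \<le> c y" if "x \<le> y" "y < t" for x y
    using strict_mono_on_leD[OF c] that by simp
  have "mon K (minor_positions K t c \<pi>) = mon K (image_mset (\<lambda>b. c b + b * K) (mset_set {..<a})
      + image_mset (\<lambda>b. c (\<pi> b) + b * K) (mset_set {a..<t}))"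
    unfolding split by (intro arg_cong[of _ _ "mon K"] arg_cong2[of _ _ _ _ "(+)"] image_mset_cong refl)
      (simp add: a(2))
  also have "\<dots> < mon K (image_mset (\<lambda>b. c b + b * K) (mset_set {..<a})
      + add_mset (c a + a * K) (image_mset (\<lambda>b. c b + b * K) (mset_set {Suc a..<t})))"
  proof (rule mon_less)
    show "\<forall>n\<in>#image_mset (\<lambda>b. c (\<pi> b) + b * K) (mset_set {a..<t}). c a + a * K < n"
    proof
      fix n assume "n \<in># image_mset (\<lambda>b. c (\<pi> b) + b * K) (mset_set {a..<t})"
      then obtain b where b: "a \<le> b" "b < t" "n = c (\<pi> b) + b * K" by auto
      show "c a + a * K < n"
      proof (cases "a = b")
        case True
        then have "a < \<pi> b" using ge[of b] a(1) b by (simp add: le_less)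
        then have "c a < c (\<pi> b)" using strict_mono_onD[OF c] at lt b by simp
        then show ?thesis using b True by simp
      next
        case False
        then have 1: "a * K < b * K" using b K by simp
        have "c a \<le> c (\<pi> b)" using le ge lt b by simp
        from add_le_less_mono[OF this 1] show ?thesis using b(3) by simp
      qed
    qed
    show "\<forall>n\<in>#image_mset (\<lambda>b. c b + b * K) (mset_set {Suc a..<t}). c a + a * K < n"
    proof
      fix n assume "n \<in># image_mset (\<lambda>b. c b + b * K) (mset_set {Suc a..<t})"
      then obtain b where b: "Suc a \<le> b" "b < t" "n = c b + b * K" by auto
      have 1: "a * K < b * K" using b K by simp
      have "c a \<le> c b" using le b by simp
      from add_le_less_mono[OF this 1] show "c a + a * K < n" using b(3) by simp
    qed
  qed
  also have "\<dots> = mon K (minor_positions K t c id)" unfolding split split' [symmetric] by simp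
  finally show ?thesis .
qed

lemma lookup_scroll_minor_diag:
  assumes "strict_mono_on {..<t} c" "K > 0"
  shows "lookup (scroll_minor K t c :: (_, 'a::comm_ring_1) mpoly) (mon K (minor_positions K t c id)) = 1"
proof -
  have fin: "finite {\<pi>. \<pi> permutes {..<t}}" by (simp add: finite_permutations)
  have "lookup (scroll_minor K t c :: (_, 'a) mpoly) (mon K (minor_positions K t c id))
    = (\<Sum>\<pi> | \<pi> permutes {..<t}. if \<pi> = id then 1 else 0)"
    unfolding scroll_minor_expansion lookup_sum
  proof (rule sum.cong[OF refl])
    fix \<pi> assume "\<pi> \<in> {\<pi>. \<pi> permutes {..<t}}"
    then have "mon K (minor_positions K t c \<pi>) \<noteq> mon K (minor_positions K t c id)" if "\<pi> \<noteq> id"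
      using minor_positions_less[OF assms] that by (metis less_irrefl mem_Collect_eq)
    then show "lookup (single (mon K (minor_positions K t c \<pi>)) (signof \<pi>)) (mon K (minor_positions K t c id))
      = (if \<pi> = id then 1 else (0::'a))"
      by (auto simp: lookup_single when_def sign_id)
  qed
  also have "\<dots> = 1" using fin by (simp add: permutes_id)
  finally show ?thesis .
qed

lemma minor_positions_bound:
  assumes "\<And>b. b < t \<Longrightarrow> c b + (t - 1) * K < N" "\<pi> permutes {..<t}"
  shows "set_mset (minor_positions K t c \<pi>) \<subseteq> {..<N}"
proof
  fix n assume "n \<in># minor_positions K t c \<pi>"
  then obtain a where a: "a < t" "n = c (\<pi> a) + a * K" by (auto simp: minor_positions_def)
  have "\<pi> a < t" using a permutes_in_image[OF assms(2)] by simp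
  from assms(1)[OF this] have "c (\<pi> a) + (t - 1) * K < N" .
  moreover have "a * K \<le> (t - 1) * K" using a by (intro mult_le_mono1) simp
  ultimately show "n \<in> {..<N}" unfolding a(2) lessThan_iff by linarith
qed

lemma vars_scroll_minor:
  assumes "\<And>b. b < t \<Longrightarrow> c b + (t - 1) * Suc k < Suc d * Suc k"
  shows "vars (scroll_minor (Suc k) t c :: (_, 'a::comm_ring_1) mpoly) \<subseteq> scroll_vars d k"
proof -
  have "keys m \<subseteq> scroll_vars d k" if m: "m \<in> keys (scroll_minor (Suc k) t c :: (_, 'a) mpoly)" for m
  proof -
    obtain \<pi> where \<pi>: "\<pi> permutes {..<t}" "m = mon (Suc k) (minor_positions (Suc k) t c \<pi>)"
      using keys_scroll_minor m by blast
    show ?thesis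
      unfolding \<pi>(2) keys_mon_scroll by (rule minor_positions_bound) (use assms \<pi>(1) in auto)
  qed
  then show ?thesis by (auto simp: vars_def)
qed

lemma leading_scroll_minor:
  assumes c: "strict_mono_on {..<t} c" and b: "\<And>b. b < t \<Longrightarrow> c b + (t - 1) * Suc k < Suc d * Suc k"
  shows "is_leading_monomial (deglex d k) (scroll_minor (Suc k) t c :: (_, 'a::comm_ring_1) mpoly)
    (mon (Suc k) (minor_positions (Suc k) t c id))"
  unfolding is_leading_monomial_def
proof (intro conjI ballI)
  show "mon (Suc k) (minor_positions (Suc k) t c id) \<in> keys (scroll_minor (Suc k) t c :: (_, 'a) mpoly)"
    using lookup_scroll_minor_diag[OF c, of "Suc k", where 'a = 'a] by (simp add: in_keys_iff)
  fix m assume "m \<in> keys (scroll_minor (Suc k) t c :: (_, 'a) mpoly)"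
  then obtain \<pi> where \<pi>: "\<pi> permutes {..<t}" "m = mon (Suc k) (minor_positions (Suc k) t c \<pi>)"
    using keys_scroll_minor by blast
  have "m \<le> mon (Suc k) (minor_positions (Suc k) t c id)"
    using minor_positions_less[OF c _ \<pi>(1), of "Suc k"] \<pi>(2) by (cases "\<pi> = id") auto
  then show "(m, mon (Suc k) (minor_positions (Suc k) t c id)) \<in> deglex d k"
    using minor_positions_bound[of t c "Suc k" "Suc d * Suc k", OF b \<pi>(1)]
      minor_positions_bound[of t c "Suc k" "Suc d * Suc k", OF b permutes_id]
    by (simp add: deglex_def \<pi>(2) monom_degree_mon keys_mon_scroll del: mult_Suc mult_Suc_right)
qed

lemma scroll_minor_degree:
  assumes "m \<in> keys (scroll_minor K t c :: (_, 'a::comm_ring_1) mpoly)"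
  shows "monom_degree m = t"
  using assms keys_scroll_minor by (fastforce simp: monom_degree_mon)

section \<open>Block elimination\<close>

text \<open>Elimination without division: the block matrix built from the adjugate clears the lower
  left block, at the price of powers of \<open>det D\<close> on both sides.\<close>

lemma det_schur:
  fixes D :: "'a::idom mat"
  assumes D: "D \<in> carrier_mat r r" and B: "B \<in> carrier_mat r q" and C: "C \<in> carrier_mat q r" and E: "E \<in> carrier_mat q q"
  shows "det D ^ (r + q) * det (four_block_mat D B C E)
    = det D ^ (r + 1) * det (det D \<cdot>\<^sub>m E - C * (adj_mat D * B))"
proof -
  let ?\<Delta> = "det D" and ?A = "adj_mat D"
  let ?S = "?\<Delta> \<cdot>\<^sub>m E - C * (?A * B)"
  note A = adj_mat[OF D]
  let ?F = "four_block_mat ?A (0\<^sub>m r q) (- (C * ?A)) (?\<Delta> \<cdot>\<^sub>m 1\<^sub>m q)"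
  have c: "- (C * ?A) \<in> carrier_mat q r" "?\<Delta> \<cdot>\<^sub>m 1\<^sub>m q \<in> carrier_mat q q" "C * ?A \<in> carrier_mat q r"
    using A C by auto
  have S: "?S \<in> carrier_mat q q" using A B C E by auto
  have low: "- (C * ?A) * D + ?\<Delta> \<cdot>\<^sub>m 1\<^sub>m q * C = 0\<^sub>m q r"
  proof -
    have "- (C * ?A) * D = - (C * (?A * D))"
      using c A C D by (subst uminus_mult_left_mat) auto
    also have "\<dots> = - (?\<Delta> \<cdot>\<^sub>m C)" using C by (simp add: A mult_smult_distrib[of C q r _ r])
    moreover have "?\<Delta> \<cdot>\<^sub>m 1\<^sub>m q * C = ?\<Delta> \<cdot>\<^sub>m C" using C by (simp add: mult_smult_assoc_mat[of _ q q _ r])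
    ultimately show ?thesis using C by (intro eq_matI) auto
  qed
  have right: "- (C * ?A) * B + ?\<Delta> \<cdot>\<^sub>m 1\<^sub>m q * E = ?S"
  proof -
    have "- (C * ?A) * B = - (C * (?A * B))"
      using c A C B by (subst uminus_mult_left_mat) auto
    moreover have "?\<Delta> \<cdot>\<^sub>m 1\<^sub>m q * E = ?\<Delta> \<cdot>\<^sub>m E" using E by (simp add: mult_smult_assoc_mat[of _ q q _ q])
    ultimately show ?thesis using A B C E by (intro eq_matI) auto
  qed
  have "?F * four_block_mat D B C E = four_block_mat (?\<Delta> \<cdot>\<^sub>m 1\<^sub>m r) (?A * B) (0\<^sub>m q r) ?S"
  proof -
    have "?A * D + 0\<^sub>m r q * C = ?\<Delta> \<cdot>\<^sub>m 1\<^sub>m r" "?A * B + 0\<^sub>m r q * E = ?A * B"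
      using A B C E by (auto simp: left_mult_zero_mat)
    then show ?thesis
      unfolding mult_four_block_mat[OF A(1) zero_carrier_mat c(1,2) D B C E] low right by simp
  qed
  moreover have "det (four_block_mat (?\<Delta> \<cdot>\<^sub>m 1\<^sub>m r) (?A * B) (0\<^sub>m q r) ?S) = ?\<Delta> ^ r * det ?S"
    by (subst det_four_block_mat_lower_left_zero[where n = r and m = q]) (use A B S in auto)
  moreover have "det ?F = det ?A * ?\<Delta> ^ q"
    by (subst det_four_block_mat_upper_right_zero[where n = r and m = q]) (use A c in auto)
  moreover have "det (?F * four_block_mat D B C E) = det ?F * det (four_block_mat D B C E)"
    by (rule det_mult[of _ "r + q"]) (use A c D E in auto)
  ultimately have *: "det ?A * ?\<Delta> ^ q * det (four_block_mat D B C E) = ?\<Delta> ^ r * det ?S" by simp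
  \<comment> \<open>One additional factor \<open>det D\<close> replaces
    \<open>det (adj_mat D)\<close> by a power of \<open>det D\<close>, without cancelling and
    without an exponent \<open>r - 1\<close>.\<close>
  have "det (?A * D) = det ?A * ?\<Delta>" by (rule det_mult[OF A(1) D])
  then have "?\<Delta> ^ r = det ?A * ?\<Delta>" unfolding A(3) by simp
  then have "?\<Delta> ^ (r + q) * det (four_block_mat D B C E) = ?\<Delta> * (det ?A * ?\<Delta> ^ q * det (four_block_mat D B C E))"
    by (simp add: power_add ac_simps)
  then show ?thesis unfolding * by (simp add: ac_simps)
qed

text \<open>The blocks come from the product of a tall and a wide matrix with inner dimension
  \<open>r\<close>. A one-sided inverse of \<open>P1\<close> up to \<open>\<delta>\<close> is
  two-sided, so the inner factors collapse: the Schur complement of a matrix of rank at most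
  \<open>r\<close> is zero.\<close>

lemma schur_complement_rank:
  fixes P1 :: "'a::idom mat"
  assumes P1: "P1 \<in> carrier_mat r r" and Q1: "Q1 \<in> carrier_mat r r" and P2: "P2 \<in> carrier_mat q r"
    and Q2: "Q2 \<in> carrier_mat r q" and A: "A \<in> carrier_mat r r"
    and inv: "P1 * Q1 * A = \<delta> \<cdot>\<^sub>m 1\<^sub>m r" and \<delta>: "\<delta> \<noteq> 0"
  shows "P2 * Q1 * (A * (P1 * Q2)) = \<delta> \<cdot>\<^sub>m (P2 * Q2)"
proof -
  define Y where "Y = Q1 * A"
  have Y: "Y \<in> carrier_mat r r" using Q1 A by (simp add: Y_def)
  have PY: "P1 * Y = \<delta> \<cdot>\<^sub>m 1\<^sub>m r" using inv P1 Q1 A by (simp add: Y_def)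
  have "det P1 * det Y = \<delta> ^ r" using det_mult[OF P1 Y] by (simp add: PY)
  then have d: "det P1 \<noteq> 0" using \<delta> by (metis mult_zero_left power_not_zero)
  have YP: "Y * P1 \<in> carrier_mat r r" using Y P1 by simp
  \<comment> \<open>The left factor \<open>P1\<close> is made removable by its adjugate; the
    entrywise equation below then cancels \<open>det P1\<close>.\<close>
  have "det P1 \<cdot>\<^sub>m (Y * P1) = (adj_mat P1 * P1) * (Y * P1)"
    using adj_mat(3)[OF P1] YP by (simp add: mult_smult_assoc_mat[of _ r r _ r] left_mult_one_mat[OF YP])
  also have "\<dots> = adj_mat P1 * ((P1 * Y) * P1)"
    unfolding assoc_mult_mat[OF P1 Y P1] by (rule assoc_mult_mat[OF adj_mat(1)[OF P1] P1 YP])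
  also have "\<dots> = \<delta> \<cdot>\<^sub>m (adj_mat P1 * P1)"
    unfolding PY using adj_mat(1)[OF P1] P1
    by (simp add: mult_smult_assoc_mat[of _ r r _ r] mult_smult_distrib[of _ r r _ r])
  also have "\<dots> = \<delta> \<cdot>\<^sub>m (det P1 \<cdot>\<^sub>m 1\<^sub>m r)" using adj_mat(3)[OF P1] by simp
  finally have e: "det P1 \<cdot>\<^sub>m (Y * P1) = \<delta> \<cdot>\<^sub>m (det P1 \<cdot>\<^sub>m 1\<^sub>m r)" .
  have "Y * P1 = \<delta> \<cdot>\<^sub>m 1\<^sub>m r"
  proof (rule eq_matI)
    fix i j assume ij: "i < dim_row (\<delta> \<cdot>\<^sub>m 1\<^sub>m r)" "j < dim_col (\<delta> \<cdot>\<^sub>m 1\<^sub>m r)"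
    have "det P1 * (Y * P1) $$ (i, j) = det P1 * (\<delta> \<cdot>\<^sub>m 1\<^sub>m r) $$ (i, j)"
      using arg_cong[OF e, of "\<lambda>M. M $$ (i, j)"] ij carrier_matD[OF Y] carrier_matD[OF P1]
      by (simp add: ac_simps)
    then show "(Y * P1) $$ (i, j) = (\<delta> \<cdot>\<^sub>m 1\<^sub>m r) $$ (i, j)" using d by simp
  qed (use YP in auto)
  then have "P2 * ((Y * P1) * Q2) = \<delta> \<cdot>\<^sub>m (P2 * Q2)"
    using P2 Q2 by (simp add: mult_smult_assoc_mat[of _ r r _ q] mult_smult_distrib[of _ q r _ q])
  moreover have "P2 * Q1 * (A * (P1 * Q2)) = P2 * ((Y * P1) * Q2)"
  proof -
    have PQ: "P1 * Q2 \<in> carrier_mat r q" and QA: "Q1 * A \<in> carrier_mat r r"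
      using P1 Q2 Q1 A by auto
    have "P2 * Q1 * (A * (P1 * Q2)) = P2 * (Q1 * (A * (P1 * Q2)))"
      by (rule assoc_mult_mat[OF P2 Q1]) (use A PQ in auto)
    also have "Q1 * (A * (P1 * Q2)) = Y * P1 * Q2"
      unfolding Y_def assoc_mult_mat[OF QA P1 Q2] assoc_mult_mat[OF Q1 A PQ] ..
    finally show ?thesis .
  qed
  ultimately show ?thesis by simp
qed

section \<open>Scroll minors in symbolic powers\<close>

lemma vars_signof_mult: "vars (signof \<pi> * p :: ('v, 'a::comm_ring_1) mpoly) = vars p"
  by (cases "evenperm \<pi>") (simp_all add: sign_def)

lemma vars_det:
  assumes "A \<in> carrier_mat n n" "\<And>i j. i < n \<Longrightarrow> j < n \<Longrightarrow> vars (A $$ (i, j)) \<subseteq> V"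
  shows "vars (det A :: ('v, 'a::comm_ring_1) mpoly) \<subseteq> V"
  unfolding det_def'[OF assms(1)]
proof (rule vars_sum_sub)
  fix \<pi> assume \<pi>: "\<pi> \<in> {\<pi>. \<pi> permutes {0..<n}}"
  show "vars (signof \<pi> * (\<Prod>i = 0..<n. A $$ (i, \<pi> i))) \<subseteq> V"
    unfolding vars_signof_mult
  proof (rule vars_prod_sub)
    fix i assume i: "i \<in> {0..<n}"
    then have "\<pi> i < n" using permutes_in_image[of \<pi> "{0..<n}" i] \<pi> by simp
    then show "vars (A $$ (i, \<pi> i)) \<subseteq> V" using i assms(2) by simp
  qed
qed

lemma vars_adj_mat:
  fixes A :: "('v, 'a::comm_ring_1) mpoly mat"
  assumes A: "A \<in> carrier_mat n n" and V: "\<And>i j. i < n \<Longrightarrow> j < n \<Longrightarrow> vars (A $$ (i, j)) \<subseteq> V"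
    and ij: "i < n" "j < n"
  shows "vars (adj_mat A $$ (i, j)) \<subseteq> V"
proof -
  have "vars (det (mat_delete A j i)) \<subseteq> V"
  proof (rule vars_det)
    show "mat_delete A j i \<in> carrier_mat (n - 1) (n - 1)" using A by (rule mat_delete_carrier)
    fix i' j' assume "i' < n - 1" "j' < n - 1"
    then show "vars (mat_delete A j i $$ (i', j')) \<subseteq> V"
      using A V by (auto simp: mat_delete_def)
  qed
  then have "vars (cofactor A j i) \<subseteq> V"
    unfolding cofactor_def by (intro vars_mult_sub vars_power_sub) auto
  then show ?thesis using A ij by (simp add: adj_mat_def)
qed

lemma vars_mat_mult:
  fixes A B :: "('v, 'a::comm_ring_1) mpoly mat"
  assumes "A \<in> carrier_mat l n" "B \<in> carrier_mat n m"
    and "\<And>i j. i < l \<Longrightarrow> j < n \<Longrightarrow> vars (A $$ (i, j)) \<subseteq> V" "\<And>i j. i < n \<Longrightarrow> j < m \<Longrightarrow> vars (B $$ (i, j)) \<subseteq> V"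
    and "i < l" "j < m"
  shows "vars ((A * B) $$ (i, j)) \<subseteq> V"
proof -
  have "(A * B) $$ (i, j) = (\<Sum>x = 0..<n. A $$ (i, x) * B $$ (x, j))"
    using assms by (simp add: scalar_prod_def)
  then show ?thesis
    by (simp only:) (intro vars_sum_sub vars_mult_sub, use assms in simp_all)
qed

text \<open>Every term of the Leibniz expansion is, up to sign, a product of \<open>n\<close>
  elements of \<open>P\<close>.\<close>

lemma det_in_ideal_power:
  fixes A :: "('v, 'a::comm_ring_1) mpoly mat"
  assumes P: "ideal P (mpoly_ring V)" and A: "A \<in> carrier_mat n n"
    and AP: "\<And>i j. i < n \<Longrightarrow> j < n \<Longrightarrow> A $$ (i, j) \<in> P"
  shows "det A \<in> ideal_power V P n"
  unfolding det_def'[OF A]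
proof (rule mpoly_ideal_sum[OF ideal_power_ideal[OF P]])
  fix \<pi> assume \<pi>: "\<pi> \<in> {\<pi>. \<pi> permutes {0..<n}}"
  have "(\<Prod>i = 0..<n. A $$ (i, \<pi> i)) \<in> ideal_power V P (card {0..<n})"
  proof (rule ideal_power_prod[OF P])
    fix i assume i: "i \<in> {0..<n}"
    then have "\<pi> i < n" using permutes_in_image[of \<pi> "{0..<n}" i] \<pi> by simp
    then show "A $$ (i, \<pi> i) \<in> P" using i AP by simp
  qed simp
  then show "signof \<pi> * (\<Prod>i = 0..<n. A $$ (i, \<pi> i)) \<in> ideal_power V P n"
    using mpoly_ideal_uminus[OF ideal_power_ideal[OF P]]
    by (cases "evenperm \<pi>") (simp_all add: sign_def)
qed

text \<open>A member of the kernel has order at least 1, so its leading monomial contains a chain of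
  more than \<open>r\<close> positions; a minor of size \<open>r\<close> has only degree
  \<open>r\<close>.\<close>

lemma small_minor_not_in_kernel:
  assumes c: "strict_mono_on {..<r} c" and b: "\<And>b. b < r \<Longrightarrow> c b + (r - 1) * Suc k < Suc d * Suc k"
  shows "(scroll_minor (Suc k) r c :: (_, 'a::idom) mpoly) \<notin> secant_kernel (scroll_vars d k) r"
proof
  let ?f = "scroll_minor (Suc k) r c :: (_, 'a) mpoly"
  assume "?f \<in> secant_kernel (scroll_vars d k) r"
  then have f: "vars ?f \<subseteq> scroll_vars d k" "subst_vars (normal_param r) ?f \<in> order_ge 1"
    by (simp_all add: secant_kernel_iff_order)
  obtain Ds where Ds: "\<forall>e\<in>set Ds. chain (Suc (Suc k)) e \<and> r < length e"
    "mset (concat Ds) \<subseteq># minor_positions (Suc k) r c id" "(\<Sum>e\<leftarrow>Ds. length e - r) = 1"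
    using leading_chains[OF term_order_deglex swap_order_deglex f(1) leading_scroll_minor[OF c b] f(2)] .
  then obtain e Ds' where e: "Ds = e # Ds'" by (cases Ds) auto
  have "length e \<le> size (mset (concat Ds))" by (simp add: e)
  also have "\<dots> \<le> r" using size_mset_mono[OF Ds(2)] by simp
  finally show False using Ds(1) e by auto
qed

text \<open>The power of the upper left \<open>r\<close>-minor by which block elimination multiplies the given minor is
  not in the prime ideal, and the entries of the Schur complement are.\<close>

lemma minor_in_symbolic_power:
  assumes c: "strict_mono_on {..<r + q} c" and b: "\<And>b. b < r + q \<Longrightarrow> c b + (r + q - 1) * Suc k < Suc d * Suc k"
  shows "(scroll_minor (Suc k) (r + q) c :: (_, 'a::idom) mpoly)
    \<in> symbolic_power (mpoly_ring (scroll_vars d k)) (secant_kernel (scroll_vars d k) r) q"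
proof -
  let ?K = "Suc k" and ?V = "scroll_vars d k"
  let ?J = "secant_kernel ?V r :: (nat \<times> nat, 'a) mpoly set"
  let ?\<phi> = "subst_vars (secant_param r) :: (nat \<times> nat, 'a) mpoly \<Rightarrow> _"
  interpret h: comm_ring_hom ?\<phi>
    by unfold_locales (simp_all add: subst_vars_add subst_vars_mult)
  define x :: "nat \<Rightarrow> nat \<Rightarrow> (nat \<times> nat, 'a) mpoly" where "x a b = Var (pos_var ?K (c b + a * ?K))" for a b
  have xV: "vars (x a b) \<subseteq> ?V" if "a < r + q" "b < r + q" for a b
  proof -
    have "a * ?K \<le> (r + q - 1) * ?K" using that by (intro mult_le_mono1) simp
    then have "c b + a * ?K < Suc d * ?K" using b[OF that(2)] by linarith
    then show ?thesis by (simp add: x_def del: mult_Suc mult_Suc_right)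
  qed
  define D where "D = mat r r (\<lambda>(a, b). x a b)"
  define B where "B = mat r q (\<lambda>(a, b). x a (b + r))"
  define C where "C = mat q r (\<lambda>(a, b). x (a + r) b)"
  define E where "E = mat q q (\<lambda>(a, b). x (a + r) (b + r))"
  have car: "D \<in> carrier_mat r r" "B \<in> carrier_mat r q" "C \<in> carrier_mat q r" "E \<in> carrier_mat q q"
    by (simp_all add: D_def B_def C_def E_def)
  have adj: "adj_mat D \<in> carrier_mat r r" by (rule adj_mat(1)[OF car(1)])
  let ?\<Delta> = "det D" and ?f = "scroll_minor ?K (r + q) c :: (_, 'a) mpoly"
  let ?S = "?\<Delta> \<cdot>\<^sub>m E - C * (adj_mat D * B)"
  have f: "?f = det (four_block_mat D B C E)"
  proof -
    have "mat (r + q) (r + q) (\<lambda>(a, b). x a b) = four_block_mat D B C E"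
      by (rule eq_matI) (auto simp: D_def B_def C_def E_def)
    then show ?thesis by (simp add: scroll_minor_def x_def)
  qed
  have \<Delta>: "?\<Delta> = scroll_minor ?K r c" by (simp add: D_def scroll_minor_def x_def)
  have cr: "strict_mono_on {..<r} c" using c by (rule monotone_on_subset) auto
  have br: "c b + (r - 1) * ?K < Suc d * ?K" if "b < r" for b
  proof -
    have "(r - 1) * ?K \<le> (r + q - 1) * ?K" by (intro mult_le_mono1) simp
    then show ?thesis using b[of b] that by linarith
  qed
  have \<Delta>J: "?\<Delta> \<notin> ?J" unfolding \<Delta> by (rule small_minor_not_in_kernel[OF cr br])
  have \<Delta>V: "vars ?\<Delta> \<subseteq> ?V" unfolding \<Delta> by (rule vars_scroll_minor[OF br])
  then have \<delta>: "?\<phi> ?\<Delta> \<noteq> 0" using \<Delta>J by (simp add: secant_kernel_def)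
  \<comment> \<open>Going down \<open>a\<close> rows multiplies the summand of copy \<open>p\<close>
    by \<open>t_p^a\<close>. So the image of the whole matrix is a product with inner dimension
    \<open>r\<close>, one index for each copy.\<close>
  define P where "P l a0 = mat l r (\<lambda>(a, p). single (single (0, p, 0) (a + a0)) 1 :: (nat \<times> nat \<times> nat, 'a) mpoly)" for l a0
  define Q where "Q l b0 = mat r l (\<lambda>(p, b). single (param_monom p (pos_var ?K (c (b + b0)))) 1 :: (nat \<times> nat \<times> nat, 'a) mpoly)" for l b0
  have PQ: "P l a0 \<in> carrier_mat l r" "Q l b0 \<in> carrier_mat r l" for l a0 b0
    by (simp_all add: P_def Q_def)
  have \<phi>x: "?\<phi> (x a b) = (\<Sum>p<r. single (single (0, p, 0) a) 1 * single (param_monom p (pos_var ?K (c b))) 1)" for a b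
  proof -
    have "param_monom p (pos_var ?K (n + a * ?K)) = single (0, p, 0) a + param_monom p (pos_var ?K n)" for p n
    proof -
      have "(n + a * ?K) div ?K = a + n div ?K" "(n + a * ?K) mod ?K = n mod ?K"
        by (rule div_mult_self1, simp, rule mod_mult_self1)
      then show ?thesis by (simp add: param_monom_def single_add add.assoc)
    qed
    then show ?thesis by (simp add: x_def secant_param_def mult_single del: mult_Suc_right)
  qed
  have \<phi>mat: "map_mat ?\<phi> (mat l m (\<lambda>(a, b). x (a + a0) (b + b0))) = P l a0 * Q m b0" for l m a0 b0
    by (rule eq_matI) (auto simp: P_def Q_def scalar_prod_def \<phi>x atLeast0LessThan)
  have maps: "map_mat ?\<phi> D = P r 0 * Q r 0" "map_mat ?\<phi> B = P r 0 * Q q r"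
    "map_mat ?\<phi> C = P q r * Q r 0" "map_mat ?\<phi> E = P q r * Q q r"
    using \<phi>mat[of r r 0 0] \<phi>mat[of r q 0 r] \<phi>mat[of q r r 0] \<phi>mat[of q q r r]
    by (simp_all add: D_def B_def C_def E_def)
  have inv: "P r 0 * Q r 0 * map_mat ?\<phi> (adj_mat D) = ?\<phi> ?\<Delta> \<cdot>\<^sub>m 1\<^sub>m r"
  proof -
    have "map_mat ?\<phi> (D * adj_mat D) = map_mat ?\<phi> D * map_mat ?\<phi> (adj_mat D)"
      by (rule h.mat_hom_mult[OF car(1) adj])
    moreover have "map_mat ?\<phi> (?\<Delta> \<cdot>\<^sub>m 1\<^sub>m r) = ?\<phi> ?\<Delta> \<cdot>\<^sub>m 1\<^sub>m r"
      by (rule eq_matI) (auto simp: subst_vars_mult)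
    ultimately show ?thesis using adj_mat(2)[OF car(1)] by (simp add: maps)
  qed
  have SJ: "?S $$ (i, j) \<in> ?J" if ij: "i < q" "j < q" for i j
  proof -
    have CAB: "C * (adj_mat D * B) \<in> carrier_mat q q" using car adj by auto
    have entry: "?S $$ (i, j) = ?\<Delta> * E $$ (i, j) - (C * (adj_mat D * B)) $$ (i, j)"
      using ij car CAB by simp
    have "vars ((C * (adj_mat D * B)) $$ (i, j)) \<subseteq> ?V"
    proof (rule vars_mat_mult[OF car(3) mult_carrier_mat[OF adj car(2)] _ _ ij])
      show "vars (C $$ (i, j)) \<subseteq> ?V" if "i < q" "j < r" for i j using that xV by (simp add: C_def)
      show "vars ((adj_mat D * B) $$ (i, j)) \<subseteq> ?V" if ij: "i < r" "j < q" for i j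
      proof (rule vars_mat_mult[OF adj car(2) _ _ ij])
        show "vars (B $$ (i, j)) \<subseteq> ?V" if "i < r" "j < q" for i j using that xV by (simp add: B_def)
        show "vars (adj_mat D $$ (i, j)) \<subseteq> ?V" if "i < r" "j < r" for i j
          by (rule vars_adj_mat[OF car(1) _ that]) (use xV in \<open>simp add: D_def\<close>)
      qed
    qed
    moreover have "vars (E $$ (i, j)) \<subseteq> ?V" using ij xV by (simp add: E_def)
    ultimately have "vars (?S $$ (i, j)) \<subseteq> ?V"
      unfolding entry using \<Delta>V by (intro vars_diff_sub vars_mult_sub)
    moreover have "?\<phi> (?S $$ (i, j)) = 0"
    proof -
      have "map_mat ?\<phi> (C * (adj_mat D * B)) = P q r * Q r 0 * (map_mat ?\<phi> (adj_mat D) * (P r 0 * Q q r))"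
        unfolding h.mat_hom_mult[OF car(3) mult_carrier_mat[OF adj car(2)]] h.mat_hom_mult[OF adj car(2)] maps ..
      also have "\<dots> = ?\<phi> ?\<Delta> \<cdot>\<^sub>m (P q r * Q q r)"
        by (rule schur_complement_rank[OF PQ(1) PQ(2) PQ(1) PQ(2) _ inv \<delta>]) (use adj in simp)
      also have "\<dots> = ?\<phi> ?\<Delta> \<cdot>\<^sub>m map_mat ?\<phi> E" by (simp add: maps)
      finally have "map_mat ?\<phi> (C * (adj_mat D * B)) $$ (i, j) = (?\<phi> ?\<Delta> \<cdot>\<^sub>m map_mat ?\<phi> E) $$ (i, j)" by simp
      then have "?\<phi> ((C * (adj_mat D * B)) $$ (i, j)) = ?\<phi> ?\<Delta> * ?\<phi> (E $$ (i, j))"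
        using ij carrier_matD[OF CAB] carrier_matD[OF car(4)] by (simp del: index_mult_mat(1))
      then show ?thesis unfolding entry by (simp add: subst_vars_diff subst_vars_mult)
    qed
    ultimately show ?thesis by (simp add: secant_kernel_def)
  qed
  have S: "?S \<in> carrier_mat q q" using car adj by auto
  have "det ?S \<in> ideal_power ?V ?J q"
    by (rule det_in_ideal_power[OF secant_kernel_ideal S SJ])
  then have "?\<Delta> ^ (r + 1) * det ?S \<in> ideal_power ?V ?J q"
    by (intro mpoly_ideal_mult[OF ideal_power_ideal[OF secant_kernel_ideal]] vars_power_sub \<Delta>V)
  then have "?\<Delta> ^ (r + q) * ?f \<in> ideal_power ?V ?J q"
    unfolding f det_schur[OF car] .
  moreover have "?\<Delta> ^ n \<notin> ?J" for n
    using \<delta> vars_power_sub[OF \<Delta>V, of n] by (simp add: secant_kernel_def subst_vars_power)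
  moreover have "vars ?f \<subseteq> ?V" by (rule vars_scroll_minor[OF b])
  ultimately show ?thesis
    using vars_power_sub[OF \<Delta>V] by (intro symbolic_powerI[OF secant_kernel_prime])
qed

section \<open>Minors of chains\<close>

text \<open>The columns are chosen so that the main diagonal is the chain: row \<open>b\<close> lies
  \<open>b K\<close> below the top of its column. For chains with gap \<open>K + 1\<close> the
  subtraction is not truncated, and the columns increase strictly.\<close>

definition chain_minor :: "nat \<Rightarrow> nat list \<Rightarrow> (nat \<times> nat, 'a::comm_ring_1) mpoly" where
  "chain_minor K c = scroll_minor K (length c) (\<lambda>b. c ! b - b * K)"

lemma chain_gap:
  assumes "chain L c" "a \<le> b" "b < length c" shows "c ! a + (b - a) * L \<le> c ! b"
  using assms(2,3)
proof (induction b rule: dec_induct)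
  case (step b)
  have "c ! b + L \<le> c ! Suc b"
    using sorted_wrt_nth_less[of "\<lambda>a b. a + L \<le> b" c b "Suc b"] assms(1) step by (simp add: chain_def)
  then show ?case using step by (simp add: Suc_diff_le)
qed simp

context
  fixes c :: "nat list" and K :: nat
  assumes c: "chain (Suc K) c"
begin

lemma chain_ge: "b < length c \<Longrightarrow> b * K \<le> c ! b"
  using chain_gap[OF c, of 0 b] by simp

lemma chain_columns_mono: "strict_mono_on {..<length c} (\<lambda>b. c ! b - b * K)"
proof (rule strict_mono_onI)
  fix a b assume ab: "a \<in> {..<length c}" "b \<in> {..<length c}" "a < b"
  then have "c ! a + (b - a) * Suc K \<le> c ! b" by (intro chain_gap[OF c]) auto
  moreover have "b * K = a * K + (b - a) * K" using ab by (metis add_mult_distrib le_add_diff_inverse less_imp_le)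
  moreover have "a * K \<le> c ! a" using ab by (intro chain_ge) auto
  ultimately show "c ! a - a * K < c ! b - b * K" using ab by simp
qed

lemma chain_columns_bound:
  assumes "set c \<subseteq> {..<N}" "b < length c"
  shows "c ! b - b * K + (length c - 1) * K < N"
proof -
  let ?l = "length c - 1"
  have "c ! b + (?l - b) * Suc K \<le> c ! ?l" using assms by (intro chain_gap[OF c]) auto
  moreover have "?l * K = b * K + (?l - b) * K" using assms by (metis Suc_diff_1 add_mult_distrib le_add_diff_inverse length_greater_0_conv less_Suc_eq_le list.size(3) not_less_zero)
  moreover have "c ! ?l < N" using assms by (metis Suc_pred' gr_implies_not0 lessI lessThan_iff linorder_neqE_nat nth_mem subset_iff)
  moreover have "b * K \<le> c ! b" using assms by (intro chain_ge)
  ultimately show ?thesis by simp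
qed

lemma chain_positions: "minor_positions K (length c) (\<lambda>b. c ! b - b * K) id = mset c"
proof -
  have "minor_positions K (length c) (\<lambda>b. c ! b - b * K) id = image_mset (\<lambda>b. c ! b) (mset_set {..<length c})"
    unfolding minor_positions_def by (rule image_mset_cong) (simp add: chain_ge)
  then show ?thesis using image_mset_nth[of "\<lambda>n. n" c] by simp
qed

lemma lookup_chain_minor:
  "K > 0 \<Longrightarrow> lookup (chain_minor K c :: (_, 'a::comm_ring_1) mpoly) (mon K (mset c)) = 1"
  using lookup_scroll_minor_diag[OF chain_columns_mono, of K, where 'a = 'a]
  by (simp add: chain_minor_def chain_positions)

end

text \<open>The index set of the generators of the symbolic power. Every chain contributes at least
  1 to the sum, so for \<open>s = 0\<close> only the empty family is left.\<close>

definition chains_of :: "nat \<Rightarrow> nat \<Rightarrow> nat \<Rightarrow> nat \<Rightarrow> nat list list set" where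
  "chains_of d k r s = {Ds. (\<forall>c\<in>set Ds. chain (Suc (Suc k)) c \<and> r < length c \<and> set c \<subseteq> {..<Suc d * Suc k}) \<and>
     (\<Sum>c\<leftarrow>Ds. length c - r) = s}"

lemma leading_chains_of:
  fixes f :: "(nat \<times> nat, 'a::comm_ring_1) mpoly"
  assumes t: "term_order_on (scroll_vars d k) tord" and sw: "swap_order (Suc k) (Suc d * Suc k) tord"
    and f: "vars f \<subseteq> scroll_vars d k" and lm: "is_leading_monomial tord f m"
    and ord: "subst_vars (normal_param r) f \<in> order_ge s"
  obtains Ds U where "Ds \<in> chains_of d k r s" "m = mon (Suc k) U + mon (Suc k) (mset (concat Ds))"
    "keys (mon (Suc k) U) \<subseteq> scroll_vars d k"
proof -
  have "keys m \<subseteq> scroll_vars d k" using keys_sub_vars[OF _ f] lm by (simp add: is_leading_monomial_def)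
  then obtain M where M: "m = mon (Suc k) M" "set_mset M \<subseteq> {..<Suc d * Suc k}" by (rule ex_mon)
  obtain Ds where Ds: "\<forall>c\<in>set Ds. chain (Suc (Suc k)) c \<and> r < length c" "mset (concat Ds) \<subseteq># M"
    "(\<Sum>c\<leftarrow>Ds. length c - r) = s"
    using leading_chains[OF t sw f lm[unfolded M(1)] ord] .
  have "set c \<subseteq> {..<Suc d * Suc k}" if "c \<in> set Ds" for c
  proof -
    have "set c \<subseteq> set_mset (mset (concat Ds))" using that by auto
    then show ?thesis using set_mset_mono[OF Ds(2)] M(2) by blast
  qed
  then have "Ds \<in> chains_of d k r s" using Ds by (simp add: chains_of_def)
  moreover define U where "U = M - mset (concat Ds)"
  have MU: "M = U + mset (concat Ds)" using Ds(2) by (simp add: U_def)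
  then have "m = mon (Suc k) U + mon (Suc k) (mset (concat Ds))" by (simp add: M(1) mon_plus)
  moreover have "keys (mon (Suc k) U) \<subseteq> scroll_vars d k"
    unfolding keys_mon_scroll using M(2) by (auto simp: MU)
  ultimately show ?thesis using that by blast
qed

lemma vars_chain_minor:
  assumes "chain (Suc (Suc k)) c" "set c \<subseteq> {..<Suc d * Suc k}"
  shows "vars (chain_minor (Suc k) c :: (_, 'a::comm_ring_1) mpoly) \<subseteq> scroll_vars d k"
  unfolding chain_minor_def by (rule vars_scroll_minor) (rule chain_columns_bound[OF assms])

lemma chain_minor_in_symbolic_power:
  assumes "chain (Suc (Suc k)) c" "set c \<subseteq> {..<Suc d * Suc k}" "length c = r + q"
  shows "(chain_minor (Suc k) c :: (_, 'a::idom) mpoly)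
    \<in> symbolic_power (mpoly_ring (scroll_vars d k)) (secant_kernel (scroll_vars d k) r) q"
  unfolding chain_minor_def assms(3)
  by (rule minor_in_symbolic_power)
     (use chain_columns_mono[OF assms(1)] chain_columns_bound[OF assms(1,2)] assms(3) in simp_all)

lemma chain_minors_in_symbolic_power:
  assumes "Ds \<in> chains_of d k r s"
  shows "(\<Prod>c\<leftarrow>Ds. chain_minor (Suc k) c :: (_, 'a::idom) mpoly)
    \<in> symbolic_power (mpoly_ring (scroll_vars d k)) (secant_kernel (scroll_vars d k) r) s"
  using assms
proof (induction Ds arbitrary: s)
  case Nil
  have "(1 :: (_, 'a) mpoly) \<notin> secant_kernel (scroll_vars d k) r" by (simp add: secant_kernel_def)
  then show ?case
    using Nil by (intro symbolic_powerI[OF secant_kernel_prime, of _ _ 1]) (simp_all add: chains_of_def)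
next
  case (Cons c Ds)
  have "(chain_minor (Suc k) c :: (_, 'a) mpoly)
    \<in> symbolic_power (mpoly_ring (scroll_vars d k)) (secant_kernel (scroll_vars d k) r) (length c - r)"
    using Cons.prems by (intro chain_minor_in_symbolic_power) (auto simp: chains_of_def)
  moreover have "(\<Prod>c\<leftarrow>Ds. chain_minor (Suc k) c :: (_, 'a) mpoly)
    \<in> symbolic_power (mpoly_ring (scroll_vars d k)) (secant_kernel (scroll_vars d k) r) (s - (length c - r))"
    using Cons.prems by (intro Cons.IH) (auto simp: chains_of_def)
  moreover have "length c - r + (s - (length c - r)) = s"
    using Cons.prems by (auto simp: chains_of_def)
  ultimately show ?case
    using symbolic_power_mult[OF secant_kernel_prime] by fastforce
qed

lemma leading_chain_minors:
  assumes t: "term_order_on (scroll_vars d k) tord"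
    and Ds: "\<And>c. c \<in> set Ds \<Longrightarrow> chain (Suc (Suc k)) c \<and> set c \<subseteq> {..<Suc d * Suc k} \<and>
      is_leading_monomial tord (chain_minor (Suc k) c :: (_, 'a::idom) mpoly) (mon (Suc k) (mset c))"
  shows "is_leading_monomial tord (\<Prod>c\<leftarrow>Ds. chain_minor (Suc k) c :: (_, 'a) mpoly) (mon (Suc k) (mset (concat Ds)))
    \<and> lookup (\<Prod>c\<leftarrow>Ds. chain_minor (Suc k) c :: (_, 'a) mpoly) (mon (Suc k) (mset (concat Ds))) = 1
    \<and> vars (\<Prod>c\<leftarrow>Ds. chain_minor (Suc k) c :: (_, 'a) mpoly) \<subseteq> scroll_vars d k"
  using Ds
proof (induction Ds)
  case Nil
  then show ?case using tord_refl[OF t, of 0] by (simp add: is_leading_monomial_def lookup_one)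
next
  case (Cons c Ds)
  have c: "chain (Suc (Suc k)) c" "set c \<subseteq> {..<Suc d * Suc k}"
    "is_leading_monomial tord (chain_minor (Suc k) c :: (_, 'a) mpoly) (mon (Suc k) (mset c))"
    using Cons.prems by auto
  note vc = vars_chain_minor[OF c(1,2), where 'a = 'a]
  have IH: "is_leading_monomial tord (\<Prod>c\<leftarrow>Ds. chain_minor (Suc k) c :: (_, 'a) mpoly) (mon (Suc k) (mset (concat Ds)))
    \<and> lookup (\<Prod>c\<leftarrow>Ds. chain_minor (Suc k) c :: (_, 'a) mpoly) (mon (Suc k) (mset (concat Ds))) = 1
    \<and> vars (\<Prod>c\<leftarrow>Ds. chain_minor (Suc k) c :: (_, 'a) mpoly) \<subseteq> scroll_vars d k"
    using Cons by simp
  from leading_monomial_mult[OF t c(3) vc conjunct1[OF IH] conjunct2[OF conjunct2[OF IH]]]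
  show ?case using IH vc lookup_chain_minor[OF c(1), where 'a = 'a] by (simp add: mon_plus vars_mult_sub)
qed

section \<open>Division by chain minors\<close>

lemma lookup_const_mult: "lookup (single 0 c * p) m = c * (lookup p m :: 'a::comm_ring_1)"
  unfolding mult_map_scale_conv_mult[symmetric] by (simp add: Poly_Mapping.map.rep_eq when_def)

lemma finite_bounded_degree: "finite {m. keys m \<subseteq> scroll_vars d k \<and> monom_degree m \<le> D}"
proof (rule finite_subset)
  let ?L = "{xs. set xs \<subseteq> {..<Suc d * Suc k} \<and> length xs \<le> D}"
  show "finite ((\<lambda>xs. mon (Suc k) (mset xs)) ` ?L)"
    by (intro finite_imageI finite_lists_length_le) simp
  show "{m. keys m \<subseteq> scroll_vars d k \<and> monom_degree m \<le> D} \<subseteq> (\<lambda>xs. mon (Suc k) (mset xs)) ` ?L"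
  proof
    fix m assume m: "m \<in> {m. keys m \<subseteq> scroll_vars d k \<and> monom_degree m \<le> D}"
    then obtain M where M: "m = mon (Suc k) M" "set_mset M \<subseteq> {..<Suc d * Suc k}" using ex_mon by blast
    obtain xs where "mset xs = M" by (metis ex_mset)
    then show "m \<in> (\<lambda>xs. mon (Suc k) (mset xs)) ` ?L"
      using M m by (intro image_eqI[of _ _ xs]) (auto simp: monom_degree_mon simp flip: set_mset_mset)
  qed
qed

text \<open>The number of monomials below the leading one is the measure by which division
  terminates.\<close>

lemma deglex_rank:
  assumes "(n, m) \<in> deglex d k" "n \<noteq> m"
  shows "card {p. (p, n) \<in> deglex d k} < card {p. (p, m) \<in> deglex d k}"
proof (rule psubset_card_mono)
  note t = term_order_deglex[of d k]
  show "finite {p. (p, m) \<in> deglex d k}"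
    by (rule finite_subset[OF _ finite_bounded_degree[of d k "monom_degree m"]]) (auto simp: deglex_def)
  have "(m, m) \<in> deglex d k" using assms(1) by (auto simp: deglex_def)
  moreover have "(m, n) \<notin> deglex d k" using assms tord_antisym[OF t] by blast
  moreover have "{p. (p, n) \<in> deglex d k} \<subseteq> {p. (p, m) \<in> deglex d k}" using tord_trans[OF t _ assms(1)] by blast
  ultimately show "{p. (p, n) \<in> deglex d k} \<subset> {p. (p, m) \<in> deglex d k}" by blast
qed

text \<open>The leading monomial of \<open>f\<close> is a multiple of that of a product of chain
  minors. This product has leading coefficient 1 and order at least \<open>s\<close>, so subtracting
  a multiple of it keeps the order bound and lowers the leading monomial.\<close>

lemma order_ge_in_ideal_leading:
  fixes f :: "(nat \<times> nat, 'a::idom) mpoly"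
  assumes Q: "ideal Q (mpoly_ring (scroll_vars d k))"
    and gen: "\<And>Ds. Ds \<in> chains_of d k r s \<Longrightarrow> (\<Prod>c\<leftarrow>Ds. chain_minor (Suc k) c) \<in> Q"
    and f: "is_leading_monomial (deglex d k) f m" "vars f \<subseteq> scroll_vars d k"
      "subst_vars (normal_param r) f \<in> order_ge s"
  shows "f \<in> Q"
  using f
proof (induction "card {n. (n, m) \<in> deglex d k}" arbitrary: f m rule: less_induct)
  case less
  let ?V = "scroll_vars d k" and ?K = "Suc k"
  note t = term_order_deglex[of d k]
  obtain Ds U where co: "Ds \<in> chains_of d k r s" and m: "m = mon ?K U + mon ?K (mset (concat Ds))"
    and bU: "keys (mon ?K U) \<subseteq> ?V"
    using leading_chains_of[OF t swap_order_deglex less.prems(2,1,3)] .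
  have Ds: "chain (Suc ?K) c" "set c \<subseteq> {..<Suc d * ?K}" if "c \<in> set Ds" for c
    using co that by (auto simp: chains_of_def)
  define g where "g = (\<Prod>c\<leftarrow>Ds. chain_minor ?K c :: (_, 'a) mpoly)"
  have lg: "is_leading_monomial (deglex d k) g (mon ?K (mset (concat Ds)))
    \<and> lookup g (mon ?K (mset (concat Ds))) = 1 \<and> vars g \<subseteq> ?V"
    unfolding g_def
  proof (rule leading_chain_minors[OF t], intro conjI)
    fix c assume c: "c \<in> set Ds"
    note ch = Ds[OF c]
    show "chain (Suc ?K) c" "set c \<subseteq> {..<Suc d * ?K}" by (rule ch)+
    show "is_leading_monomial (deglex d k) (chain_minor ?K c :: (_, 'a) mpoly) (mon ?K (mset c))"
      unfolding chain_minor_def chain_positions[OF ch(1), symmetric]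
      by (rule leading_scroll_minor[OF chain_columns_mono[OF ch(1)]]) (rule chain_columns_bound[OF ch])
  qed
  define h where "h = (single (mon ?K U) 1 :: (_, 'a) mpoly)"
  have hV: "vars h \<subseteq> ?V" unfolding h_def by (rule vars_single_sub[OF bU])
  have lh: "is_leading_monomial (deglex d k) h (mon ?K U)"
    using tord_refl[OF t bU] by (simp add: h_def is_leading_monomial_def)
  have lhg: "is_leading_monomial (deglex d k) (h * g) m" "lookup (h * g) m = 1"
    using leading_monomial_mult[OF t lh hV conjunct1[OF lg] conjunct2[OF conjunct2[OF lg]]] lg
    by (simp_all add: m h_def)
  define p where "p = single 0 (lookup f m) * h"
  have pV: "vars p \<subseteq> ?V" unfolding p_def using hV by (intro vars_mult_sub) auto
  define f' where "f' = f - p * g"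
  have gQ: "g \<in> Q" unfolding g_def by (rule gen[OF co])
  have pg: "p * g \<in> Q" by (rule mpoly_ideal_mult[OF Q pV gQ])
  have lc: "lookup (p * g) n = lookup f m * lookup (h * g) n" for n
    by (simp add: p_def mult.assoc lookup_const_mult)
  have f'V: "vars f' \<subseteq> ?V"
    unfolding f'_def using less.prems(2) pV lg by (intro vars_diff_sub vars_mult_sub) auto
  have ord': "subst_vars (normal_param r) f' \<in> order_ge s"
  proof -
    have "subst_vars (normal_param r) g \<in> order_ge s"
      unfolding g_def by (rule symbolic_power_order[OF chain_minors_in_symbolic_power[OF co]])
    then have "subst_vars (normal_param r) p * subst_vars (normal_param r) g \<in> order_ge (0 + s)"
      by (intro order_ge_mult) simp_all
    then show ?thesis
      unfolding f'_def using less.prems(3) by (simp add: subst_vars_diff subst_vars_mult order_ge_diff)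
  qed
  have "f' \<in> Q"
  proof (cases "f' = 0")
    case True
    then show ?thesis using mpoly_ideal_0[OF Q] by simp
  next
    case False
    then obtain m' where m': "is_leading_monomial (deglex d k) f' m'"
      using ex_leading_monomial[OF t _ f'V] by blast
    have "lookup f' m = 0" by (simp add: f'_def lookup_minus lc lhg)
    then have "m' \<noteq> m" using m' by (auto simp: is_leading_monomial_def in_keys_iff)
    have "lookup f' m' \<noteq> 0" using m' by (simp add: is_leading_monomial_def in_keys_iff)
    then have "m' \<in> keys f \<or> m' \<in> keys (h * g)"
      by (auto simp: f'_def lookup_minus lc in_keys_iff)
    then have "(m', m) \<in> deglex d k"
      using less.prems(1) lhg(1) by (auto simp: is_leading_monomial_def)
    then show ?thesis using less.hyps[OF deglex_rank m' f'V ord'] \<open>m' \<noteq> m\<close> by blast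
  qed
  then have "f' + p * g \<in> Q" using mpoly_ideal_add[OF Q _ pg] by blast
  then show ?case by (simp add: f'_def)
qed

text \<open>The ideal \<open>Q\<close> is arbitrary so that the same division serves for the
  symbolic power and for both inclusions of differential perfection.\<close>

lemma order_ge_in_ideal:
  fixes f :: "(nat \<times> nat, 'a::idom) mpoly"
  assumes Q: "ideal Q (mpoly_ring (scroll_vars d k))"
    and gen: "\<And>Ds. Ds \<in> chains_of d k r s \<Longrightarrow> (\<Prod>c\<leftarrow>Ds. chain_minor (Suc k) c) \<in> Q"
    and f: "vars f \<subseteq> scroll_vars d k" "subst_vars (normal_param r) f \<in> order_ge s"
  shows "f \<in> Q"
proof (cases "f = 0")
  case True
  then show ?thesis using mpoly_ideal_0[OF Q] by simp
next
  case False
  then obtain m where "is_leading_monomial (deglex d k) f m"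
    using ex_leading_monomial[OF term_order_deglex _ f(1)] by blast
  from order_ge_in_ideal_leading[OF Q gen this f] show ?thesis .
qed

text \<open>The converse of the order bound comes from division by chain minors, which lie in the
  symbolic power by block elimination.\<close>

lemma secant_symbolic_power_iff:
  fixes f :: "(nat \<times> nat, 'a::idom) mpoly"
  shows "f \<in> symbolic_power (mpoly_ring (scroll_vars d k)) (secant_kernel (scroll_vars d k) r) s
    \<longleftrightarrow> vars f \<subseteq> scroll_vars d k \<and> subst_vars (normal_param r) f \<in> order_ge s"
proof
  assume f: "f \<in> symbolic_power (mpoly_ring (scroll_vars d k)) (secant_kernel (scroll_vars d k) r) s"
  show "vars f \<subseteq> scroll_vars d k \<and> subst_vars (normal_param r) f \<in> order_ge s"
    using symbolic_power_order[OF f] mpoly_ideal_sub[OF symbolic_power_ideal[OF secant_kernel_prime] f] by blast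
next
  assume "vars f \<subseteq> scroll_vars d k \<and> subst_vars (normal_param r) f \<in> order_ge s"
  then have f: "vars f \<subseteq> scroll_vars d k" "subst_vars (normal_param r) f \<in> order_ge s" by simp_all
  show "f \<in> symbolic_power (mpoly_ring (scroll_vars d k)) (secant_kernel (scroll_vars d k) r) s"
    by (rule order_ge_in_ideal[OF symbolic_power_ideal[OF secant_kernel_prime] chain_minors_in_symbolic_power f])
qed

section \<open>Differential perfection\<close>

text \<open>Together these facts make the sum in the semiring of ideals the least upper bound, the
  only property used afterwards.\<close>

lemma ideals_set_finsum:
  fixes g :: "'i \<Rightarrow> ('v, 'a::comm_ring_1) mpoly set"
  assumes "finite A" "\<And>i. i \<in> A \<Longrightarrow> ideal (g i) (mpoly_ring V)"
  shows "ideal (finsum (ideals_set (mpoly_ring V)) g A) (mpoly_ring V)"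
    and "i \<in> A \<Longrightarrow> g i \<subseteq> finsum (ideals_set (mpoly_ring V)) g A"
    and "ideal Q (mpoly_ring V) \<Longrightarrow> (\<And>i. i \<in> A \<Longrightarrow> g i \<subseteq> Q) \<Longrightarrow> finsum (ideals_set (mpoly_ring V)) g A \<subseteq> Q"
proof -
  let ?S = "ideals_set (mpoly_ring V) :: ('v, 'a) mpoly set ring"
  interpret S: semiring ?S by (rule cring.ideals_set_is_semiring[OF cring_mpoly])
  have cl: "ideal (finsum ?S g B) (mpoly_ring V)" if "B \<subseteq> A" for B
    using S.finsum_closed[of g B] assms(2) that by auto
  show "ideal (finsum ?S g A) (mpoly_ring V)" by (rule cl) simp
  have ins: "finsum ?S g (insert i B) = g i <+>\<^bsub>mpoly_ring V\<^esub> finsum ?S g B"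
    if "i \<notin> B" "insert i B \<subseteq> A" for i B
  proof -
    have "finite B" using that(2) assms(1) by (meson finite_subset insert_subset)
    then have "finsum ?S g (insert i B) = g i \<oplus>\<^bsub>?S\<^esub> finsum ?S g B"
      by (rule S.finsum_insert) (use that assms(2) in auto)
    then show ?thesis by simp
  qed
  show "g i \<subseteq> finsum ?S g A" if i: "i \<in> A"
  proof
    fix x assume x: "x \<in> g i"
    have "finsum ?S g A = g i <+>\<^bsub>mpoly_ring V\<^esub> finsum ?S g (A - {i})"
      using ins[of i "A - {i}"] i by (simp add: insert_absorb)
    moreover have "x + 0 \<in> g i <+>\<^bsub>mpoly_ring V\<^esub> finsum ?S g (A - {i})"
      using x mpoly_ideal_0[OF cl[of "A - {i}"]] unfolding set_add_def' by fastforce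
    ultimately show "x \<in> finsum ?S g A" by simp
  qed
  show "finsum ?S g A \<subseteq> Q" if Q: "ideal Q (mpoly_ring V)" "\<And>i. i \<in> A \<Longrightarrow> g i \<subseteq> Q"
  proof -
    have "finsum ?S g B \<subseteq> Q" if "finite B" "B \<subseteq> A" for B
      using that
    proof (induction B)
      case empty
      then show ?case using mpoly_ideal_0[OF Q(1)] by simp
    next
      case (insert i B)
      then have B: "finsum ?S g B \<subseteq> Q" "g i \<subseteq> Q" using Q(2) by auto
      show ?case
        unfolding ins[OF insert(2) insert(4)]
      proof
        fix x assume "x \<in> g i <+>\<^bsub>mpoly_ring V\<^esub> finsum ?S g B"
        then obtain a b where "a \<in> g i" "b \<in> finsum ?S g B" "x = a + b"
          unfolding set_add_def' by auto
        then show "x \<in> Q" using B mpoly_ideal_add[OF Q(1)] by blast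
      qed
    qed
    then show ?thesis using assms(1) by blast
  qed
qed

text \<open>By division, the inclusion into the right-hand side is needed for products of chain
  minors only, and such a product is either a single minor or splits into two shorter
  products.\<close>

lemma secant_kernel_diff_perfect:
  fixes r s d k :: nat
  defines "V \<equiv> scroll_vars d k"
  defines "J \<equiv> secant_kernel V r :: (nat \<times> nat, 'a::idom) mpoly set"
  assumes s: "s \<ge> 1"
  shows "symbolic_power (mpoly_ring V) J s =
    secant_kernel V (r + s - 1) \<oplus>\<^bsub>ideals_set (mpoly_ring V)\<^esub>
    (\<Oplus>\<^bsub>ideals_set (mpoly_ring V)\<^esub> i \<in> {1..s - 1}.
       symbolic_power (mpoly_ring V) J i \<otimes>\<^bsub>ideals_set (mpoly_ring V)\<^esub> symbolic_power (mpoly_ring V) J (s - i))"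
proof -
  let ?R = "mpoly_ring V :: (nat \<times> nat, 'a) mpoly ring"
  let ?sym = "symbolic_power ?R J"
  let ?g = "\<lambda>i. ideal_prod ?R (?sym i) (?sym (s - i))"
  let ?F = "finsum (ideals_set ?R) ?g {1..s - 1}"
  have sym: "ideal (?sym i) ?R" for i
    unfolding J_def by (rule symbolic_power_ideal[OF secant_kernel_prime])
  have gi: "ideal (?g i) ?R" for i
    by (rule ring.ideal_prod_is_ideal[OF ring_mpoly sym sym])
  have F: "ideal ?F ?R" by (rule ideals_set_finsum(1)) (use gi in auto)
  note K = secant_kernel_ideal[of V "r + s - 1", where 'a = 'a]
  have RHS: "ideal (secant_kernel V (r + s - 1) <+>\<^bsub>?R\<^esub> ?F) ?R"
    by (rule ring.add_ideals[OF ring_mpoly K F])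
  have "?sym s = secant_kernel V (r + s - 1) <+>\<^bsub>?R\<^esub> ?F"
  proof (intro equalityI subsetI)
    fix f assume "f \<in> ?sym s"
    then have f: "vars f \<subseteq> V" "subst_vars (normal_param r) f \<in> order_ge s"
      unfolding J_def V_def secant_symbolic_power_iff by auto
    show "f \<in> secant_kernel V (r + s - 1) <+>\<^bsub>?R\<^esub> ?F"
    proof (rule order_ge_in_ideal[OF RHS[unfolded V_def], folded V_def, OF _ f])
      fix Ds assume Ds: "Ds \<in> chains_of d k r s"
      then obtain c Ds' where Ds': "Ds = c # Ds'" using s by (cases Ds) (auto simp: chains_of_def)
      have c: "chain (Suc (Suc k)) c" "r < length c" "set c \<subseteq> {..<Suc d * Suc k}"
        using Ds by (auto simp: chains_of_def Ds')
      define i where "i = length c - r"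
      have len: "length c = r + i" "i \<ge> 1" using c by (simp_all add: i_def)
      show "(\<Prod>c\<leftarrow>Ds. chain_minor (Suc k) c :: (_, 'a) mpoly) \<in> secant_kernel V (r + s - 1) <+>\<^bsub>?R\<^esub> ?F"
      \<comment> \<open>A single chain has length \<open>r + s\<close>, so its minor lies in the
        ideal of the \<open>(r + s - 1)\<close>-th secant variety. With two or more chains the first
        factor splits off, with \<open>1 \<le> i\<close> and \<open>i < s\<close>.\<close>
      proof (cases "Ds' = []")
        case True
        then have "i = s" using Ds by (simp add: chains_of_def Ds' i_def)
        then have "length c = (r + s - 1) + 1" using len s by simp
        from symbolic_power_order[OF chain_minor_in_symbolic_power[OF c(1,3) this, where 'a = 'a]]
        have m: "chain_minor (Suc k) c \<in> (secant_kernel V (r + s - 1) :: (_, 'a) mpoly set)"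
          unfolding secant_kernel_iff_order using vars_chain_minor[OF c(1,3)] by (simp add: V_def)
        have "chain_minor (Suc k) c + 0 \<in> secant_kernel V (r + s - 1) <+>\<^bsub>?R\<^esub> ?F"
          unfolding set_add_def' using m mpoly_ideal_0[OF F] by fastforce
        then show ?thesis by (simp add: Ds' True)
      next
        case False
        then obtain c' Ds'' where "Ds' = c' # Ds''" by (cases Ds') auto
        then have lt: "i < s" using Ds by (auto simp: chains_of_def Ds' i_def)
        have "chain_minor (Suc k) c \<in> ?sym i"
          unfolding J_def V_def by (rule chain_minor_in_symbolic_power[OF c(1,3) len(1)])
        moreover have "(\<Prod>c\<leftarrow>Ds'. chain_minor (Suc k) c) \<in> ?sym (s - i)"
          unfolding J_def V_def
          by (rule chain_minors_in_symbolic_power) (use Ds in \<open>auto simp: chains_of_def Ds' i_def\<close>)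
        ultimately have "(\<Prod>c\<leftarrow>Ds. chain_minor (Suc k) c) \<in> ?g i"
          using ideal_prod.prod[of "chain_minor (Suc k) c" "?sym i" "\<Prod>c\<leftarrow>Ds'. chain_minor (Suc k) c" "?sym (s - i)" ?R]
          by (simp add: Ds')
        then have "(\<Prod>c\<leftarrow>Ds. chain_minor (Suc k) c) \<in> ?F"
        proof (rule subsetD[OF ideals_set_finsum(2), rotated -1])
          show "i \<in> {1..s - 1}" using len(2) lt by simp
        qed (use gi in simp_all)
        then have "0 + (\<Prod>c\<leftarrow>Ds. chain_minor (Suc k) c) \<in> secant_kernel V (r + s - 1) <+>\<^bsub>?R\<^esub> ?F"
          unfolding set_add_def' using mpoly_ideal_0[OF K] by fastforce
        then show ?thesis by simp
      qed
    qed
  next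
    fix f assume "f \<in> secant_kernel V (r + s - 1) <+>\<^bsub>?R\<^esub> ?F"
    then obtain a b where ab: "a \<in> secant_kernel V (r + s - 1)" "b \<in> ?F" "f = a + b"
      unfolding set_add_def' by auto
    \<comment> \<open>Division with the parameters \<open>r + s - 1\<close> and \<open>1\<close>:
      the secant ideal is generated by minors of size \<open>r + s\<close>, and block elimination at
      size \<open>r\<close> puts these into the \<open>s\<close>-th symbolic power of
      \<open>J\<close>.\<close>
    have "a \<in> ?sym s"
    proof (rule order_ge_in_ideal[OF sym[unfolded V_def], folded V_def])
      show "vars a \<subseteq> V" "subst_vars (normal_param (r + s - 1)) a \<in> order_ge 1"
        using ab(1) by (simp_all add: secant_kernel_iff_order)
      fix Ds assume Ds: "Ds \<in> chains_of d k (r + s - 1) 1"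
      then obtain c Ds' where Ds': "Ds = c # Ds'" by (cases Ds) (auto simp: chains_of_def)
      have c: "chain (Suc (Suc k)) c" "r + s - 1 < length c" "set c \<subseteq> {..<Suc d * Suc k}"
        using Ds by (auto simp: chains_of_def Ds')
      have "Ds' = []"
      proof (rule ccontr)
        assume "Ds' \<noteq> []"
        then obtain c' Ds'' where "Ds' = c' # Ds''" by (cases Ds') auto
        then show False using Ds c(2) by (auto simp: chains_of_def Ds')
      qed
      moreover have "length c - (r + s - 1) = 1"
        using Ds by (simp add: chains_of_def Ds' \<open>Ds' = []\<close>)
      then have "length c = r + s" using c(2) s by linarith
      ultimately show "(\<Prod>c\<leftarrow>Ds. chain_minor (Suc k) c :: (_, 'a) mpoly) \<in> ?sym s"
        unfolding J_def V_def using chain_minor_in_symbolic_power[OF c(1,3), where 'a = 'a] by (simp add: Ds')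
    qed
    moreover have "?F \<subseteq> ?sym s"
    proof (rule ideals_set_finsum(3)[OF _ gi sym])
      fix i assume i: "i \<in> {1..s - 1}"
      show "?g i \<subseteq> ?sym s"
      proof
        fix x assume "x \<in> ?g i"
        then show "x \<in> ?sym s"
        proof (induction rule: ideal_prod.induct)
          case (prod u v)
          have "u * v \<in> ?sym (i + (s - i))"
            using symbolic_power_mult[OF secant_kernel_prime] prod unfolding J_def by blast
          moreover have "i + (s - i) = s" using i by auto
          ultimately show ?case by simp
        next
          case (sum u v)
          then show ?case using mpoly_ideal_add[OF sym] by simp
        qed
      qed
    qed simp
    ultimately show "f \<in> ?sym s" using ab mpoly_ideal_add[OF sym] by blast
  qed
  then show ?thesis by simp
qed

section \<open>Groebner bases\<close>

lemma single_1_eq [simp]: "(single m 1 :: ('v, 'a::comm_ring_1) mpoly) = single n 1 \<longleftrightarrow> m = n"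
proof
  assume "(single m 1 :: ('v, 'a) mpoly) = single n 1"
  then have "keys (single m 1 :: ('v, 'a) mpoly) = keys (single n 1 :: ('v, 'a) mpoly)" by simp
  then show "m = n" by simp
qed simp

lemma diagonal_order_scroll_minor:
  fixes c :: "nat \<Rightarrow> nat"
  assumes diag: "diagonal_term_order V ((scroll_mat d k :: nat \<Rightarrow> (nat \<times> nat, 'a::comm_ring_1) mpoly mat) ` {1..d}) tord"
    and r: "1 \<le> r" "r \<le> d" and c: "strict_mono_on {..<Suc r} c" "\<And>b. b < Suc r \<Longrightarrow> c b < (d - r + 1) * Suc k"
  shows "is_leading_monomial tord (scroll_minor (Suc k) (Suc r) c :: (nat \<times> nat, 'a) mpoly)
    (mon (Suc k) (minor_positions (Suc k) (Suc r) c id))"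
proof -
  let ?A = "scroll_mat d k r :: (nat \<times> nat, 'a) mpoly mat"
  let ?S = "{..<Suc r}" and ?T = "c ` {..<Suc r}"
  let ?B = "mat (Suc r) (Suc r) (\<lambda>(a, b). Var (pos_var (Suc k) (c b + a * Suc k))) :: (nat \<times> nat, 'a) mpoly mat"
  have sub: "submatrix ?A ?S ?T = ?B" by (rule submatrix_scroll[OF c])
  have "?S \<subseteq> {..<dim_row ?A}" "?T \<subseteq> {..<dim_col ?A}"
    using c(2) by (auto simp: scroll_mat_def)
  moreover have "card ?S = card ?T"
    using strict_mono_on_imp_inj_on[OF c(1)] by (simp add: card_image)
  moreover have "?A \<in> scroll_mat d k ` {1..d}" using r by auto
  ultimately obtain m where m: "prod_list (diag_mat (submatrix ?A ?S ?T)) = single m 1"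
    "is_leading_monomial tord (det (submatrix ?A ?S ?T)) m"
    using diag unfolding diagonal_term_order_def by blast
  have "prod_list (diag_mat ?B) = (\<Prod>a<Suc r. Var (pos_var (Suc k) (c a + a * Suc k)))"
    unfolding prod_list_diag_prod by (rule prod.cong) auto
  also have "\<dots> = single (mon (Suc k) (minor_positions (Suc k) (Suc r) c id)) 1"
    unfolding Var_def prod_unfold_prod_mset prod_mset_single mon_def minor_positions_def
    by (simp add: image_mset.compositionality comp_def)
  finally have "m = mon (Suc k) (minor_positions (Suc k) (Suc r) c id)" using m(1) by (simp add: sub)
  then show ?thesis using m(2) by (simp add: sub scroll_minor_def)
qed

text \<open>The 2-minors of \<open>X_1\<close> are the binomials of the swaps. Their two monomials
  differ, so the antidiagonal really occurs and is compared with the leading diagonal.\<close>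

lemma diagonal_order_swap_order:
  assumes diag: "diagonal_term_order V ((scroll_mat d k :: nat \<Rightarrow> (nat \<times> nat, 'a::comm_ring_1) mpoly mat) ` {1..d}) tord"
    and d: "d \<ge> 1"
  shows "swap_order (Suc k) (Suc d * Suc k) tord"
  unfolding swap_order_def
proof (intro allI impI)
  fix n m assume nm: "n < m \<and> m + Suc k < Suc d * Suc k"
  define c where "c b = (if b = 0 then n else m)" for b :: nat
  have c1: "strict_mono_on {..<Suc 1} c" using nm by (auto simp: strict_mono_on_def c_def)
  have c2: "c b < (d - 1 + 1) * Suc k" if "b < Suc 1" for b using nm d by (auto simp: c_def)
  have lead: "is_leading_monomial tord (scroll_minor (Suc k) (Suc 1) c :: (nat \<times> nat, 'a) mpoly)
    (mon (Suc k) (minor_positions (Suc k) (Suc 1) c id))"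
    by (rule diagonal_order_scroll_minor[OF diag order_refl d c1 c2])
  have pos: "minor_positions (Suc k) (Suc 1) c id = {#n, m + Suc k#}"
    by (simp add: minor_positions_def c_def lessThan_Suc)
  have sm: "(scroll_minor (Suc k) (Suc 1) c :: (nat \<times> nat, 'a) mpoly)
    = single (mon (Suc k) {#n, m + Suc k#}) 1 - single (mon (Suc k) {#n + Suc k, m#}) 1"
  proof -
    have "scroll_minor (Suc k) (Suc 1) c = (det (mat 2 2 (\<lambda>(a, b). Var (pos_var (Suc k) (c b + a * Suc k)))) :: (nat \<times> nat, 'a) mpoly)"
      by (simp only: scroll_minor_def Suc_1)
    then show ?thesis unfolding det_2_mat by (simp add: Var_mult mon_add_mset add.commute c_def)
  qed
  have "{#n + Suc k, m#} \<noteq> {#n, m + Suc k#}" 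
  proof
    assume "{#n + Suc k, m#} = {#n, m + Suc k#}"
    then have "n \<in># {#n + Suc k, m#}" by simp
    then show False using nm by simp
  qed
  then have "mon (Suc k) {#n + Suc k, m#} \<noteq> mon (Suc k) {#n, m + Suc k#}" by simp
  then have "mon (Suc k) {#n + Suc k, m#} \<in> keys (scroll_minor (Suc k) (Suc 1) c :: (nat \<times> nat, 'a) mpoly)"
    unfolding sm in_keys_iff lookup_minus lookup_single by (simp add: when_def del: mon_inject)
  then show "(mon (Suc k) {#n + Suc k, m#}, mon (Suc k) {#n, m + Suc k#}) \<in> tord"
    using lead unfolding pos is_leading_monomial_def by blast
qed

lemma total_degree_homogeneous:
  assumes "p \<noteq> 0" "\<And>m. m \<in> keys p \<Longrightarrow> monom_degree m = t"
  shows "total_degree p = t"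
proof -
  have "keys p \<noteq> {}" using assms(1) by simp
  moreover have "(\<lambda>m. \<Sum>v\<in>keys m. lookup m v) ` keys p \<subseteq> {t}" using assms(2) by (auto simp: monom_degree_def)
  ultimately have "(\<lambda>m. \<Sum>v\<in>keys m. lookup m v) ` keys p = {t}" by blast
  then show ?thesis by (simp add: total_degree_def)
qed

lemma total_degree_scroll_minor:
  assumes "strict_mono_on {..<t} c" "K > 0"
  shows "total_degree (scroll_minor K t c :: (_, 'a::comm_ring_1) mpoly) = t"
proof (rule total_degree_homogeneous)
  show "(scroll_minor K t c :: (_, 'a) mpoly) \<noteq> 0"
    using lookup_scroll_minor_diag[OF assms, where 'a = 'a] by fastforce
qed (rule scroll_minor_degree)

text \<open>A column belongs to \<open>X_r\<close> exactly if its bottom entry, \<open>r\<close>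
  rows further down, is still one of the variables.\<close>

lemma scroll_columns_bound:
  fixes d k r n :: nat
  assumes "r \<le> d"
  shows "n < (d - r + 1) * Suc k \<longleftrightarrow> n + r * Suc k < Suc d * Suc k"
proof -
  have "Suc d * Suc k = (d - r + 1) * Suc k + r * Suc k"
    using assms by (metis add_mult_distrib Suc_eq_plus1 add.commute add_Suc le_add_diff_inverse)
  then show ?thesis by linarith
qed

definition minor_products :: "nat \<Rightarrow> nat \<Rightarrow> nat \<Rightarrow> nat \<Rightarrow> (nat \<times> nat, 'a::comm_ring_1) mpoly set" where
  "minor_products d k r s = {(\<Prod>i\<in>{1..l}. f i) | (l :: nat) (f :: nat \<Rightarrow> (nat \<times> nat, 'a) mpoly) (\<rho> :: nat \<Rightarrow> nat).
     l \<ge> 1 \<and>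
     (\<forall>i\<in>{1..l}. r \<le> \<rho> i \<and> \<rho> i \<le> d \<and> f i \<in> minors_ge (\<rho> i + 1) (scroll_mat d k (\<rho> i))) \<and>
     (\<Sum>i\<in>{1..l}. int (total_degree (f i)) - int r) = int s}"

lemma minors_geE:
  assumes "f \<in> minors_ge (r + 1) (scroll_mat d k r :: (nat \<times> nat, 'a::comm_ring_1) mpoly mat)" "r \<le> d"
  obtains c where "f = scroll_minor (Suc k) (Suc r) c" "strict_mono_on {..<Suc r} c"
    "\<And>b. b < Suc r \<Longrightarrow> c b + (Suc r - 1) * Suc k < Suc d * Suc k" "total_degree f = Suc r"
proof -
  obtain c where c: "f = scroll_minor (Suc k) (Suc r) c" "strict_mono_on {..<Suc r} c"
    "\<And>b. b < Suc r \<Longrightarrow> c b < (d - r + 1) * Suc k"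
    using assms(1) unfolding minors_ge_scroll_mat[OF refl] minors_scroll_mat by blast
  have "c b + (Suc r - 1) * Suc k < Suc d * Suc k" if "b < Suc r" for b
    using c(3)[OF that] unfolding scroll_columns_bound[OF assms(2)] by simp
  moreover have "total_degree f = Suc r" unfolding c(1) by (rule total_degree_scroll_minor[OF c(2)]) simp
  ultimately show ?thesis using that c by blast
qed

lemma minor_products_sub:
  "minor_products d k r s \<subseteq> symbolic_power (mpoly_ring (scroll_vars d k))
     (secant_kernel (scroll_vars d k) r :: (nat \<times> nat, 'a::idom) mpoly set) s"
proof
  let ?sym = "symbolic_power (mpoly_ring (scroll_vars d k)) (secant_kernel (scroll_vars d k) r :: (nat \<times> nat, 'a) mpoly set)"
  fix p :: "(nat \<times> nat, 'a) mpoly" assume "p \<in> minor_products d k r s"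
  then obtain l f \<rho> where p: "p = (\<Prod>i\<in>{1..l}. f i)"
    and f: "\<forall>i\<in>{1..l::nat}. r \<le> \<rho> i \<and> \<rho> i \<le> d \<and> f i \<in> minors_ge (\<rho> i + 1) (scroll_mat d k (\<rho> i))"
    and s: "(\<Sum>i\<in>{1..l}. int (total_degree (f i)) - int r) = int s"
    unfolding minor_products_def by blast
  have each: "f i \<in> ?sym (Suc (\<rho> i) - r) \<and> total_degree (f i) = Suc (\<rho> i) \<and> r \<le> \<rho> i" if i: "i \<in> {1..l}" for i
  proof -
    have fi: "f i \<in> minors_ge (\<rho> i + 1) (scroll_mat d k (\<rho> i))" "\<rho> i \<le> d" "r \<le> \<rho> i" using f i by blast+
    obtain c where c: "f i = scroll_minor (Suc k) (Suc (\<rho> i)) c" "strict_mono_on {..<Suc (\<rho> i)} c"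
      "\<And>b. b < Suc (\<rho> i) \<Longrightarrow> c b + (Suc (\<rho> i) - 1) * Suc k < Suc d * Suc k" "total_degree (f i) = Suc (\<rho> i)"
      by (rule minors_geE[OF fi(1,2)]) blast
    have e: "Suc (\<rho> i) = r + (Suc (\<rho> i) - r)" using fi(3) by simp
    have "f i \<in> ?sym (Suc (\<rho> i) - r)"
      unfolding c(1) by (subst e, rule minor_in_symbolic_power) (use c(2,3) e in simp_all)
    then show ?thesis using c(4) fi by simp
  qed
  have "(\<Prod>i\<in>A. f i) \<in> ?sym (\<Sum>i\<in>A. Suc (\<rho> i) - r)" if "finite A" "A \<subseteq> {1..l}" for A
    using that
  proof (induction A)
    case empty
    have "(1 :: (_, 'a) mpoly) \<notin> secant_kernel (scroll_vars d k) r" by (simp add: secant_kernel_def)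
    then show ?case by (intro symbolic_powerI[OF secant_kernel_prime, of _ _ 1]) simp_all
  next
    case (insert i A)
    then have "f i * (\<Prod>i\<in>A. f i) \<in> ?sym ((Suc (\<rho> i) - r) + (\<Sum>i\<in>A. Suc (\<rho> i) - r))"
      using each[of i] by (intro symbolic_power_mult[OF secant_kernel_prime]) auto
    then show ?case unfolding prod.insert[OF insert(1,2)] sum.insert[OF insert(1,2)] .
  qed
  then have "p \<in> ?sym (\<Sum>i\<in>{1..l}. Suc (\<rho> i) - r)" by (simp add: p)
  moreover have "int (\<Sum>i\<in>{1..l}. Suc (\<rho> i) - r) = int s"
    unfolding s[symmetric] of_nat_sum
  proof (rule sum.cong[OF refl])
    fix i assume "i \<in> {1..l}"
    from each[OF this] show "int (Suc (\<rho> i) - r) = int (total_degree (f i)) - int r"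
      by (simp add: of_nat_diff)
  qed
  ultimately show "p \<in> ?sym s" by (simp only: of_nat_eq_iff)
qed

text \<open>A minor of \<open>X_\<rho>\<close> has degree \<open>\<rho> + 1\<close>, so with
  \<open>r \<le> \<rho>\<close> each factor contributes at least 1 to the sum. Hence there are at
  most \<open>s\<close> factors, each from a finite set.\<close>

lemma finite_minor_products: "finite (minor_products d k r s :: (nat \<times> nat, 'a::comm_ring_1) mpoly set)"
proof -
  define F where "F = (\<Union>\<rho>\<in>{..d}. minors_ge (\<rho> + 1) (scroll_mat d k \<rho>) :: (nat \<times> nat, 'a) mpoly set)"
  have fin: "finite (minors t A)" for t and A :: "(nat \<times> nat, 'a) mpoly mat"
  proof (rule finite_subset)
    show "minors t A \<subseteq> (\<lambda>(S, T). det (submatrix A S T)) ` (Pow {..<dim_row A} \<times> Pow {..<dim_col A})"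
      by (auto simp: minors_def)
  qed simp
  have "finite (minors_ge (\<rho> + 1) (scroll_mat d k \<rho> :: (nat \<times> nat, 'a) mpoly mat))" for \<rho>
    unfolding minors_ge_scroll_mat[OF refl] by (rule fin)
  then have F: "finite F" unfolding F_def by (rule finite_UN_I[OF finite_atMost])
  have "minor_products d k r s \<subseteq> (\<Union>l\<in>{..s}. (\<lambda>f. \<Prod>i\<in>{1..l}. f i) ` ({1..l} \<rightarrow>\<^sub>E F))"
  proof
    fix p :: "(nat \<times> nat, 'a) mpoly" assume "p \<in> minor_products d k r s"
    then obtain l f \<rho> where p: "p = (\<Prod>i\<in>{1..l}. f i)"
      and f: "\<forall>i\<in>{1..l::nat}. r \<le> \<rho> i \<and> \<rho> i \<le> d \<and> f i \<in> minors_ge (\<rho> i + 1) (scroll_mat d k (\<rho> i))"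
      and s: "(\<Sum>i\<in>{1..l}. int (total_degree (f i)) - int r) = int s"
      unfolding minor_products_def by blast
    have one: "1 \<le> int (total_degree (f i)) - int r" if "i \<in> {1..l}" for i
    proof -
      have fi: "f i \<in> minors_ge (\<rho> i + 1) (scroll_mat d k (\<rho> i))" "\<rho> i \<le> d" "r \<le> \<rho> i" using f that by blast+
      show ?thesis using minors_geE[OF fi(1,2)] fi(3) by fastforce
    qed
    have "int l = (\<Sum>i\<in>{1..l}. 1)" by simp
    also have "\<dots> \<le> int s" unfolding s[symmetric] by (rule sum_mono) (rule one)
    finally have "l \<le> s" by simp
    moreover have "p = (\<Prod>i\<in>{1..l}. restrict f {1..l} i)" unfolding p by (rule prod.cong) auto
    moreover have "restrict f {1..l} \<in> {1..l} \<rightarrow>\<^sub>E F" using f by (auto simp: F_def)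
    ultimately show "p \<in> (\<Union>l\<in>{..s}. (\<lambda>f. \<Prod>i\<in>{1..l}. f i) ` ({1..l} \<rightarrow>\<^sub>E F))" by blast
  qed
  then show ?thesis
    by (rule finite_subset) (use F in \<open>auto intro!: finite_imageI finite_PiE\<close>)
qed

text \<open>The gaps push the last element of a chain with \<open>l\<close> elements to position
  \<open>(l - 1) K\<close> or beyond, so the corresponding matrix exists.\<close>

lemma chain_length_le:
  assumes "chain (Suc (Suc k)) c" "set c \<subseteq> {..<Suc d * Suc k}" "c \<noteq> []"
  shows "length c - 1 \<le> d"
proof -
  have "c ! (length c - 1) < Suc d * Suc k" using assms(2,3) by (simp add: subset_iff)
  moreover have "(length c - 1) * Suc k \<le> c ! (length c - 1)"
    using chain_ge[OF assms(1), of "length c - 1"] assms(3) by simp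
  ultimately have "(length c - 1) * Suc k < Suc d * Suc k" by (rule le_less_trans[rotated])
  then show ?thesis by (simp only: mult_less_cancel2 less_Suc_eq_le)
qed

lemma chain_minor_in_minors:
  assumes "chain (Suc (Suc k)) c" "set c \<subseteq> {..<Suc d * Suc k}" "length c = Suc \<rho>"
  shows "\<rho> \<le> d" "strict_mono_on {..<Suc \<rho>} (\<lambda>b. c ! b - b * Suc k)"
    "b < Suc \<rho> \<Longrightarrow> c ! b - b * Suc k < (d - \<rho> + 1) * Suc k"
    "chain_minor (Suc k) c \<in> minors_ge (\<rho> + 1) (scroll_mat d k \<rho> :: (nat \<times> nat, 'a::comm_ring_1) mpoly mat)"
proof -
  show \<rho>: "\<rho> \<le> d" using chain_length_le[OF assms(1,2)] assms(3) by fastforce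
  show mono: "strict_mono_on {..<Suc \<rho>} (\<lambda>b. c ! b - b * Suc k)"
    using chain_columns_mono[OF assms(1)] unfolding assms(3) .
  have bd: "c ! b - b * Suc k < (d - \<rho> + 1) * Suc k" if "b < Suc \<rho>" for b
    unfolding scroll_columns_bound[OF \<rho>] using chain_columns_bound[OF assms(1,2), of b] that assms(3) by simp
  then show "b < Suc \<rho> \<Longrightarrow> c ! b - b * Suc k < (d - \<rho> + 1) * Suc k" by blast
  show "chain_minor (Suc k) c \<in> minors_ge (\<rho> + 1) (scroll_mat d k \<rho> :: (nat \<times> nat, 'a) mpoly mat)"
    unfolding minors_ge_scroll_mat[OF refl] minors_scroll_mat chain_minor_def assms(3)
    using mono bd by blast
qed

lemma chain_minors_in_products:
  assumes Ds: "Ds \<in> chains_of d k r s" and s: "s \<ge> 1"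
  shows "(\<Prod>c\<leftarrow>Ds. chain_minor (Suc k) c) \<in> (minor_products d k r s :: (nat \<times> nat, 'a::comm_ring_1) mpoly set)"
proof -
  define l where "l = length Ds"
  define f where "f i = (chain_minor (Suc k) (Ds ! (i - 1)) :: (nat \<times> nat, 'a) mpoly)" for i
  define \<rho> where "\<rho> i = length (Ds ! (i - 1)) - 1" for i
  have Ds': "chain (Suc (Suc k)) c" "r < length c" "set c \<subseteq> {..<Suc d * Suc k}" if "c \<in> set Ds" for c
    using Ds that by (auto simp: chains_of_def)
  have img: "{1..l} = Suc ` {..<l}" by (simp add: image_Suc_lessThan)
  have nth: "Ds ! (i - 1) \<in> set Ds" if "i \<in> {1..l}" for i using that by (auto simp: l_def)
  have len: "length (Ds ! (i - 1)) = Suc (\<rho> i)" if "i \<in> {1..l}" for i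
    using Ds'(2)[OF nth[OF that]] by (simp add: \<rho>_def)
  have deg: "total_degree (f i) = Suc (\<rho> i)" if i: "i \<in> {1..l}" for i
    unfolding f_def chain_minor_def len[OF i]
    by (rule total_degree_scroll_minor[OF chain_minor_in_minors(2)[OF Ds'(1,3) len]]) (use nth i in simp_all)
  have "(\<Prod>c\<leftarrow>Ds. chain_minor (Suc k) c) = (\<Prod>i\<in>{1..l}. f i)"
    unfolding img by (subst prod.reindex) (simp_all add: f_def l_def prod.list_conv_set_nth atLeast0LessThan)
  \<comment> \<open>The empty family belongs to \<open>s = 0\<close> and is excluded here, in
    accordance with the condition on \<open>l\<close>.\<close>
  moreover have "l \<ge> 1" using Ds s by (cases Ds) (auto simp: chains_of_def l_def)
  moreover have "r \<le> \<rho> i \<and> \<rho> i \<le> d \<and> f i \<in> minors_ge (\<rho> i + 1) (scroll_mat d k (\<rho> i))" if i: "i \<in> {1..l}" for i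
    using chain_minor_in_minors(1,4)[OF Ds'(1,3) len, OF nth nth i, OF i i] Ds'(2)[OF nth[OF i]] len[OF i]
    unfolding f_def by auto
  moreover have "(\<Sum>i\<in>{1..l}. int (total_degree (f i)) - int r) = int s"
  proof -
    have "(\<Sum>i\<in>{1..l}. int (total_degree (f i)) - int r) = (\<Sum>i\<in>{1..l}. int (length (Ds ! (i - 1)) - r))"
    proof (rule sum.cong[OF refl])
      fix i assume i: "i \<in> {1..l}"
      show "int (total_degree (f i)) - int r = int (length (Ds ! (i - 1)) - r)"
        using deg[OF i] len[OF i] Ds'(2)[OF nth[OF i]] by (simp add: of_nat_diff)
    qed
    also have "\<dots> = int (\<Sum>c\<leftarrow>Ds. length c - r)"
      unfolding img by (subst sum.reindex) (simp_all add: l_def sum.list_conv_set_nth atLeast0LessThan)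
    finally show ?thesis using Ds by (simp add: chains_of_def)
  qed
  ultimately show ?thesis unfolding minor_products_def by blast
qed

text \<open>For the given order it remains to compare leading monomials: that of an element of the
  symbolic power is a multiple of the product of chains that leads one of the products of
  minors.\<close>

lemma minor_products_groebner:
  assumes d: "d \<ge> 1" and r: "r \<ge> 1" and s: "s \<ge> 1"
    and diag: "diagonal_term_order (scroll_vars d k)
      ((scroll_mat d k :: nat \<Rightarrow> (nat \<times> nat, 'a::idom) mpoly mat) ` {1..d}) tord"
  shows "groebner_basis (scroll_vars d k) tord (minor_products d k r s)
    (symbolic_power (mpoly_ring (scroll_vars d k)) (secant_kernel (scroll_vars d k) r :: (nat \<times> nat, 'a) mpoly set) s)"
  unfolding groebner_basis_def
proof (intro conjI finite_minor_products minor_products_sub)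
  let ?V = "scroll_vars d k" and ?K = "Suc k"
  let ?G = "minor_products d k r s :: (nat \<times> nat, 'a) mpoly set"
  let ?sym = "symbolic_power (mpoly_ring ?V) (secant_kernel ?V r :: (nat \<times> nat, 'a) mpoly set) s"
  have t: "term_order_on ?V tord" using diag by (simp add: diagonal_term_order_def)
  note sw = diagonal_order_swap_order[OF diag d]
  have lmV: "leading_monomials tord S \<subseteq> {p. vars p \<subseteq> ?V}" if "S \<subseteq> ?sym" for S :: "(nat \<times> nat, 'a) mpoly set"
  proof
    fix q assume "q \<in> leading_monomials tord S"
    then obtain m p where q: "q = single m 1" "p \<in> S" "m \<in> keys p"
      by (auto simp: leading_monomials_def is_leading_monomial_def)
    have "p \<in> ?sym" using q that by blast
    then have "vars p \<subseteq> ?V" unfolding secant_symbolic_power_iff by blast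
    then show "q \<in> {p. vars p \<subseteq> ?V}"
      using vars_single_sub[OF keys_sub_vars[OF q(3)], of ?V] by (simp add: q(1))
  qed
  have LG: "leading_monomials tord ?G \<subseteq> leading_monomials tord ?sym"
    using minor_products_sub unfolding leading_monomials_def by blast
  note IG = Idl_ideal[OF lmV[OF minor_products_sub]]
  show "Idl\<^bsub>mpoly_ring ?V\<^esub> (leading_monomials tord ?G) = Idl\<^bsub>mpoly_ring ?V\<^esub> (leading_monomials tord ?sym)"
  proof (rule equalityI)
    show "Idl\<^bsub>mpoly_ring ?V\<^esub> (leading_monomials tord ?G) \<subseteq> Idl\<^bsub>mpoly_ring ?V\<^esub> (leading_monomials tord ?sym)"
    proof (rule Idl_least[OF Idl_ideal[OF lmV[OF subset_refl]]])
      show "leading_monomials tord ?G \<subseteq> Idl\<^bsub>mpoly_ring ?V\<^esub> (leading_monomials tord ?sym)"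
        by (rule subsetI) (rule Idl_self, rule subsetD[OF LG])
    qed
    show "Idl\<^bsub>mpoly_ring ?V\<^esub> (leading_monomials tord ?sym) \<subseteq> Idl\<^bsub>mpoly_ring ?V\<^esub> (leading_monomials tord ?G)"
    proof (rule Idl_least[OF IG], rule subsetI)
      fix q assume "q \<in> leading_monomials tord ?sym"
      then obtain m f where q: "q = single m 1" and f: "f \<in> ?sym" and lm: "is_leading_monomial tord f m"
        by (auto simp: leading_monomials_def)
      have fV: "vars f \<subseteq> ?V" and ord: "subst_vars (normal_param r) f \<in> order_ge s"
        using f by (simp_all add: secant_symbolic_power_iff)
      obtain Ds U where co: "Ds \<in> chains_of d k r s" and m: "m = mon ?K U + mon ?K (mset (concat Ds))"
        and U: "keys (mon ?K U) \<subseteq> ?V"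
        using leading_chains_of[OF t sw fV lm ord] .
      let ?g = "\<Prod>c\<leftarrow>Ds. chain_minor ?K c :: (_, 'a) mpoly"
      have "is_leading_monomial tord ?g (mon ?K (mset (concat Ds)))"
      proof (rule conjunct1[OF leading_chain_minors[OF t]], intro conjI)
        fix c assume c: "c \<in> set Ds"
        then have ch: "chain (Suc ?K) c" "r < length c" and bd: "set c \<subseteq> {..<Suc d * ?K}"
          using co by (auto simp: chains_of_def)
        show "chain (Suc ?K) c" "set c \<subseteq> {..<Suc d * ?K}" by (rule ch bd)+
        obtain \<rho> where \<rho>: "length c = Suc \<rho>" using ch(2) by (cases "length c") simp_all
        \<comment> \<open>Because \<open>r\<close> is at least 1, every chain that occurs has at
          least two elements, so its minor belongs to one of the matrices
          \<open>X_1, ..., X_d\<close> to which the diagonal condition applies.\<close>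
        have "1 \<le> \<rho>" using ch(2) r \<rho> by simp
        from diagonal_order_scroll_minor[OF diag this chain_minor_in_minors(1,2)[OF ch(1) bd \<rho>]
            chain_minor_in_minors(3)[OF ch(1) bd \<rho>]]
        show "is_leading_monomial tord (chain_minor ?K c :: (_, 'a) mpoly) (mon ?K (mset c))"
          unfolding chain_minor_def chain_positions[OF ch(1), symmetric] \<rho> .
      qed
      moreover have "?g \<in> ?G" by (rule chain_minors_in_products[OF co s])
      ultimately have "single (mon ?K (mset (concat Ds))) 1 \<in> leading_monomials tord ?G"
        unfolding leading_monomials_def by blast
      then have in_I: "single (mon ?K (mset (concat Ds))) 1 \<in> Idl\<^bsub>mpoly_ring ?V\<^esub> (leading_monomials tord ?G)"
        by (rule Idl_self)
      from U have "single (mon ?K U) 1 * single (mon ?K (mset (concat Ds))) 1 \<in> Idl\<^bsub>mpoly_ring ?V\<^esub> (leading_monomials tord ?G)"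
        by (intro mpoly_ideal_mult[OF IG _ in_I] vars_single_sub)
      then show "q \<in> Idl\<^bsub>mpoly_ring ?V\<^esub> (leading_monomials tord ?G)"
        by (simp add: q m mult_single)
    qed
  qed
qed

theorem corollary6p9:
  fixes d k :: nat
    and I :: "(nat \<times> nat, 'a::alg_closed_field) mpoly set"
    and V :: "(nat \<times> nat) set"
  assumes "d \<ge> 1"
  defines "V \<equiv> scroll_vars d k"
    and "I \<equiv> scroll_ideal d k"
  shows "differentially_perfect V I \<and>
    (\<forall>r\<ge>1. \<forall>s\<ge>1. \<forall>tord.
       diagonal_term_order V
         ((scroll_mat d k :: nat \<Rightarrow> (nat \<times> nat, 'a) mpoly mat) ` {1..d}) tord \<longrightarrow>
       groebner_basis V tord
         {(\<Prod>i\<in>{1..l}. f i) | (l :: nat) (f :: nat \<Rightarrow> (nat \<times> nat, 'a) mpoly) (\<rho> :: nat \<Rightarrow> nat).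
            l \<ge> 1 \<and>
            (\<forall>i\<in>{1..l}. r \<le> \<rho> i \<and> \<rho> i \<le> d \<and> f i \<in> minors_ge (\<rho> i + 1) (scroll_mat d k (\<rho> i))) \<and>
            (\<Sum>i\<in>{1..l}. int (total_degree (f i)) - int r) = int s}
         (symbolic_power (mpoly_ring V) (secant_ideal V I r) s))"
proof (intro conjI allI impI)
  have sec: "secant_ideal V I r = secant_kernel V r" if "r \<ge> 1" for r
    unfolding I_def by (rule secant_ideal_scroll[OF assms(1) _ that]) (simp add: V_def)
  show "differentially_perfect V I"
    unfolding differentially_perfect_def diff_perfect_at_def Let_def
  proof (intro allI impI)
    fix r s :: nat assume rs: "1 \<le> r" "1 \<le> s"
    have rs': "1 \<le> r + s - 1" using rs by simp
    show "symbolic_power (mpoly_ring V) (secant_ideal V I r) s =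
        secant_ideal V I (r + s - 1) \<oplus>\<^bsub>ideals_set (mpoly_ring V)\<^esub>
        (\<Oplus>\<^bsub>ideals_set (mpoly_ring V)\<^esub> i \<in> {1..s - 1}.
           symbolic_power (mpoly_ring V) (secant_ideal V I r) i
             \<otimes>\<^bsub>ideals_set (mpoly_ring V)\<^esub> symbolic_power (mpoly_ring V) (secant_ideal V I r) (s - i))"
      unfolding sec[OF rs(1)] sec[OF rs']
      unfolding V_def by (rule secant_kernel_diff_perfect[OF rs(2)])
  qed
  fix r s :: nat and tord
  assume rs: "1 \<le> r" "1 \<le> s"
    and diag: "diagonal_term_order V ((scroll_mat d k :: nat \<Rightarrow> (nat \<times> nat, 'a) mpoly mat) ` {1..d}) tord"
  show "groebner_basis V tord
         {(\<Prod>i\<in>{1..l}. f i) | (l :: nat) (f :: nat \<Rightarrow> (nat \<times> nat, 'a) mpoly) (\<rho> :: nat \<Rightarrow> nat).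
            l \<ge> 1 \<and>
            (\<forall>i\<in>{1..l}. r \<le> \<rho> i \<and> \<rho> i \<le> d \<and> f i \<in> minors_ge (\<rho> i + 1) (scroll_mat d k (\<rho> i))) \<and>
            (\<Sum>i\<in>{1..l}. int (total_degree (f i)) - int r) = int s}
         (symbolic_power (mpoly_ring V) (secant_ideal V I r) s)"
    using minor_products_groebner[OF assms(1) rs diag[unfolded V_def]]
    unfolding sec[OF rs(1)] unfolding V_def minor_products_def .
qed

end
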